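(* Let $\ell\ge4$ be even, let $\Phi$ be a root system of type $D_\ell$, and let $\omega\in W_{A_\circ}=\{1,\omega_1,\omega_{\ell-1},\omega_\ell\}$. Then for every $q\in\mathbb{Z}_{>0}$: - if $\omega=1$ and $q\notin2\mathbb{Z}$: $\chi_{\Phi,q}(\omega) = (q-1)(q-3)\cdots(q-(2\ell-3))\,(q-(\ell-1))$; - if $\omega=1$ and $q\in2\mathbb{Z}$: $\chi_{\Phi,q}(\omega) = (q-2)(q-4)\cdots(q-2(\ell-2))\,\bigl(q^2-2(\ell-1)q+\tfrac{\ell(\ell-1)}{2}\bigr)$; - if $\omega=\omega_1$ and $q\notin2\mathbb{Z}$: $\chi_{\Phi,q}(\omega)=0$; - if $\omega=\omega_1$ and $q\in2\mathbb{Z}$: $\chi_{\Phi,q}(\omega) = (q-2)(q-4)\cdots(q-2(\ell-2))$; - if $\omega\in\{\omega_{\ell-1},\omega_\ell\}$ and $\gcd\{4,q\}=1$: $\chi_{\Phi,q}(\omega)=0$; - if $\omega\in\{\omega_{\ell-1},\omega_\ell\}$ and $\gcd\{4,q\}=2$: $\chi_{\Phi,q}(\omega) = \bigl(q-(\tfrac{3\ell}{2}-2)\bigr)\prod_{i=1}^{\ell/2-1}(q-(4i-2)) = (q-2)(q-6)\cdots(q-2(\ell-3))\,\bigl(q-(\tfrac{3\ell}{2}-2)\bigr)$; - if $\omega\in\{\omega_{\ell-1},\omega_\ell\}$ and $\gcd\{4,q\}=4$: $\chi_{\Phi,q}(\omega) = \bigl(q-\tfrac{\ell}{2}\bigr)\prod_{i=1}^{\ell/2-1}(q-4i)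 = (q-4)(q-8)\cdots(q-2(\ell-2))\,\bigl(q-\tfrac{\ell}{2}\bigr)$.
   Context: Let $\Phi = \{\pm e_i\pm e_k : i<k\}\subset E=\mathbb{R}^\ell$, with simple roots $\alpha_i=e_i-e_{i+1}$ ($1\le i\le\ell-1$), $\alpha_\ell=e_{\ell-1}+e_\ell$, Weyl group $W$ and the standard inner product $(\cdot,\cdot)$. The coweight lattice is $Z := \{x\in E : (\alpha,x)\in\mathbb{Z}\ \forall\alpha\in\Phi\}$. For $q\in\mathbb{Z}_{>0}$, $M(\Phi;q) := \{x+qZ\in Z/qZ : (\beta,x)\not\equiv0\pmod q\ \forall\beta\in\Phi\}$; $W$ acts on it via $w(x+qZ)=w(x)+qZ$, and $\chi_{\Phi,q}(w) := \#\{t\in M(\Phi;q) : w(t)=t\}$. Let $\tilde\alpha=\sum_{i=1}^\ell n_i\alpha_i$ be the highest root, $n_0:=1$, $J:=\{i\in\{0,\dots,\ell\}: n_i=1\}$ (here $J=\{0,1,\ell-1,\ell\}$). Let $w_0$ be the longest element of $W$; for $j\in J\setminus\{0\}$ let $w_j$ be the longest element of the subgroup generated by the simple reflections $s_{\alpha_i}$, $i\ne j$; put $\omega_j := w_jw_0$ and $\omega_0:=1$. Let $A_\circ=\{x\in E : (\alpha_i,x)>0\ \forall i,\ (\tilde\alpha,x)<1\}$; $W_{A_\circ}$ is the subgroup of $w\in W$ mapping the image of $A_\circ$ in $E/Z$ to itself, and $W_{A_\circ}=\{\omega_j : j\in J\}$. *)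

theory Defs
  imports
    "HOL-Analysis.Analysis"
    "HOL-Library.Set_Algebras"
    "HOL-Algebra.Bij"
    "HOL-Algebra.Generated_Groups"
begin

section \<open>Groups generated by reflections\<close>

definition reflect_along :: "'a::euclidean_space \<Rightarrow> 'a \<Rightarrow> 'a" where
  "reflect_along a x = x - (2 * (x \<bullet> a) / (a \<bullet> a)) *\<^sub>R a"

text \<open>
  The multiplication of the group \<^term>\<open>BijGroup UNIV\<close> of bijections of the whole space is
  composition of functions.
\<close>

definition refl_group :: "'a::euclidean_space set \<Rightarrow> ('a \<Rightarrow> 'a) set" where
  "refl_group R = generate (BijGroup UNIV) (reflect_along ` R)"

text \<open>
  In the next two definitions \<open>S\<close> is a set of simple roots, and lengths are taken with respect to
  the reflections along the elements of \<open>S\<close>.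
\<close>

definition refl_length :: "'a::euclidean_space set \<Rightarrow> ('a \<Rightarrow> 'a) \<Rightarrow> nat" where
  "refl_length S w =
     (LEAST n. \<exists>as. length as = n \<and> set as \<subseteq> S \<and> w = foldr (\<circ>) (map reflect_along as) id)"

definition longest_element :: "'a::euclidean_space set \<Rightarrow> 'a \<Rightarrow> 'a" where
  "longest_element S =
     (THE w. w \<in> refl_group S \<and> (\<forall>v \<in> refl_group S. refl_length S v \<le> refl_length S w))"


section \<open>Root systems with simple roots \<open>\<alpha> 1, \<dots>, \<alpha> l\<close>\<close>

definition highest_root :: "'a::euclidean_space set \<Rightarrow> (nat \<Rightarrow> 'a) \<Rightarrow> nat \<Rightarrow> 'a" where
  "highest_root \<Phi> \<alpha> l =
     (THE \<beta>. \<beta> \<in> \<Phi> \<and> (\<forall>\<gamma>\<in>\<Phi>. \<exists>c :: nat \<Rightarrow> nat. \<beta> - \<gamma> = (\<Sum>i=1..l. real (c i) *\<^sub>R \<alpha> i)))"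

definition omega :: "(nat \<Rightarrow> 'a::euclidean_space) \<Rightarrow> nat \<Rightarrow> nat \<Rightarrow> 'a \<Rightarrow> 'a" where
  "omega \<alpha> l j = longest_element (\<alpha> ` ({1..l} - {j})) \<circ> longest_element (\<alpha> ` {1..l})"

definition coweight_lattice :: "'a::euclidean_space set \<Rightarrow> 'a set" where
  "coweight_lattice \<Phi> = {x. \<forall>\<alpha>\<in>\<Phi>. \<alpha> \<bullet> x \<in> \<int>}"

definition alcove :: "'a::euclidean_space set \<Rightarrow> (nat \<Rightarrow> 'a) \<Rightarrow> nat \<Rightarrow> 'a set" where
  "alcove \<Phi> \<alpha> l = {x. (\<forall>i\<in>{1..l}. \<alpha> i \<bullet> x > 0) \<and> highest_root \<Phi> \<alpha> l \<bullet> x < 1}"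

text \<open>
  Elements of a quotient \<open>E/L\<close> are cosets \<^term>\<open>x +o L = {x + z | z. z \<in> L}\<close>.  A linear map \<open>w\<close>
  preserving \<open>L\<close> acts on them by taking images: \<^term>\<open>w ` (x +o L)\<close> is \<^term>\<open>w x +o L\<close>.
\<close>

definition alcove_stabilizer :: "'a::euclidean_space set \<Rightarrow> (nat \<Rightarrow> 'a) \<Rightarrow> nat \<Rightarrow> ('a \<Rightarrow> 'a) set" where
  "alcove_stabilizer \<Phi> \<alpha> l =
     {w \<in> refl_group \<Phi>.
        (let \<A> = (\<lambda>x. x +o coweight_lattice \<Phi>) ` alcove \<Phi> \<alpha> l in (\<lambda>t. w ` t) ` \<A> = \<A>)}"

definition toric_complement :: "'a::euclidean_space set \<Rightarrow> nat \<Rightarrow> 'a set set" where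
  "toric_complement \<Phi> q =
     {x +o ((\<lambda>z. real q *\<^sub>R z) ` coweight_lattice \<Phi>) | x.
        x \<in> coweight_lattice \<Phi> \<and> (\<forall>\<beta>\<in>\<Phi>. \<not> (\<exists>k::int. \<beta> \<bullet> x = real q * of_int k))}"

definition fixed_count :: "'a::euclidean_space set \<Rightarrow> nat \<Rightarrow> ('a \<Rightarrow> 'a) \<Rightarrow> nat" where
  "fixed_count \<Phi> q w = card {t \<in> toric_complement \<Phi> q. w ` t = t}"


section \<open>Type D\<close>

text \<open>Here \<open>e 1, \<dots>, e l\<close> are meant to be the vectors of the standard orthonormal basis.\<close>

definition D_roots :: "(nat \<Rightarrow> 'a::euclidean_space) \<Rightarrow> nat \<Rightarrow> 'a set" where
  "D_roots e l =
     (\<Union>k\<in>{1..l}. \<Union>i\<in>{1..<k}. {e i + e k, e i - e k, - e i + e k, - e i - e k})"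

definition D_simple :: "(nat \<Rightarrow> 'a::euclidean_space) \<Rightarrow> nat \<Rightarrow> nat \<Rightarrow> 'a" where
  "D_simple e l i = (if i = l then e (l - 1) + e l else e i - e (i + 1))"

end

theory Submission
  imports Defs
begin

text \<open>
  In the coordinates \<open>e 1, \<dots>, e l\<close> the Weyl group consists of the permutations of the coordinates
  combined with an even number of sign changes.  Such an element is the identity as soon as it maps
  one point with positive decreasing coordinates into the dominant chamber.  This determines the
  longest elements: the length of an element is the number of positive roots that it makes
  negative, so the longest element of a parabolic subgroup changes the sign of every positive root of
  the subsystem, and two elements doing so and permuting the other positive roots agree.  As \<open>l\<close> is
  even, the longest element of the whole group is \<open>- id\<close>, and the elements \<open>omega\<close> become explicit:
  \<open>omega 1\<close> changes the sign of the first and the last coordinate, \<open>omega l\<close> reverses the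
  coordinates and changes all signs, and \<open>omega (l - 1)\<close> is the conjugate of \<open>omega l\<close> under the sign
  change of \<open>e l\<close>.

  Each of these maps the fundamental alcove to itself after translation by a minuscule coweight.
  Conversely, if an element of the Weyl group sends a point of the alcove to the alcove translated by a
  coweight, then the positive roots take values \<open>0\<close> or \<open>1\<close> on this coweight, which leaves
  the minuscule ones; undoing the corresponding symmetry yields an element that maps a point of the
  alcove into the alcove, hence the identity.

  The coweights are the halves of the integer vectors whose entries have equal parity.  Modulo \<open>q\<close> times the coweight lattice, a
  coset has exactly two representatives with doubled coordinates in \<open>{0..<2 * q}\<close>, whether \<open>q\<close> is
  even or odd.  The toric complement corresponds to the families of residues modulo \<open>2 * q\<close> of equal parity
  that are pairwise different up to sign, so twice the count is a number of families of pairwise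
  inequivalent residues.  Such families are counted entry by entry when all
  equivalence classes have the same size; each exceptional class (residues congruent to their
  negatives) contributes at most one entry and adds one term.  For \<open>omega 1\<close> the first and
  last entries of a fixed family are the residues \<open>0\<close> and \<open>q\<close>.  For \<open>omega l\<close> mirror
  images add up to \<open>q\<close>, the family is determined by its first half, and the equivalence becomes
  equality up to sign modulo \<open>q\<close> instead of \<open>2 * q\<close>, whose classes have four elements.
\<close>

section \<open>Lengths in groups generated by reflections\<close>

lemma linear_reflect_along: "linear (reflect_along a)"
  by (rule linearI)
    (auto simp: reflect_along_def inner_add_left algebra_simps add_divide_distrib scaleR_add_left)

lemma reflect_along_self: "a \<noteq> 0 \<Longrightarrow> reflect_along a a = - a"
  by (simp add: reflect_along_def scaleR_2)

lemma reflect_along_involution: "reflect_along a (reflect_along a x) = x"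
  by (cases "a = 0") (auto simp: reflect_along_def inner_diff_left field_simps)

definition refl_word :: "'a::euclidean_space list \<Rightarrow> 'a \<Rightarrow> 'a" where
  "refl_word as = foldr (\<circ>) (map reflect_along as) id"

lemma refl_word_simps [simp]:
  "refl_word [] = id" "refl_word (a # as) = reflect_along a \<circ> refl_word as"
  by (simp_all add: refl_word_def)

lemma refl_word_append: "refl_word (as @ bs) = refl_word as \<circ> refl_word bs"
  by (induction as) (auto simp: o_assoc)

lemma refl_word_rev: "refl_word (rev as) (refl_word as x) = x"
  by (induction as arbitrary: x) (auto simp: refl_word_append reflect_along_involution)

lemma bij_refl_word: "bij (refl_word as)"
  by (rule o_bij[of "refl_word (rev as)"])
    (use refl_word_rev[of as] refl_word_rev[of "rev as"] in auto)

lemma BijGroup_UNIV_simps: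
  "carrier (BijGroup UNIV) = {f. bij f}"
  "bij f \<Longrightarrow> bij g \<Longrightarrow> f \<otimes>\<^bsub>BijGroup UNIV\<^esub> g = f \<circ> g"
  "\<one>\<^bsub>BijGroup UNIV\<^esub> = id"
  by (auto simp: BijGroup_def Bij_def compose_def fun_eq_iff extensional_def)

text \<open>Reflections are their own inverses, so inverses of generators add nothing to the words.\<close>

lemma refl_group_eq_words: "refl_group R = refl_word ` {as. set as \<subseteq> R}"
proof (intro equalityI subsetI)
  interpret group "BijGroup (UNIV :: 'a set)" by (rule group_BijGroup)
  have bij: "bij (reflect_along a)" for a :: 'a
    using bij_refl_word[of "[a]"] by simp
  have inv: "inv\<^bsub>BijGroup UNIV\<^esub> reflect_along a = reflect_along a" for a :: 'a
    by (rule inv_equality)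
      (auto simp: BijGroup_UNIV_simps bij fun_eq_iff reflect_along_involution)
  fix w
  { assume "w \<in> refl_group R"
    then have "w \<in> generate (BijGroup UNIV) (reflect_along ` R)"
      by (simp add: refl_group_def)
    then show "w \<in> refl_word ` {as. set as \<subseteq> R}"
    proof (induction rule: generate.induct)
      case one
      then show ?case by (intro image_eqI[of _ _ "[]"]) (auto simp: BijGroup_UNIV_simps)
    next
      case (incl h)
      then obtain a where "a \<in> R" "h = reflect_along a" by auto
      then show ?case by (intro image_eqI[of _ _ "[a]"]) auto
    next
      case (inv h)
      then obtain a where "a \<in> R" "h = reflect_along a" by auto
      then show ?case using \<open>\<And>a. inv\<^bsub>BijGroup UNIV\<^esub> reflect_along a = reflect_along a\<close>
        by (intro image_eqI[of _ _ "[a]"]) auto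
    next
      case (eng h1 h2)
      then obtain as bs where "set as \<subseteq> R" "h1 = refl_word as" "set bs \<subseteq> R" "h2 = refl_word bs"
        by blast
      then show ?case
        by (intro image_eqI[of _ _ "as @ bs"])
          (auto simp: refl_word_append BijGroup_UNIV_simps bij_refl_word)
    qed }
  { assume "w \<in> refl_word ` {as. set as \<subseteq> R}"
    then obtain as where "w = refl_word as" "set as \<subseteq> R" by auto
    then have "w \<in> generate (BijGroup UNIV) (reflect_along ` R)"
    proof (induction as arbitrary: w)
      case Nil
      then show ?case
        using generate.one[of "BijGroup UNIV" "reflect_along ` R"]
        by (metis BijGroup_UNIV_simps(3) refl_word_simps(1))
    next
      case (Cons a as)
      have "reflect_along a \<in> generate (BijGroup UNIV) (reflect_along ` R)"
        using Cons.prems by (intro generate.incl) auto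
      moreover have "refl_word as \<in> generate (BijGroup UNIV) (reflect_along ` R)"
        using Cons by auto
      ultimately have "reflect_along a \<otimes>\<^bsub>BijGroup UNIV\<^esub> refl_word as
          \<in> generate (BijGroup UNIV) (reflect_along ` R)"
        by (rule generate.eng)
      then show ?case
        using Cons.prems(1) BijGroup_UNIV_simps(2)[OF bij bij_refl_word, of a as]
        by (metis refl_word_simps(2))
    qed
    then show "w \<in> refl_group R" by (simp add: refl_group_def) }
qed

lemma refl_word_in_refl_group: "set as \<subseteq> R \<Longrightarrow> refl_word as \<in> refl_group R"
  by (auto simp: refl_group_eq_words)

lemma refl_group_induct [consumes 1, case_names id refl]:
  assumes "w \<in> refl_group R" and "Q id"
    and "\<And>a w. a \<in> R \<Longrightarrow> w \<in> refl_group R \<Longrightarrow> Q w \<Longrightarrow> Q (reflect_along a \<circ> w)"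
  shows "Q w"
proof -
  obtain as where "w = refl_word as" "set as \<subseteq> R"
    using assms(1) by (auto simp: refl_group_eq_words)
  then show ?thesis
    by (induction as arbitrary: w) (auto simp: assms refl_word_in_refl_group)
qed

lemma refl_group_comp:
  assumes "v \<in> refl_group R" "w \<in> refl_group R"
  shows "v \<circ> w \<in> refl_group R"
proof -
  obtain as bs where "v = refl_word as" "set as \<subseteq> R" "w = refl_word bs" "set bs \<subseteq> R"
    using assms by (auto simp: refl_group_eq_words)
  then show ?thesis
    using refl_word_in_refl_group[of "as @ bs" R] by (simp add: refl_word_append)
qed

lemma reflect_along_in_refl_group: "a \<in> R \<Longrightarrow> reflect_along a \<in> refl_group R"
  using refl_word_in_refl_group[of "[a]" R] by simp

lemma refl_group_mono: "R \<subseteq> R' \<Longrightarrow> refl_group R \<subseteq> refl_group R'"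
  by (auto simp: refl_group_eq_words)

lemma id_in_refl_group: "id \<in> refl_group R"
  using refl_word_in_refl_group[of "[]" R] by simp

lemma linear_refl_group: "w \<in> refl_group R \<Longrightarrow> linear w"
proof (induction rule: refl_group_induct)
  case id
  show ?case using linear_id by (simp add: id_def)
next
  case (refl a w)
  then show ?case using linear_compose linear_reflect_along by blast
qed

lemma refl_group_inverse:
  assumes "w \<in> refl_group R"
  obtains w' where "w' \<in> refl_group R" "w' \<circ> w = id" "w \<circ> w' = id"
proof -
  obtain as where as: "w = refl_word as" "set as \<subseteq> R"
    using assms by (auto simp: refl_group_eq_words)
  have "refl_word (rev as) \<in> refl_group R"
    by (rule refl_word_in_refl_group) (use as in simp)
  moreover have "refl_word (rev as) \<circ> w = id" "w \<circ> refl_word (rev as) = id"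
    using as refl_word_rev[of as] refl_word_rev[of "rev as"] by (auto simp: fun_eq_iff)
  ultimately show ?thesis using that by blast
qed

text \<open>
  A finite set \<open>P\<close> of vectors on one side of a hyperplane that behaves like the positive roots with
  respect to the simple roots \<open>S\<close>.  That every element of \<open>P\<close> is a nonnegative combination of \<open>S\<close>
  is expressed by duality: a linear functional that is nonnegative on \<open>S\<close> is so on \<open>P\<close>.
\<close>

locale positive_system =
  fixes P S :: "'a::euclidean_space set" and \<rho> :: 'a
  assumes finite_P: "finite P" and S_subset: "S \<subseteq> P"
    and \<rho>_pos: "\<beta> \<in> P \<Longrightarrow> 0 < \<rho> \<bullet> \<beta>"
    and refl_P: "\<alpha> \<in> S \<Longrightarrow> \<beta> \<in> P \<Longrightarrow> \<beta> \<noteq> \<alpha> \<Longrightarrow> reflect_along \<alpha> \<beta> \<in> P"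
    and dual_cone: "linear f \<Longrightarrow> (\<And>\<alpha>. \<alpha> \<in> S \<Longrightarrow> 0 \<le> f \<alpha>) \<Longrightarrow> \<beta> \<in> P \<Longrightarrow> 0 \<le> (f \<beta> :: real)"
    and preserving_trivial: "w \<in> refl_group S \<Longrightarrow> w ` P \<subseteq> P \<Longrightarrow> w = id"
begin

lemma neg_notin: "\<beta> \<in> P \<Longrightarrow> - \<beta> \<notin> P"
  using \<rho>_pos[of \<beta>] \<rho>_pos[of "-\<beta>"] by auto

lemma nonzero: "\<beta> \<in> P \<Longrightarrow> \<beta> \<noteq> 0"
  using \<rho>_pos[of \<beta>] by auto

lemma refl_group_roots:
  assumes "w \<in> refl_group S" "\<beta> \<in> P"
  shows "w \<beta> \<in> P \<or> - w \<beta> \<in> P"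
  using assms(1)
proof (induction rule: refl_group_induct)
  case id
  then show ?case using assms by simp
next
  case (refl a w)
  then have a: "a \<in> P" "a \<noteq> 0" using S_subset nonzero by auto
  have neg: "reflect_along a (- x) = - reflect_along a x" for x
    using linear_reflect_along linear_neg by blast
  show ?case
  proof (cases "w \<beta> = a \<or> w \<beta> = - a")
    case True
    then show ?thesis using a neg by (auto simp: reflect_along_self)
  next
    case False
    then have "- w \<beta> \<noteq> a" by auto
    then show ?thesis using refl False refl_P[of a "w \<beta>"] refl_P[of a "- w \<beta>"] by (auto simp: neg)
  qed
qed

definition inversions :: "('a \<Rightarrow> 'a) \<Rightarrow> 'a set" where
  "inversions w = {\<beta> \<in> P. - w \<beta> \<in> P}"

lemma finite_inversions: "finite (inversions w)"
  using finite_P by (simp add: inversions_def)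

text \<open>
  The reflection along a simple root \<open>\<alpha>\<close> permutes the positive roots other than \<open>\<alpha>\<close>, so composing
  with it changes the inversions only at \<open>\<alpha>\<close>, up to relabelling.
\<close>

lemma card_inversions_comp:
  assumes w: "w \<in> refl_group S" and \<alpha>: "\<alpha> \<in> S"
  shows "card (inversions (w \<circ> reflect_along \<alpha>)) + (if - w \<alpha> \<in> P then 1 else 0) =
    card (inversions w) + (if w \<alpha> \<in> P then 1 else 0)"
proof -
  let ?s = "reflect_along \<alpha>"
  let ?A = "inversions w - {\<alpha>}" and ?B = "inversions (w \<circ> ?s) - {\<alpha>}"
  have \<alpha>P: "\<alpha> \<in> P" "\<alpha> \<noteq> 0" using \<alpha> S_subset nonzero by auto
  have neq: "?s \<beta> \<noteq> \<alpha>" if "\<beta> \<in> P" for \<beta>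
    by (metis \<alpha>P neg_notin reflect_along_involution reflect_along_self that)
  have "bij_betw ?s ?B ?A"
    by (rule bij_betw_byWitness[of _ ?s])
      (use \<alpha> neq in \<open>auto simp: inversions_def reflect_along_involution intro: refl_P\<close>)
  then have eq: "card ?A = card ?B" by (simp add: bij_betw_same_card)
  have "w (?s \<alpha>) = - w \<alpha>"
    using \<alpha>P linear_refl_group[OF w] by (simp add: reflect_along_self linear_neg)
  then have mem: "\<alpha> \<in> inversions (w \<circ> ?s) \<longleftrightarrow> w \<alpha> \<in> P" "\<alpha> \<in> inversions w \<longleftrightarrow> - w \<alpha> \<in> P"
    using \<alpha>P(1) unfolding inversions_def by (simp_all only: mem_Collect_eq comp_apply minus_minus simp_thms)
  have "card (inversions u) = card (inversions u - {\<alpha>}) + (if \<alpha> \<in> inversions u then 1 else 0)" for u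
    using card.remove[OF finite_inversions, of \<alpha> u] by auto
  from this[of w] this[of "w \<circ> ?s"] show ?thesis
    using eq unfolding mem by linarith
qed

lemma simple_dichotomy:
  assumes "w \<in> refl_group S" "\<alpha> \<in> S"
  shows "w \<alpha> \<in> P \<longleftrightarrow> - w \<alpha> \<notin> P"
  using refl_group_roots[of w \<alpha>] assms S_subset neg_notin by auto

lemma card_inversions_word: "set as \<subseteq> S \<Longrightarrow> card (inversions (refl_word as)) \<le> length as"
proof (induction as rule: rev_induct)
  case Nil
  have "inversions id = {}" using neg_notin by (auto simp: inversions_def)
  then show ?case by (metis card.empty refl_word_simps(1) le0)
next
  case (snoc a as)
  then have "card (inversions (refl_word as \<circ> reflect_along a)) \<le> card (inversions (refl_word as)) + 1"
    using card_inversions_comp[of "refl_word as" a] refl_word_in_refl_group[of as S]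
    by (auto split: if_splits)
  moreover have "refl_word (as @ [a]) = refl_word as \<circ> reflect_along a"
    by (simp only: refl_word_append refl_word_simps comp_id)
  ultimately show ?case using snoc by (metis (no_types, lifting) Un_subset_iff add_mono_thms_linordered_semiring(3) le_trans length_append_singleton Suc_eq_plus1 set_append)
qed

lemma some_simple_negative:
  assumes w: "w \<in> refl_group S" and \<beta>: "\<beta> \<in> P" "- w \<beta> \<in> P"
  obtains \<alpha> where "\<alpha> \<in> S" "- w \<alpha> \<in> P"
proof (rule ccontr)
  assume "\<not> thesis"
  then have "w \<alpha> \<in> P" if "\<alpha> \<in> S" for \<alpha>
    using that simple_dichotomy[OF w] \<open>\<And>\<alpha>. \<alpha> \<in> S \<Longrightarrow> - w \<alpha> \<in> P \<Longrightarrow> thesis\<close> by blast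
  then have "0 \<le> \<rho> \<bullet> w \<alpha>" if "\<alpha> \<in> S" for \<alpha>
    using that \<rho>_pos[of "w \<alpha>"] by force
  moreover have "linear (\<lambda>x. \<rho> \<bullet> w x)"
    using linear_refl_group[OF w]
    by (intro linearI) (auto simp: linear_add linear_scale inner_add_right)
  ultimately have "0 \<le> \<rho> \<bullet> w \<beta>" using \<beta> dual_cone by blast
  then show False using \<rho>_pos[OF \<beta>(2)] by simp
qed

lemma some_simple_positive:
  assumes w: "w \<in> refl_group S" and \<beta>: "\<beta> \<in> P" "w \<beta> \<in> P"
  obtains \<alpha> where "\<alpha> \<in> S" "w \<alpha> \<in> P"
proof (rule ccontr)
  assume "\<not> thesis"
  then have "- w \<alpha> \<in> P" if "\<alpha> \<in> S" for \<alpha>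
    using that simple_dichotomy[OF w] \<open>\<And>\<alpha>. \<alpha> \<in> S \<Longrightarrow> w \<alpha> \<in> P \<Longrightarrow> thesis\<close> by blast
  then have "0 \<le> - (\<rho> \<bullet> w \<alpha>)" if "\<alpha> \<in> S" for \<alpha>
    using that \<rho>_pos[of "- w \<alpha>"] by force
  moreover have "linear (\<lambda>x. - (\<rho> \<bullet> w x))"
    using linear_refl_group[OF w]
    by (intro linearI) (auto simp: linear_add linear_scale inner_add_right)
  ultimately have "0 \<le> - (\<rho> \<bullet> w \<beta>)" using \<beta> dual_cone by blast
  then show False using \<rho>_pos[OF \<beta>(2)] by simp
qed

text \<open>
  An element with an inversion also inverts some simple root, and composing with the corresponding
  reflection removes one inversion; so a word with as many letters as there are inversions is found
  by descent.
\<close>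

lemma exists_word_of_length_inversions:
  assumes "w \<in> refl_group S"
  shows "\<exists>as. length as = card (inversions w) \<and> set as \<subseteq> S \<and> w = refl_word as"
  using assms
proof (induction "card (inversions w)" arbitrary: w)
  case 0
  then have "inversions w = {}" using finite_inversions by auto
  then have "w ` P \<subseteq> P" using refl_group_roots[OF 0(2)] by (auto simp: inversions_def)
  then have "w = id" by (rule preserving_trivial[OF 0(2)])
  then show ?case using 0 by (intro exI[of _ "[]"]) auto
next
  case (Suc n)
  then have "inversions w \<noteq> {}" by auto
  then obtain \<beta> where "\<beta> \<in> P" "- w \<beta> \<in> P" by (auto simp: inversions_def)
  then obtain \<alpha> where \<alpha>: "\<alpha> \<in> S" "- w \<alpha> \<in> P" using some_simple_negative Suc by metis
  let ?v = "w \<circ> reflect_along \<alpha>"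
  have v: "?v \<in> refl_group S"
    using Suc \<alpha> by (intro refl_group_comp reflect_along_in_refl_group) auto
  have "n = card (inversions ?v)"
    using card_inversions_comp[OF Suc.prems \<alpha>(1)] \<alpha> simple_dichotomy[OF Suc.prems \<alpha>(1)]
      Suc.hyps(2) by auto
  from Suc.hyps(1)[OF this v] this obtain as where
    as: "length as = n" "set as \<subseteq> S" "?v = refl_word as" by auto
  have "w = ?v \<circ> reflect_along \<alpha>" by (auto simp: fun_eq_iff reflect_along_involution)
  also have "\<dots> = refl_word (as @ [\<alpha>])" using as refl_word_append[of as "[\<alpha>]"] by simp
  finally show ?case using as \<alpha> Suc.hyps(2) by (intro exI[of _ "as @ [\<alpha>]"]) auto
qed

lemma refl_length_eq_inversions:
  assumes "w \<in> refl_group S"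
  shows "refl_length S w = card (inversions w)"
  unfolding refl_length_def refl_word_def[symmetric]
  by (rule Least_equality)
    (use exists_word_of_length_inversions[OF assms] card_inversions_word in auto)

lemma full_inversions:
  assumes w: "w \<in> refl_group S" and full: "inversions w = P"
  shows "w ` P = uminus ` P"
proof (rule card_subset_eq)
  show "finite (uminus ` P)" using finite_P by simp
  show "w ` P \<subseteq> uminus ` P"
  proof
    fix y assume "y \<in> w ` P"
    then have "- y \<in> P" using full by (auto simp: inversions_def)
    then show "y \<in> uminus ` P" by (intro image_eqI[of _ _ "- y"]) auto
  qed
  obtain w' where "w' \<circ> w = id" using refl_group_inverse[OF w] by blast
  then have "inj w" by (metis inj_on_id inj_on_imageI2)
  then show "card (w ` P) = card (uminus ` P)"
    by (simp add: card_image inj_on_subset)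
qed

text \<open>An element with the most inversions sends no simple root to a positive one.\<close>

lemma exists_full_inversions: "\<exists>w \<in> refl_group S. inversions w = P"
proof -
  let ?N = "\<lambda>w. card (inversions w)"
  have bound: "?N w \<le> card P" for w
    using finite_P by (intro card_mono) (auto simp: inversions_def)
  obtain w where w: "w \<in> refl_group S" and max: "\<And>v. v \<in> refl_group S \<Longrightarrow> ?N v \<le> ?N w"
    using ex_has_greatest_nat[of "\<lambda>w. w \<in> refl_group S" id ?N "Suc (card P)"]
      id_in_refl_group[of S] bound by (auto simp: less_Suc_eq_le)
  have "\<beta> \<in> inversions w" if \<beta>: "\<beta> \<in> P" for \<beta>
  proof (rule ccontr)
    assume "\<beta> \<notin> inversions w"
    then have "w \<beta> \<in> P" using refl_group_roots[OF w \<beta>] \<beta> by (auto simp: inversions_def)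
    then obtain \<alpha> where \<alpha>: "\<alpha> \<in> S" "w \<alpha> \<in> P" using some_simple_positive[OF w \<beta>] by blast
    have "w \<circ> reflect_along \<alpha> \<in> refl_group S"
      using w \<alpha> by (intro refl_group_comp reflect_along_in_refl_group) auto
    then show False
      using max[of "w \<circ> reflect_along \<alpha>"] card_inversions_comp[OF w \<alpha>(1)] \<alpha>
        simple_dichotomy[OF w \<alpha>(1)] by auto
  qed
  then show ?thesis using w by (auto simp: inversions_def)
qed

text \<open>
  The longest element inverts all of \<open>P\<close>; it is unique because two such elements differ by one that
  preserves \<open>P\<close>.
\<close>

theorem longest_element_inverts:
  "longest_element S \<in> refl_group S \<and> longest_element S ` P = uminus ` P"
proof -
  obtain w where w: "w \<in> refl_group S" "inversions w = P" using exists_full_inversions by blast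
  have bound: "card (inversions v) \<le> card P" for v
    using finite_P by (intro card_mono) (auto simp: inversions_def)
  have unique: "v = w" if v: "v \<in> refl_group S" "inversions v = P" for v
  proof -
    obtain w' where w': "w' \<in> refl_group S" "w' \<circ> w = id" "w \<circ> w' = id"
      using refl_group_inverse[OF w(1)] by blast
    have "w' ` (w ` P) = P" using w'(2) by (simp add: image_comp)
    then have "(w' \<circ> v) ` P \<subseteq> P"
      using full_inversions[OF w] full_inversions[OF v] image_comp[of w' v P] by simp
    then have "w' \<circ> v = id"
      using preserving_trivial refl_group_comp[OF w'(1) v(1)] by blast
    then show ?thesis using w'(3) by (metis comp_assoc comp_id id_comp)
  qed
  have "longest_element S = w"
    unfolding longest_element_def
  proof (rule the_equality)
    show "w \<in> refl_group S \<and> (\<forall>v\<in>refl_group S. refl_length S v \<le> refl_length S w)"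
      using w bound by (auto simp: refl_length_eq_inversions)
  next
    fix v assume v: "v \<in> refl_group S \<and> (\<forall>u\<in>refl_group S. refl_length S u \<le> refl_length S v)"
    then have "card P \<le> card (inversions v)" using w by (metis refl_length_eq_inversions)
    then have "inversions v = P"
      using finite_P by (intro card_seteq) (auto simp: inversions_def)
    then show "v = w" using v unique by blast
  qed
  then show ?thesis using w full_inversions by simp
qed

end

section \<open>Signed permutations of the coordinates\<close>

locale standard_basis =
  fixes e :: "nat \<Rightarrow> 'a::euclidean_space" and l :: nat
  assumes e_bij: "bij_betw e {1..l} Basis"
begin

lemma e_Basis: "i \<in> {1..l} \<Longrightarrow> e i \<in> Basis"
  using e_bij by (auto simp: bij_betw_def)

lemma e_eq_iff: "i \<in> {1..l} \<Longrightarrow> k \<in> {1..l} \<Longrightarrow> e i = e k \<longleftrightarrow> i = k"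
  using e_bij inj_on_eq_iff[of e "{1..l}" i k] by (simp only: bij_betw_def)

lemma e_inner: "i \<in> {1..l} \<Longrightarrow> k \<in> {1..l} \<Longrightarrow> e i \<bullet> e k = (if i = k then 1 else 0)"
  by (simp only: inner_Basis[OF e_Basis e_Basis] e_eq_iff)

lemma coord_eqI: "(\<And>i. i \<in> {1..l} \<Longrightarrow> x \<bullet> e i = y \<bullet> e i) \<Longrightarrow> x = y"
proof (rule euclidean_eqI)
  fix b :: 'a assume "\<And>i. i \<in> {1..l} \<Longrightarrow> x \<bullet> e i = y \<bullet> e i" "b \<in> Basis"
  moreover from this obtain i where "i \<in> {1..l}" "b = e i"
    using e_bij unfolding bij_betw_def by blast
  ultimately show "x \<bullet> b = y \<bullet> b" by simp
qed

definition of_coords :: "(nat \<Rightarrow> real) \<Rightarrow> 'a" where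
  "of_coords f = (\<Sum>i\<in>{1..l}. f i *\<^sub>R e i)"

lemma of_coords_inner [simp]:
  assumes i: "i \<in> {1..l}"
  shows "of_coords f \<bullet> e i = f i"
proof -
  have "of_coords f \<bullet> e i = (\<Sum>k\<in>{1..l}. if k = i then f k else 0)"
    unfolding of_coords_def inner_sum_left by (rule sum.cong) (use i in \<open>auto simp: e_inner\<close>)
  then show ?thesis using i by simp
qed

lemma of_coords_inner' [simp]: "i \<in> {1..l} \<Longrightarrow> e i \<bullet> of_coords f = f i"
  by (subst inner_commute) (rule of_coords_inner)

text \<open>
  The permutations of the coordinates combined with an even number of sign changes, in a form that
  gives the coordinates of the image.
\<close>

definition even_signed_perm :: "('a \<Rightarrow> 'a) \<Rightarrow> bool" where
  "even_signed_perm w \<longleftrightarrow> (\<exists>\<pi> s. \<pi> permutes {1..l} \<and> (\<forall>i\<in>{1..l}. s i = 1 \<or> s i = -1) \<and>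
     prod s {1..l} = 1 \<and> (\<forall>x. \<forall>i\<in>{1..l}. w x \<bullet> e i = s i * (x \<bullet> e (\<pi> i))))"

lemma even_signed_permI:
  assumes "\<pi> permutes {1..l}" "\<And>i. i \<in> {1..l} \<Longrightarrow> s i = 1 \<or> s i = -1" "prod s {1..l} = 1"
    "\<And>x i. i \<in> {1..l} \<Longrightarrow> w x \<bullet> e i = s i * (x \<bullet> e (\<pi> i))"
  shows "even_signed_perm w"
  using assms unfolding even_signed_perm_def by blast

lemma even_signed_permE:
  assumes "even_signed_perm w"
  obtains \<pi> s where "\<pi> permutes {1..l}" "\<And>i. i \<in> {1..l} \<Longrightarrow> s i = 1 \<or> s i = -1" "prod s {1..l} = 1"
    "\<And>x i. i \<in> {1..l} \<Longrightarrow> w x \<bullet> e i = s i * (x \<bullet> e (\<pi> i))"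
  using assms unfolding even_signed_perm_def by blast

lemma even_signed_perm_id: "even_signed_perm id"
  by (rule even_signed_permI[of id "\<lambda>_. 1"]) (auto simp: permutes_id)

lemma permutes_in: "\<pi> permutes {1..l} \<Longrightarrow> i \<in> {1..l} \<Longrightarrow> \<pi> i \<in> {1..l}"
  using permutes_in_image by metis

lemma even_signed_perm_comp:
  assumes "even_signed_perm v" "even_signed_perm w"
  shows "even_signed_perm (v \<circ> w)"
proof -
  obtain \<pi> s where v: "\<pi> permutes {1..l}" "\<And>i. i \<in> {1..l} \<Longrightarrow> s i = 1 \<or> s i = -1" "prod s {1..l} = 1"
    "\<And>x i. i \<in> {1..l} \<Longrightarrow> v x \<bullet> e i = s i * (x \<bullet> e (\<pi> i))"
    using even_signed_permE[OF assms(1)] by metis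
  obtain \<sigma> t where w: "\<sigma> permutes {1..l}" "\<And>i. i \<in> {1..l} \<Longrightarrow> t i = 1 \<or> t i = -1" "prod t {1..l} = 1"
    "\<And>x i. i \<in> {1..l} \<Longrightarrow> w x \<bullet> e i = t i * (x \<bullet> e (\<sigma> i))"
    using even_signed_permE[OF assms(2)] by metis
  have \<pi>in: "\<pi> i \<in> {1..l}" if "i \<in> {1..l}" for i using permutes_in v(1) that by blast
  show ?thesis
  proof (rule even_signed_permI)
    show "\<sigma> \<circ> \<pi> permutes {1..l}" by (rule permutes_compose[OF v(1) w(1)])
    fix i assume i: "i \<in> {1..l}"
    show "s i * t (\<pi> i) = 1 \<or> s i * t (\<pi> i) = - 1"
      using v(2)[OF i] w(2)[OF \<pi>in[OF i]] by auto
    show "(v \<circ> w) x \<bullet> e i = s i * t (\<pi> i) * (x \<bullet> e ((\<sigma> \<circ> \<pi>) i))" for x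
      using i v(4)[OF i] w(4)[OF \<pi>in[OF i]] by simp
  next
    have "(\<Prod>i\<in>{1..l}. t (\<pi> i)) = prod t {1..l}"
      using prod.permute[OF v(1), of t] by (simp add: comp_def)
    then show "(\<Prod>i\<in>{1..l}. s i * t (\<pi> i)) = 1"
      using v(3) w(3) by (simp add: prod.distrib)
  qed
qed

lemma even_signed_perm_linear:
  assumes "even_signed_perm w"
  shows "linear w"
proof -
  obtain \<pi> s where w: "\<And>x i. i \<in> {1..l} \<Longrightarrow> w x \<bullet> e i = s i * (x \<bullet> e (\<pi> i))"
    using even_signed_permE[OF assms] by metis
  show ?thesis
    by (intro linearI coord_eqI) (simp_all add: w inner_add_left algebra_simps)
qed

lemma inner_coords: "x \<bullet> y = (\<Sum>i\<in>{1..l}. (x \<bullet> e i) * (y \<bullet> e i))"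
proof -
  have "x \<bullet> y = (\<Sum>b\<in>Basis. (x \<bullet> b) * (y \<bullet> b))" by (rule euclidean_inner)
  also have "\<dots> = (\<Sum>i\<in>{1..l}. (x \<bullet> e i) * (y \<bullet> e i))"
    by (rule sum.reindex_bij_betw[OF e_bij, symmetric])
  finally show ?thesis .
qed

lemma even_signed_perm_inverse:
  assumes "even_signed_perm w"
  obtains w' where "even_signed_perm w'" "w' \<circ> w = id" "w \<circ> w' = id" "\<And>x y. x \<bullet> w y = w' x \<bullet> y"
proof -
  obtain \<pi> s where w: "\<pi> permutes {1..l}" "\<And>i. i \<in> {1..l} \<Longrightarrow> s i = 1 \<or> s i = -1" "prod s {1..l} = 1"
    "\<And>x i. i \<in> {1..l} \<Longrightarrow> w x \<bullet> e i = s i * (x \<bullet> e (\<pi> i))"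
    using even_signed_permE[OF assms] by metis
  let ?\<sigma> = "Hilbert_Choice.inv \<pi>"
  have \<sigma>: "?\<sigma> permutes {1..l}" using w(1) by (rule permutes_inv)
  have in1: "\<pi> i \<in> {1..l}" "?\<sigma> i \<in> {1..l}" if "i \<in> {1..l}" for i
    using permutes_in that w(1) \<sigma> by blast+
  have canc: "\<pi> (?\<sigma> i) = i" "?\<sigma> (\<pi> i) = i" for i
    using permutes_inverses[OF w(1)] by auto
  define w' where "w' x = of_coords (\<lambda>i. s (?\<sigma> i) * (x \<bullet> e (?\<sigma> i)))" for x
  have c': "w' x \<bullet> e i = s (?\<sigma> i) * (x \<bullet> e (?\<sigma> i))" if "i \<in> {1..l}" for x i
    using that by (simp add: w'_def)
  have ss: "s i * (s i * x) = x" if "i \<in> {1..l}" for i x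
    using w(2)[OF that] by auto
  show ?thesis
  proof (rule that)
    show "even_signed_perm w'"
    proof (rule even_signed_permI[of ?\<sigma> "s \<circ> ?\<sigma>"])
      show "?\<sigma> permutes {1..l}" by fact
      show "(s \<circ> ?\<sigma>) i = 1 \<or> (s \<circ> ?\<sigma>) i = -1" if "i \<in> {1..l}" for i
        using w(2)[OF in1(2)[OF that]] by simp
      show "prod (s \<circ> ?\<sigma>) {1..l} = 1" using prod.permute[OF \<sigma>, of s] w(3) by simp
      show "w' x \<bullet> e i = (s \<circ> ?\<sigma>) i * (x \<bullet> e (?\<sigma> i))" if "i \<in> {1..l}" for x i
        using c'[OF that] by simp
    qed
    show "w' \<circ> w = id"
    proof (rule ext, rule coord_eqI)
      fix x i assume i: "i \<in> {1..l}"
      show "(w' \<circ> w) x \<bullet> e i = id x \<bullet> e i"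
        using i c' w(4)[OF in1(2)[OF i]] ss[OF in1(2)[OF i]] by (simp add: canc)
    qed
    show "w \<circ> w' = id"
    proof (rule ext, rule coord_eqI)
      fix x i assume i: "i \<in> {1..l}"
      show "(w \<circ> w') x \<bullet> e i = id x \<bullet> e i"
        using i w(4)[OF i] c'[OF in1(1)[OF i]] ss[OF i] by (simp add: canc)
    qed
    show "x \<bullet> w y = w' x \<bullet> y" for x y
    proof -
      have "w' x \<bullet> y = (\<Sum>i\<in>{1..l}. (w' x \<bullet> e i) * (y \<bullet> e i))" by (rule inner_coords)
      also have "\<dots> = (\<Sum>i\<in>{1..l}. (w' x \<bullet> e (\<pi> i)) * (y \<bullet> e (\<pi> i)))"
        using sum.permute[OF w(1), of "\<lambda>i. (w' x \<bullet> e i) * (y \<bullet> e i)"] by (simp add: comp_def)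
      also have "\<dots> = (\<Sum>i\<in>{1..l}. (x \<bullet> e i) * (w y \<bullet> e i))"
      proof (rule sum.cong)
        fix i assume i: "i \<in> {1..l}"
        show "(w' x \<bullet> e (\<pi> i)) * (y \<bullet> e (\<pi> i)) = (x \<bullet> e i) * (w y \<bullet> e i)"
          using w(4)[OF i, of y] c'[OF in1(1)[OF i], of x] by (simp add: canc)
      qed simp
      finally show ?thesis using inner_coords[of x "w y"] by simp
    qed
  qed
qed

lemma even_signed_perm_e:
  assumes "even_signed_perm w"
  obtains \<tau> t where "\<And>i. i \<in> {1..l} \<Longrightarrow> \<tau> i \<in> {1..l}" "inj \<tau>"
    "\<And>i. i \<in> {1..l} \<Longrightarrow> t i = 1 \<or> t i = -1"
    "\<And>i. i \<in> {1..l} \<Longrightarrow> w (e i) = t i *\<^sub>R e (\<tau> i)"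
proof -
  obtain \<pi> s where w: "\<pi> permutes {1..l}" "\<And>i. i \<in> {1..l} \<Longrightarrow> s i = 1 \<or> s i = -1" "prod s {1..l} = 1"
    "\<And>x i. i \<in> {1..l} \<Longrightarrow> w x \<bullet> e i = s i * (x \<bullet> e (\<pi> i))"
    using even_signed_permE[OF assms] by metis
  let ?\<sigma> = "Hilbert_Choice.inv \<pi>"
  have \<sigma>: "?\<sigma> permutes {1..l}" using w(1) by (rule permutes_inv)
  have in1: "\<pi> i \<in> {1..l}" "?\<sigma> i \<in> {1..l}" if "i \<in> {1..l}" for i
    using permutes_in that w(1) \<sigma> by blast+
  show ?thesis
  proof (rule that)
    show "?\<sigma> i \<in> {1..l}" if "i \<in> {1..l}" for i using in1 that by blast
    show "inj ?\<sigma>" using \<sigma> permutes_inj by blast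
    show "(s \<circ> ?\<sigma>) i = 1 \<or> (s \<circ> ?\<sigma>) i = -1" if "i \<in> {1..l}" for i
      using w(2)[OF in1(2)[OF that]] by simp
    show "w (e i) = (s \<circ> ?\<sigma>) i *\<^sub>R e (?\<sigma> i)" if i: "i \<in> {1..l}" for i
    proof (rule coord_eqI)
      fix k assume k: "k \<in> {1..l}"
      have "\<pi> k = i \<longleftrightarrow> ?\<sigma> i = k" using permutes_inverses[OF w(1)] by metis
      then show "w (e i) \<bullet> e k = ((s \<circ> ?\<sigma>) i *\<^sub>R e (?\<sigma> i)) \<bullet> e k"
        using i k w(4)[OF k] in1 by (auto simp: e_inner)
    qed
  qed
qed

text \<open>
  Let \<open>x\<close> have positive decreasing coordinates.  In the dominant chamber the first \<open>l - 1\<close>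
  coordinates are positive, so if \<open>v x\<close> lies there then only the last sign of \<open>v\<close> could be negative,
  and parity excludes it; then \<open>v\<close> permutes a decreasing sequence into a decreasing one.
\<close>

lemma even_signed_perm_chamber:
  assumes v: "even_signed_perm v" and l: "2 \<le> l"
    and x_pos: "\<And>i. i \<in> {1..l} \<Longrightarrow> 0 < x \<bullet> e i"
    and x_dec: "\<And>i k. 1 \<le> i \<Longrightarrow> i < k \<Longrightarrow> k \<le> l \<Longrightarrow> x \<bullet> e k < x \<bullet> e i"
    and y_diff: "\<And>i k. 1 \<le> i \<Longrightarrow> i < k \<Longrightarrow> k \<le> l \<Longrightarrow> v x \<bullet> e k < v x \<bullet> e i"
    and y_sum: "0 < v x \<bullet> e (l - 1) + v x \<bullet> e l"
  shows "v = id"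
proof -
  obtain \<pi> s where w: "\<pi> permutes {1..l}" "\<And>i. i \<in> {1..l} \<Longrightarrow> s i = 1 \<or> s i = -1" "prod s {1..l} = 1"
    "\<And>x i. i \<in> {1..l} \<Longrightarrow> v x \<bullet> e i = s i * (x \<bullet> e (\<pi> i))"
    using even_signed_permE[OF v] by metis
  have in1: "\<pi> i \<in> {1..l}" if "i \<in> {1..l}" for i
    using permutes_in that w(1) by blast
  have pos: "0 < v x \<bullet> e i" if "1 \<le> i" "i < l" for i
    using y_diff[of i "l - 1"] y_diff[of "l - 1" l] y_sum that by (cases "i = l - 1") force+
  have s1: "s i = 1" if "1 \<le> i" "i < l" for i
    using w(4)[of i x] w(2)[of i] pos[OF that] x_pos[of "\<pi> i"] in1[of i] that by auto
  have "{1..l} = insert l {1..<l}" using l by auto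
  then have "prod s {1..l} = prod s {1..<l} * s l" by simp
  also have "\<dots> = s l" using s1 by simp
  finally have "s l = 1" using w(3) by simp
  then have s: "s i = 1" if "i \<in> {1..l}" for i using s1 that by (cases "i = l") auto
  have mono: "\<pi> i < \<pi> k" if "1 \<le> i" "i < k" "k \<le> l" for i k
  proof (rule ccontr)
    assume "\<not> \<pi> i < \<pi> k"
    moreover have "\<pi> i \<noteq> \<pi> k" using permutes_inj[OF w(1)] that by (auto dest: injD)
    ultimately have "x \<bullet> e (\<pi> i) < x \<bullet> e (\<pi> k)"
      using x_dec[of "\<pi> k" "\<pi> i"] in1[of i] in1[of k] that by auto
    then show False using y_diff[OF that] w(4)[of i x] w(4)[of k x] s[of i] s[of k] that by auto
  qed
  have "i \<le> \<pi> i" if "i \<in> {1..l}" for i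
    using that
  proof (induction i)
    case (Suc i)
    then show ?case using mono[of i "Suc i"] in1[of "Suc i"] by (cases "i = 0") auto
  qed simp
  then have "\<pi> = id" by (intro permutes_natset_ge[OF w(1)]) auto
  then show ?thesis using w(4) s by (intro ext coord_eqI) auto
qed

end

section \<open>The roots of type D\<close>

locale type_D = standard_basis e l for e :: "nat \<Rightarrow> 'a::euclidean_space" and l :: nat +
  assumes l4: "4 \<le> l"
begin

abbreviation roots :: "'a set" where "roots \<equiv> D_roots e l"
abbreviation simple :: "nat \<Rightarrow> 'a" where "simple \<equiv> D_simple e l"

definition pos_roots :: "'a set" where
  "pos_roots = {e i - e k |i k. 1 \<le> i \<and> i < k \<and> k \<le> l} \<union> {e i + e k |i k. 1 \<le> i \<and> i < k \<and> k \<le> l}"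

lemma pos_rootsE [consumes 1, case_names diff sum]:
  assumes "\<beta> \<in> pos_roots"
  obtains i k where "1 \<le> i" "i < k" "k \<le> l" "\<beta> = e i - e k"
  | i k where "1 \<le> i" "i < k" "k \<le> l" "\<beta> = e i + e k"
  using assms unfolding pos_roots_def by blast

lemma pos_rootsI:
  assumes "1 \<le> i" "i < k" "k \<le> l"
  shows "e i - e k \<in> pos_roots" "e i + e k \<in> pos_roots" "e k + e i \<in> pos_roots"
proof -
  show "e i - e k \<in> pos_roots" "e i + e k \<in> pos_roots" using assms unfolding pos_roots_def by blast+
  then show "e k + e i \<in> pos_roots" by (simp add: add.commute)
qed

lemma roots_eq: "roots = pos_roots \<union> uminus ` pos_roots"
proof
  show "roots \<subseteq> pos_roots \<union> uminus ` pos_roots"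
  proof
    fix \<beta> assume "\<beta> \<in> roots"
    then obtain i k where ik: "k \<in> {1..l}" "i \<in> {1..<k}"
      "\<beta> \<in> {e i + e k, e i - e k, - e i + e k, - e i - e k}"
      unfolding D_roots_def by blast
    have "- e i + e k = - (e i - e k)" "- e i - e k = - (e i + e k)" by simp_all
    moreover have "e i - e k \<in> pos_roots" "e i + e k \<in> pos_roots" using pos_rootsI ik by auto
    ultimately show "\<beta> \<in> pos_roots \<union> uminus ` pos_roots" using ik by blast
  qed
  show "pos_roots \<union> uminus ` pos_roots \<subseteq> roots"
  proof
    fix \<beta> assume "\<beta> \<in> pos_roots \<union> uminus ` pos_roots"
    then obtain \<gamma> where \<gamma>: "\<gamma> \<in> pos_roots" "\<beta> = \<gamma> \<or> \<beta> = - \<gamma>" by auto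
    from \<gamma>(1) obtain i k where "1 \<le> i" "i < k" "k \<le> l" "\<gamma> = e i - e k \<or> \<gamma> = e i + e k"
      by (cases rule: pos_rootsE) auto
    moreover have "- (e i - e k) = - e i + e k" "- (e i + e k) = - e i - e k" by simp_all
    ultimately have "k \<in> {1..l}" "i \<in> {1..<k}" "\<beta> \<in> {e i + e k, e i - e k, - e i + e k, - e i - e k}"
      using \<gamma>(2) by (auto simp del: minus_diff_eq minus_add_distrib)
    then show "\<beta> \<in> roots" unfolding D_roots_def by blast
  qed
qed

lemma roots_signs:
  "roots = {a *\<^sub>R e i + b *\<^sub>R e k | a b i k. a \<in> {1, -1} \<and> b \<in> {1, -1} \<and> i \<in> {1..l} \<and> k \<in> {1..l} \<and> i \<noteq> k}"
proof
  show "roots \<subseteq> {a *\<^sub>R e i + b *\<^sub>R e k | a b i k. a \<in> {1, -1} \<and> b \<in> {1, -1} \<and> i \<in> {1..l} \<and> k \<in> {1..l} \<and> i \<noteq> k}"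
    (is "_ \<subseteq> ?R")
  proof
    fix \<beta> assume "\<beta> \<in> roots"
    then obtain i k where ik: "k \<in> {1..l}" "i \<in> {1..<k}"
      "\<beta> \<in> {e i + e k, e i - e k, - e i + e k, - e i - e k}"
      unfolding D_roots_def by blast
    obtain a b :: real where ab: "a \<in> {1, -1}" "b \<in> {1, -1}" "\<beta> = a *\<^sub>R e i + b *\<^sub>R e k"
      using ik(3) that[of 1 1] that[of 1 "-1"] that[of "-1" 1] that[of "-1" "-1"] by auto
    have "i \<in> {1..l}" "i \<noteq> k" using ik by auto
    then show "\<beta> \<in> ?R" using ab ik(1) by blast
  qed
  show "?R \<subseteq> roots"
  proof
    fix \<beta> assume "\<beta> \<in> ?R"
    then obtain a b i k where \<beta>: "\<beta> = a *\<^sub>R e i + b *\<^sub>R e k" and ab: "a \<in> {1, -1}" "b \<in> {1, -1}"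
      and ik: "i \<in> {1..l}" "k \<in> {1..l}" "i \<noteq> k" by blast
    have R: "a *\<^sub>R e i + b *\<^sub>R e k \<in> roots" if "a \<in> {1, -1}" "b \<in> {1, -1}" "i \<in> {1..l}" "k \<in> {1..l}" "i < k" for a b i k
    proof -
      have "a *\<^sub>R e i + b *\<^sub>R e k \<in> {e i + e k, e i - e k, - e i + e k, - e i - e k}" using that by auto
      moreover have "k \<in> {1..l}" "i \<in> {1..<k}" using that by auto
      ultimately show ?thesis unfolding D_roots_def by blast
    qed
    show "\<beta> \<in> roots"
    proof (cases "i < k")
      case True
      then show ?thesis using R \<beta> ab ik by blast
    next
      case False
      then have "b *\<^sub>R e k + a *\<^sub>R e i \<in> roots" using R[of b a k i] ab ik by simp
      then show ?thesis unfolding \<beta> by (simp add: add.commute)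
    qed
  qed
qed

lemma even_signed_perm_roots:
  assumes "even_signed_perm w" "\<beta> \<in> roots"
  shows "w \<beta> \<in> roots"
proof -
  obtain \<tau> t where t: "\<And>i. i \<in> {1..l} \<Longrightarrow> \<tau> i \<in> {1..l}" "inj \<tau>"
    "\<And>i. i \<in> {1..l} \<Longrightarrow> t i = 1 \<or> t i = -1"
    "\<And>i. i \<in> {1..l} \<Longrightarrow> w (e i) = t i *\<^sub>R e (\<tau> i)"
    using even_signed_perm_e[OF assms(1)] by metis
  obtain a b i k where \<beta>: "\<beta> = a *\<^sub>R e i + b *\<^sub>R e k" and ab: "a \<in> {1, -1}" "b \<in> {1, -1}"
    and ik: "i \<in> {1..l}" "k \<in> {1..l}" "i \<noteq> k"
    using assms(2) unfolding roots_signs by blast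
  have "w \<beta> = (a * t i) *\<^sub>R e (\<tau> i) + (b * t k) *\<^sub>R e (\<tau> k)"
    using even_signed_perm_linear[OF assms(1)] t(4) ik by (simp add: \<beta> linear_add linear_scale)
  moreover have "a * t i \<in> {1, -1}" "b * t k \<in> {1, -1}"
    using ab t(3)[OF ik(1)] t(3)[OF ik(2)] by auto
  moreover have "\<tau> i \<noteq> \<tau> k" using t(2) ik(3) by (auto dest: injD)
  ultimately show ?thesis unfolding roots_signs using t(1) ik by blast
qed

text \<open>
  The reflection along \<open>a *\<^sub>R e i + b *\<^sub>R e k\<close> exchanges the two coordinates, with the same sign
  \<open>- a * b\<close> twice.
\<close>

lemma reflect_along_root_even_signed_perm:
  assumes "\<beta> \<in> roots"
  shows "even_signed_perm (reflect_along \<beta>)"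
proof -
  obtain a b i k where \<beta>: "\<beta> = a *\<^sub>R e i + b *\<^sub>R e k" and ab: "a \<in> {1, -1}" "b \<in> {1, -1}"
    and ik: "i \<in> {1..l}" "k \<in> {1..l}" "i \<noteq> k"
    using assms unfolding roots_signs by blast
  have norm: "\<beta> \<bullet> \<beta> = 2"
    unfolding \<beta> using ab ik by (auto simp: inner_add_left inner_add_right e_inner)
  define s where "s j = (if j = i \<or> j = k then - a * b else 1)" for j
  show ?thesis
  proof (rule even_signed_permI[of "Transposition.transpose i k" s])
    show "Transposition.transpose i k permutes {1..l}" using ik by (simp add: permutes_swap_id)
    show "s j = 1 \<or> s j = - 1" for j using ab by (auto simp: s_def)
    have "prod s {1..l} = s i * (s k * prod s ({1..l} - {i} - {k}))"
      using ik by (simp add: prod.remove[of _ i] prod.remove[of _ k])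
    also have "prod s ({1..l} - {i} - {k}) = 1" by (rule prod.neutral) (auto simp: s_def)
    finally show "prod s {1..l} = 1" using ab by (auto simp: s_def)
    fix x j assume j: "j \<in> {1..l}"
    have "reflect_along \<beta> x \<bullet> e j = x \<bullet> e j - (x \<bullet> \<beta>) * (\<beta> \<bullet> e j)"
      by (simp add: reflect_along_def norm inner_diff_left)
    also have "\<dots> = s j * (x \<bullet> e (Transposition.transpose i k j))"
      using ab ik j
      by (auto simp: \<beta> s_def inner_add_left inner_add_right e_inner Transposition.transpose_def algebra_simps)
    finally show "reflect_along \<beta> x \<bullet> e j = s j * (x \<bullet> e (Transposition.transpose i k j))" .
  qed
qed

lemma refl_group_even_signed_perm: "w \<in> refl_group roots \<Longrightarrow> even_signed_perm w"
  by (induction rule: refl_group_induct)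
    (blast intro: even_signed_perm_id even_signed_perm_comp reflect_along_root_even_signed_perm)+

text \<open>Natural coefficients, as in the order that singles out the highest root.\<close>

definition simple_cone :: "'a set" where
  "simple_cone = {\<Sum>i=1..l. real (c i) *\<^sub>R simple i |c. True}"

lemma simple_cone_add: "x \<in> simple_cone \<Longrightarrow> y \<in> simple_cone \<Longrightarrow> x + y \<in> simple_cone"
proof -
  assume "x \<in> simple_cone" "y \<in> simple_cone"
  then obtain c d where "x = (\<Sum>i=1..l. real (c i) *\<^sub>R simple i)" "y = (\<Sum>i=1..l. real (d i) *\<^sub>R simple i)"
    unfolding simple_cone_def by blast
  then have "x + y = (\<Sum>i=1..l. real (c i + d i) *\<^sub>R simple i)"
    by (simp add: sum.distrib scaleR_add_left)
  then show ?thesis unfolding simple_cone_def by (intro CollectI exI[of _ "\<lambda>i. c i + d i"]) simp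
qed

lemma simple_cone_0: "0 \<in> simple_cone"
  unfolding simple_cone_def by (intro CollectI exI[of _ "\<lambda>i. 0"]) simp

lemma simple_in_cone:
  assumes "i \<in> {1..l}"
  shows "simple i \<in> simple_cone"
proof -
  have "(\<Sum>k=1..l. real (if k = i then 1 else 0) *\<^sub>R simple k) = (\<Sum>k=1..l. if k = i then simple k else 0)"
    by (rule sum.cong) auto
  also have "\<dots> = simple i" using assms by simp
  finally show ?thesis
    unfolding simple_cone_def by (intro CollectI exI[of _ "\<lambda>k. if k = i then 1 else 0"]) simp
qed

lemma diff_in_cone:
  assumes "1 \<le> i" "i \<le> k" "k \<le> l"
  shows "e i - e k \<in> simple_cone"
  using assms(2,3)
proof (induction k rule: dec_induct)
  case base
  then show ?case by (simp add: simple_cone_0)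
next
  case (step k)
  have "simple k = e k - e (Suc k)" using step by (simp add: D_simple_def)
  moreover have "simple k \<in> simple_cone" using step assms by (intro simple_in_cone) auto
  moreover have "e i - e (Suc k) = (e i - e k) + (e k - e (Suc k))" by simp
  ultimately show ?case using step by (metis simple_cone_add Suc_leD)
qed

lemma sum_in_cone:
  assumes "1 \<le> i" "i < l" "1 \<le> k" "k \<le> l"
  shows "e i + e k \<in> simple_cone"
proof -
  have "e (l - 1) + e l \<in> simple_cone"
    using simple_in_cone[of l] l4 by (simp add: D_simple_def)
  moreover have "e i + e k = (e i - e (l - 1)) + (e k - e l) + (e (l - 1) + e l)" by simp
  moreover have "e i - e (l - 1) \<in> simple_cone" "e k - e l \<in> simple_cone"
    using assms by (auto intro: diff_in_cone)
  ultimately show ?thesis by (metis simple_cone_add)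
qed

lemma pos_roots_in_cone: "\<beta> \<in> pos_roots \<Longrightarrow> \<beta> \<in> simple_cone"
  by (cases rule: pos_rootsE) (auto intro: diff_in_cone sum_in_cone)

lemma pos_roots_combination:
  assumes "\<beta> \<in> pos_roots"
  obtains c :: "nat \<Rightarrow> nat" where "\<beta> = (\<Sum>i=1..l. real (c i) *\<^sub>R simple i)"
  using pos_roots_in_cone[OF assms] unfolding simple_cone_def by blast

lemma simple_in_pos_roots: "i \<in> {1..l} \<Longrightarrow> simple i \<in> pos_roots"
  using l4 pos_rootsI[of i "i + 1"] pos_rootsI[of "l - 1" l] by (auto simp: D_simple_def)

text \<open>The half-sum of the positive roots.\<close>

definition weyl_vector :: 'a where
  "weyl_vector = of_coords (\<lambda>i. real l - real i)"

lemma weyl_vector_e: "i \<in> {1..l} \<Longrightarrow> weyl_vector \<bullet> e i = real l - real i"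
  by (simp add: weyl_vector_def)

lemma weyl_vector_simple: "i \<in> {1..l} \<Longrightarrow> weyl_vector \<bullet> simple i = 1"
  using l4 by (auto simp: D_simple_def inner_add_right inner_diff_right weyl_vector_e)

lemma weyl_vector_pos: "\<beta> \<in> pos_roots \<Longrightarrow> 1 \<le> weyl_vector \<bullet> \<beta>"
  by (cases rule: pos_rootsE) (auto simp: inner_add_right inner_diff_right weyl_vector_e)

lemma pos_rootI: "\<beta> \<in> roots \<Longrightarrow> 0 \<le> weyl_vector \<bullet> \<beta> \<Longrightarrow> \<beta> \<in> pos_roots"
  using weyl_vector_pos[of "- \<beta>"] by (auto simp: roots_eq)

lemma pos_rootI': 
  assumes "\<beta> \<in> roots" "0 < g \<bullet> \<beta>" "\<And>i. i \<in> {1..l} \<Longrightarrow> 0 \<le> g \<bullet> simple i"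
  shows "\<beta> \<in> pos_roots"
proof (rule ccontr)
  assume "\<beta> \<notin> pos_roots"
  then have "- \<beta> \<in> pos_roots" using assms(1) by (auto simp: roots_eq)
  then obtain c where "- \<beta> = (\<Sum>i=1..l. real (c i) *\<^sub>R simple i)" using pos_roots_combination by blast
  then have "g \<bullet> (- \<beta>) = (\<Sum>i=1..l. real (c i) * (g \<bullet> simple i))" by (simp add: inner_sum_right)
  also have "\<dots> \<ge> 0" using assms(3) by (intro sum_nonneg mult_nonneg_nonneg) auto
  finally show False using assms(2) by simp
qed

lemma finite_pos_roots: "finite pos_roots"
proof -
  have "pos_roots \<subseteq> (\<lambda>(i, k). e i - e k) ` ({1..l} \<times> {1..l}) \<union> (\<lambda>(i, k). e i + e k) ` ({1..l} \<times> {1..l})"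
  proof
    fix \<beta> assume "\<beta> \<in> pos_roots"
    then show "\<beta> \<in> (\<lambda>(i, k). e i - e k) ` ({1..l} \<times> {1..l}) \<union> (\<lambda>(i, k). e i + e k) ` ({1..l} \<times> {1..l})"
      by (cases rule: pos_rootsE) (force simp: image_iff)+
  qed
  then show ?thesis by (rule finite_subset) simp
qed

lemma pos_root_norm: "\<beta> \<in> pos_roots \<Longrightarrow> \<beta> \<bullet> \<beta> = 2"
  by (cases rule: pos_rootsE) (auto simp: inner_add_right inner_diff_right inner_add_left inner_diff_left e_inner)

lemma pos_root_inner_le_1:
  assumes "\<alpha> \<in> pos_roots" "\<beta> \<in> pos_roots" "\<beta> \<noteq> \<alpha>"
  shows "\<beta> \<bullet> \<alpha> \<le> 1"
  using assms(1)
proof (cases rule: pos_rootsE)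
  case (diff i k)
  from assms(2) show ?thesis
    by (cases rule: pos_rootsE)
      (use diff assms(3) in \<open>auto simp: inner_add_right inner_diff_right inner_add_left inner_diff_left e_inner\<close>)
next
  case (sum i k)
  from assms(2) show ?thesis
    by (cases rule: pos_rootsE)
      (use sum assms(3) in \<open>auto simp: inner_add_right inner_diff_right inner_add_left inner_diff_left e_inner\<close>)
qed

text \<open>
  Every simple root has inner product 1 with the Weyl vector, so a simple reflection lowers the
  height of another positive root by at most 1, hence not below 0.
\<close>

lemma simple_reflection_pos_roots:
  assumes i: "i \<in> {1..l}" and \<beta>: "\<beta> \<in> pos_roots" "\<beta> \<noteq> simple i"
  shows "reflect_along (simple i) \<beta> \<in> pos_roots"
proof (rule pos_rootI)
  have a: "simple i \<in> pos_roots" by (rule simple_in_pos_roots[OF i])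
  show "reflect_along (simple i) \<beta> \<in> roots"
    using even_signed_perm_roots[OF reflect_along_root_even_signed_perm] a \<beta>(1) roots_eq by blast
  have "weyl_vector \<bullet> reflect_along (simple i) \<beta> = weyl_vector \<bullet> \<beta> - \<beta> \<bullet> simple i"
    by (simp add: reflect_along_def pos_root_norm[OF a] inner_diff_right weyl_vector_simple[OF i])
  then show "0 \<le> weyl_vector \<bullet> reflect_along (simple i) \<beta>"
    using weyl_vector_pos[OF \<beta>(1)] pos_root_inner_le_1[OF a \<beta>] by linarith
qed

text \<open>The inverse of an element preserving the positive roots sends one dominant point to another.\<close>

lemma preserving_pos_roots_id:
  assumes w: "even_signed_perm w" "w ` pos_roots \<subseteq> pos_roots"
  shows "w = id"
proof -
  obtain v where v: "even_signed_perm v" "v \<circ> w = id" "w \<circ> v = id" "\<And>x y. x \<bullet> w y = v x \<bullet> y"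
    using even_signed_perm_inverse[OF w(1)] by metis
  define x where "x = of_coords (\<lambda>i. real l + 1 - real i)"
  have x: "x \<bullet> e i = real l + 1 - real i" if "i \<in> {1..l}" for i using that by (simp add: x_def)
  have "0 < x \<bullet> \<beta>" if "\<beta> \<in> pos_roots" for \<beta>
    using that by (cases rule: pos_rootsE) (auto simp: inner_add_right inner_diff_right x)
  then have pos: "0 < v x \<bullet> \<beta>" if "\<beta> \<in> pos_roots" for \<beta>
    using that w(2) v(4)[of x \<beta>] by (metis image_subset_iff)
  have "v = id"
  proof (rule even_signed_perm_chamber[OF v(1), of x])
    show "v x \<bullet> e k < v x \<bullet> e i" if "1 \<le> i" "i < k" "k \<le> l" for i k
      using pos[OF pos_rootsI(1)[OF that]] by (simp add: inner_diff_right)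
    show "0 < v x \<bullet> e (l - 1) + v x \<bullet> e l"
      using pos[OF pos_rootsI(2)[of "l - 1" l]] l4 by (simp add: inner_add_right)
  qed (use l4 x in auto)
  then show ?thesis using v(2) by simp
qed

end

section \<open>Longest elements of parabolic subgroups\<close>

context type_D
begin

text \<open>
  The vector \<open>g\<close> stands for a sum of fundamental coweights: it vanishes exactly on the positive roots
  of the parabolic subsystem generated by the simple roots with index in \<open>J\<close>.
\<close>

definition parabolic :: "nat set \<Rightarrow> 'a \<Rightarrow> bool" where
  "parabolic J g \<longleftrightarrow> J \<subseteq> {1..l} \<and> (\<forall>i\<in>J. g \<bullet> simple i = 0) \<and> (\<forall>i\<in>{1..l} - J. 0 < g \<bullet> simple i)"

lemma parabolic_simple_nonneg: "parabolic J g \<Longrightarrow> i \<in> {1..l} \<Longrightarrow> 0 \<le> g \<bullet> simple i"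
  unfolding parabolic_def by (cases "i \<in> J") (auto simp: less_imp_le)

lemma inner_simple_combination:
  "g \<bullet> (\<Sum>i=1..l. real (c i) *\<^sub>R simple i) = (\<Sum>i=1..l. real (c i) * (g \<bullet> simple i))"
  by (simp add: inner_sum_right)

lemma parabolic_pos_nonneg:
  assumes "parabolic J g" "\<beta> \<in> pos_roots"
  shows "0 \<le> g \<bullet> \<beta>"
proof -
  obtain c where "\<beta> = (\<Sum>i=1..l. real (c i) *\<^sub>R simple i)" using pos_roots_combination[OF assms(2)] .
  then show ?thesis
    using parabolic_simple_nonneg[OF assms(1)]
    by (simp only: inner_simple_combination) (intro sum_nonneg mult_nonneg_nonneg, auto)
qed

lemma parabolic_dual_cone:
  fixes f :: "'a \<Rightarrow> real"
  assumes J: "parabolic J g" and \<beta>: "\<beta> \<in> pos_roots" "g \<bullet> \<beta> = 0"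
    and f: "linear f" "\<And>i. i \<in> J \<Longrightarrow> 0 \<le> f (simple i)"
  shows "0 \<le> f \<beta>"
proof -
  obtain c where c: "\<beta> = (\<Sum>i=1..l. real (c i) *\<^sub>R simple i)" using pos_roots_combination[OF \<beta>(1)] .
  have "(\<Sum>i=1..l. real (c i) * (g \<bullet> simple i)) = 0"
    using \<beta>(2) by (simp only: c inner_simple_combination)
  then have zero: "real (c i) * (g \<bullet> simple i) = 0" if "i \<in> {1..l}" for i
    using that parabolic_simple_nonneg[OF J] by (subst (asm) sum_nonneg_eq_0_iff) auto
  have "f \<beta> = (\<Sum>i=1..l. real (c i) * f (simple i))"
    unfolding c by (simp add: linear_sum[OF f(1)] linear_scale[OF f(1)])
  also have "\<dots> \<ge> 0"
  proof (intro sum_nonneg)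
    fix i assume i: "i \<in> {1..l}"
    show "0 \<le> real (c i) * f (simple i)"
    proof (cases "i \<in> J")
      case True
      then show ?thesis using f(2) by simp
    next
      case False
      then have "g \<bullet> simple i > 0" using J i unfolding parabolic_def by blast
      then show ?thesis using zero[OF i] by simp
    qed
  qed
  finally show ?thesis .
qed

lemma parabolic_refl_group:
  assumes J: "parabolic J g" and w: "w \<in> refl_group (simple ` J)"
  shows "g \<bullet> w x = g \<bullet> x"
    and "\<beta> \<in> pos_roots \<Longrightarrow> g \<bullet> \<beta> \<noteq> 0 \<Longrightarrow> w \<beta> \<in> pos_roots"
proof -
  have g: "g \<bullet> simple i = 0" "i \<in> {1..l}" if "i \<in> J" for i
    using J that unfolding parabolic_def by auto
  have refl_g: "g \<bullet> reflect_along (simple i) y = g \<bullet> y" if "i \<in> J" for i y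
    using g(1)[OF that] by (simp add: reflect_along_def inner_diff_right)
  have "(\<forall>x. g \<bullet> w x = g \<bullet> x) \<and> (\<beta> \<in> pos_roots \<longrightarrow> g \<bullet> \<beta> \<noteq> 0 \<longrightarrow> w \<beta> \<in> pos_roots)" for \<beta>
    using w
  proof (induction rule: refl_group_induct)
    case (refl a w)
    then obtain i where i: "i \<in> J" "a = simple i" by auto
    have "reflect_along a (w \<beta>) \<in> pos_roots" if "\<beta> \<in> pos_roots" "g \<bullet> \<beta> \<noteq> 0"
    proof -
      have "w \<beta> \<in> pos_roots" "g \<bullet> w \<beta> \<noteq> 0" using refl.IH that by auto
      then have "w \<beta> \<noteq> simple i" using g(1)[OF i(1)] by auto
      then show ?thesis using simple_reflection_pos_roots[OF g(2)[OF i(1)]] \<open>w \<beta> \<in> pos_roots\<close> i(2) by simp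
    qed
    then show ?case using refl.IH refl_g[OF i(1)] i(2) by simp
  qed simp
  then show "g \<bullet> w x = g \<bullet> x" "\<beta> \<in> pos_roots \<Longrightarrow> g \<bullet> \<beta> \<noteq> 0 \<Longrightarrow> w \<beta> \<in> pos_roots" by blast+
qed

lemma simple_roots_subset: "J \<subseteq> {1..l} \<Longrightarrow> simple ` J \<subseteq> roots"
  using simple_in_pos_roots unfolding roots_eq by blast

lemma parabolic_positive_system:
  assumes J: "parabolic J g"
  shows "positive_system {\<beta> \<in> pos_roots. g \<bullet> \<beta> = 0} (simple ` J) weyl_vector"
proof
  have g: "g \<bullet> simple i = 0" "i \<in> {1..l}" if "i \<in> J" for i
    using J that unfolding parabolic_def by auto
  show "finite {\<beta> \<in> pos_roots. g \<bullet> \<beta> = 0}" using finite_pos_roots by simp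
  show "simple ` J \<subseteq> {\<beta> \<in> pos_roots. g \<bullet> \<beta> = 0}" using g simple_in_pos_roots by blast
  show "0 < weyl_vector \<bullet> \<beta>" if "\<beta> \<in> {\<beta> \<in> pos_roots. g \<bullet> \<beta> = 0}" for \<beta>
    using that weyl_vector_pos[of \<beta>] by simp
  show "reflect_along \<alpha> \<beta> \<in> {\<beta> \<in> pos_roots. g \<bullet> \<beta> = 0}"
    if "\<alpha> \<in> simple ` J" "\<beta> \<in> {\<beta> \<in> pos_roots. g \<bullet> \<beta> = 0}" "\<beta> \<noteq> \<alpha>" for \<alpha> \<beta>
  proof -
    obtain i where i: "i \<in> J" "\<alpha> = simple i" using \<open>\<alpha> \<in> simple ` J\<close> by auto
    have "g \<bullet> reflect_along \<alpha> \<beta> = g \<bullet> \<beta>"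
      using g(1)[OF i(1)] i(2) by (simp add: reflect_along_def inner_diff_right)
    then show ?thesis
      using that simple_reflection_pos_roots[OF g(2)[OF i(1)], of \<beta>] i(2) by simp
  qed
  show "0 \<le> f \<beta>" if "linear f" "\<And>\<alpha>. \<alpha> \<in> simple ` J \<Longrightarrow> 0 \<le> f \<alpha>" "\<beta> \<in> {\<beta> \<in> pos_roots. g \<bullet> \<beta> = 0}"
    for f :: "'a \<Rightarrow> real" and \<beta>
    by (rule parabolic_dual_cone[OF J _ _ that(1)]) (use that in auto)
  show "w = id" if w: "w \<in> refl_group (simple ` J)"
    "w ` {\<beta> \<in> pos_roots. g \<bullet> \<beta> = 0} \<subseteq> {\<beta> \<in> pos_roots. g \<bullet> \<beta> = 0}" for w
  proof (rule preserving_pos_roots_id)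
    have "simple ` J \<subseteq> roots" using J simple_roots_subset unfolding parabolic_def by blast
    then show "even_signed_perm w" using w(1) refl_group_mono refl_group_even_signed_perm by blast
    show "w ` pos_roots \<subseteq> pos_roots"
    proof
      fix \<gamma> assume "\<gamma> \<in> w ` pos_roots"
      then obtain \<beta> where \<beta>: "\<beta> \<in> pos_roots" "\<gamma> = w \<beta>" by blast
      show "\<gamma> \<in> pos_roots"
      proof (cases "g \<bullet> \<beta> = 0")
        case True
        then show ?thesis using w(2) \<beta> by blast
      next
        case False
        then show ?thesis using parabolic_refl_group(2)[OF J w(1)] \<beta> by blast
      qed
    qed
  qed
qed

lemma longest_element_in_refl_group:
  "parabolic J g \<Longrightarrow> longest_element (simple ` J) \<in> refl_group roots"
proof -
  assume J: "parabolic J g"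
  then have "simple ` J \<subseteq> roots" using simple_roots_subset unfolding parabolic_def by blast
  then show ?thesis
    using positive_system.longest_element_inverts[OF parabolic_positive_system[OF J]] refl_group_mono
    by blast
qed

text \<open>
  The candidate \<open>c\<close> composed with the longest element preserves the positive roots: inside the
  subsystem both change the sign, and outside of it both preserve the positive value of \<open>g\<close>.
\<close>

lemma longest_element_eqI:
  assumes J: "parabolic J g" and c: "even_signed_perm c" "\<And>x. c (c x) = x" "\<And>x. g \<bullet> c x = g \<bullet> x"
    and neg: "\<And>i. i \<in> J \<Longrightarrow> - c (simple i) \<in> pos_roots"
  shows "longest_element (simple ` J) = c"
proof -
  let ?P = "{\<beta> \<in> pos_roots. g \<bullet> \<beta> = 0}" and ?w = "longest_element (simple ` J)"
  have w: "?w \<in> refl_group (simple ` J)" "?w ` ?P = uminus ` ?P"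
    using positive_system.longest_element_inverts[OF parabolic_positive_system[OF J]] by auto
  have lin: "linear c" using even_signed_perm_linear[OF c(1)] .
  have "even_signed_perm ?w"
    using longest_element_in_refl_group[OF J] refl_group_even_signed_perm by blast
  then have "even_signed_perm (c \<circ> ?w)" using c(1) even_signed_perm_comp by blast
  moreover have "c (?w \<beta>) \<in> pos_roots" if \<beta>: "\<beta> \<in> pos_roots" for \<beta>
  proof (cases "g \<bullet> \<beta> = 0")
    case True
    then have "?w \<beta> \<in> uminus ` ?P" using w(2) \<beta> by blast
    then obtain \<gamma> where \<gamma>: "\<gamma> \<in> pos_roots" "g \<bullet> \<gamma> = 0" "?w \<beta> = - \<gamma>" by auto
    have "0 \<le> weyl_vector \<bullet> - c \<gamma>"
    proof (rule parabolic_dual_cone[OF J \<gamma>(1,2), of "\<lambda>x. weyl_vector \<bullet> - c x"])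
      show "linear (\<lambda>x. weyl_vector \<bullet> - c x)"
        using lin by (intro linearI) (auto simp: linear_add linear_scale inner_add_right inner_diff_right)
      show "0 \<le> weyl_vector \<bullet> - c (simple i)" if "i \<in> J" for i
        using weyl_vector_pos[OF neg[OF that]] by linarith
    qed
    moreover have "- c \<gamma> \<in> roots"
    proof -
      have "- \<gamma> \<in> roots" using \<gamma>(1) unfolding roots_eq by blast
      then have "c (- \<gamma>) \<in> roots" by (rule even_signed_perm_roots[OF c(1)])
      then show ?thesis by (simp add: linear_neg[OF lin])
    qed
    ultimately have "- c \<gamma> \<in> pos_roots" by (intro pos_rootI)
    then show ?thesis by (simp add: \<gamma>(3) linear_neg[OF lin])
  next
    case False
    then have "?w \<beta> \<in> pos_roots" using parabolic_refl_group(2)[OF J w(1) \<beta>] by blast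
    then have "c (?w \<beta>) \<in> roots" using even_signed_perm_roots[OF c(1)] unfolding roots_eq by blast
    moreover have "0 < g \<bullet> c (?w \<beta>)"
      using parabolic_pos_nonneg[OF J \<beta>] False c(3) parabolic_refl_group(1)[OF J w(1)] by simp
    ultimately show ?thesis using pos_rootI'[of "c (?w \<beta>)" g] parabolic_simple_nonneg[OF J] by blast
  qed
  ultimately have "c \<circ> ?w = id" by (intro preserving_pos_roots_id) auto
  then have "c (?w x) = x" for x by (metis comp_apply id_apply)
  then show ?thesis using c(2) by (metis ext)
qed

text \<open>The sign \<open>s i\<close> belongs to the target coordinate \<open>i\<close>, the source coordinate being \<open>\<pi> i\<close>.\<close>

definition signed_perm :: "(nat \<Rightarrow> nat) \<Rightarrow> (nat \<Rightarrow> real) \<Rightarrow> 'a \<Rightarrow> 'a" where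
  "signed_perm \<pi> s x = of_coords (\<lambda>i. s i * (x \<bullet> e (\<pi> i)))"

lemma signed_perm_inner [simp]: "i \<in> {1..l} \<Longrightarrow> signed_perm \<pi> s x \<bullet> e i = s i * (x \<bullet> e (\<pi> i))"
  by (simp add: signed_perm_def)

definition flip :: "nat \<Rightarrow> nat" where "flip i = (if i \<in> {1..l} then l + 1 - i else i)"

lemma flip_in: "i \<in> {1..l} \<Longrightarrow> flip i \<in> {1..l}" by (auto simp: flip_def)

lemma flip_flip [simp]: "flip (flip i) = i" by (auto simp: flip_def)

lemma flip_permutes: "flip permutes {1..l}"
  by (rule bij_imp_permutes)
    (auto simp: flip_def intro!: bij_betw_byWitness[of _ flip] split: if_splits)

lemma signed_perm_add: "signed_perm \<pi> s (x + y) = signed_perm \<pi> s x + signed_perm \<pi> s y"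
  by (rule coord_eqI) (simp add: inner_add_left algebra_simps)

lemma signed_perm_diff: "signed_perm \<pi> s (x - y) = signed_perm \<pi> s x - signed_perm \<pi> s y"
  by (rule coord_eqI) (simp add: inner_diff_left algebra_simps)

lemma signed_perm_e:
  assumes "i \<in> {1..l}" "\<And>i. i \<in> {1..l} \<Longrightarrow> \<pi> i \<in> {1..l}" "\<And>i. \<pi> (\<pi> i) = i"
  shows "signed_perm \<pi> s (e i) = s (\<pi> i) *\<^sub>R e (\<pi> i)"
proof (rule coord_eqI)
  fix k assume k: "k \<in> {1..l}"
  have "\<pi> k = i \<longleftrightarrow> \<pi> i = k" using assms(3) by metis
  then show "signed_perm \<pi> s (e i) \<bullet> e k = (s (\<pi> i) *\<^sub>R e (\<pi> i)) \<bullet> e k"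
    using k assms(1) assms(2)[OF k] assms(2)[of i] assms(3)[of i] by (auto simp: e_inner)
qed

lemma signed_perm_involution:
  assumes "\<And>i. i \<in> {1..l} \<Longrightarrow> \<pi> i \<in> {1..l}" "\<And>i. \<pi> (\<pi> i) = i"
    "\<And>i. i \<in> {1..l} \<Longrightarrow> s i * s (\<pi> i) = 1"
  shows "signed_perm \<pi> s (signed_perm \<pi> s x) = x"
proof (rule coord_eqI)
  fix i assume i: "i \<in> {1..l}"
  have "s i * (s (\<pi> i) * (x \<bullet> e i)) = x \<bullet> e i" using assms(3)[OF i] by (simp flip: mult.assoc)
  then show "signed_perm \<pi> s (signed_perm \<pi> s x) \<bullet> e i = x \<bullet> e i"
    using i assms(1)[OF i] assms(2)[of i] by simp
qed

lemma even_signed_perm_signed_perm: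
  assumes "\<pi> permutes {1..l}" "\<And>i. i \<in> {1..l} \<Longrightarrow> s i = 1 \<or> s i = -1" "prod s {1..l} = 1"
  shows "even_signed_perm (signed_perm \<pi> s)"
  by (rule even_signed_permI[OF assms]) auto

lemma parabolic_full: "parabolic {1..l} 0"
  by (auto simp: parabolic_def)

lemma parabolic_1: "parabolic ({1..l} - {1}) (e 1)"
  using l4 by (auto simp: parabolic_def D_simple_def inner_add_right inner_diff_right e_inner)

lemma parabolic_l: "parabolic ({1..l} - {l}) (of_coords (\<lambda>i. 1))"
  using l4 by (auto simp: parabolic_def D_simple_def inner_add_right inner_diff_right)

lemma parabolic_l1: "parabolic ({1..l} - {l - 1}) (of_coords (\<lambda>i. if i = l then -1 else 1))"
  using l4 by (auto simp: parabolic_def D_simple_def inner_add_right inner_diff_right)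

end

locale type_D_even = type_D e l for e :: "nat \<Rightarrow> 'a::euclidean_space" and l :: nat +
  assumes even_l: "even l"
begin

lemma prod_signs_end:
  fixes a b :: real
  assumes "a * a = 1" "b * b = 1"
  shows "(\<Prod>i\<in>{1..l}. if i = 1 \<or> i = l then a else b) = 1"
proof -
  have "(\<Prod>i\<in>{1..l}. if i = 1 \<or> i = l then a else b) = a * (a * (\<Prod>i\<in>{1..l} - {1} - {l}. b))"
    using l4 by (simp add: prod.remove[of _ 1] prod.remove[of _ l])
  also have "\<dots> = b ^ (l - 2)" using assms l4 by (simp flip: mult.assoc add: numeral_2_eq_2)
  also have "\<dots> = 1"
  proof -
    obtain m where "l = 2 * m" using even_l by (rule evenE)
    then have "l - 2 = 2 * (m - 1)" by simp
    then show ?thesis using assms by (simp add: power_mult power2_eq_square)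
  qed
  finally show ?thesis .
qed

lemma longest_element_full: "longest_element (simple ` {1..l}) = uminus"
proof (rule longest_element_eqI[OF parabolic_full])
  show "even_signed_perm uminus"
    by (rule even_signed_permI[of id "\<lambda>i. -1"]) (use even_l in \<open>auto simp: permutes_id\<close>)
qed (auto simp: simple_in_pos_roots)

lemma longest_element_1:
  "longest_element (simple ` ({1..l} - {1})) = signed_perm id (\<lambda>i. if i = 1 \<or> i = l then 1 else -1)"
  (is "_ = ?c")
proof (rule longest_element_eqI[OF parabolic_1])
  show c: "even_signed_perm ?c"
    by (rule even_signed_perm_signed_perm[OF permutes_id _ prod_signs_end]) auto
  show "?c (?c x) = x" for x by (rule signed_perm_involution) auto
  show "e 1 \<bullet> ?c x = e 1 \<bullet> x" for x
    using l4 signed_perm_inner[of 1] by (simp add: inner_commute)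
  have ce: "signed_perm id s (e i) = s i *\<^sub>R e i" if "i \<in> {1..l}" for s i
    using signed_perm_e[OF that, of id] by simp
  fix i assume i: "i \<in> {1..l} - {1}"
  consider "i < l - 1" | "i = l - 1" | "i = l" using i by force
  then show "- ?c (simple i) \<in> pos_roots"
    using i l4 pos_rootsI[of i "Suc i"] pos_rootsI[of "l - 1" l]
    by cases
      (auto simp: D_simple_def signed_perm_diff
        signed_perm_add ce)
qed

lemma longest_element_l:
  "longest_element (simple ` ({1..l} - {l})) = signed_perm flip (\<lambda>i. 1)"
  (is "_ = ?c")
proof (rule longest_element_eqI[OF parabolic_l])
  show c: "even_signed_perm ?c"
    by (rule even_signed_perm_signed_perm[OF flip_permutes]) auto
  show "?c (?c x) = x" for x by (rule signed_perm_involution[OF flip_in]) auto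
  show "of_coords (\<lambda>i. 1) \<bullet> ?c x = of_coords (\<lambda>i. 1) \<bullet> x" for x
  proof -
    have "of_coords (\<lambda>i. 1) \<bullet> ?c x = (\<Sum>i\<in>{1..l}. x \<bullet> e (flip i))"
      by (subst inner_coords) (auto intro!: sum.cong)
    also have "\<dots> = (\<Sum>i\<in>{1..l}. x \<bullet> e i)"
      using sum.permute[OF flip_permutes, of "\<lambda>i. x \<bullet> e i"] by (simp add: comp_def)
    also have "\<dots> = of_coords (\<lambda>i. 1) \<bullet> x" by (subst inner_coords) (auto intro!: sum.cong)
    finally show ?thesis .
  qed
  have ce: "signed_perm flip s (e i) = s (flip i) *\<^sub>R e (flip i)" if "i \<in> {1..l}" for s i
    using signed_perm_e[OF that, of flip] flip_in by simp
  fix i assume i: "i \<in> {1..l} - {l}"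
  then show "- ?c (simple i) \<in> pos_roots"
    using i l4 pos_rootsI(1)[of "l - i" "l + 1 - i"]
    by (auto simp: D_simple_def signed_perm_diff ce flip_def)
qed

lemma longest_element_l1:
  "longest_element (simple ` ({1..l} - {l - 1})) = signed_perm flip (\<lambda>i. if i = 1 \<or> i = l then -1 else 1)"
  (is "_ = ?c")
proof (rule longest_element_eqI[OF parabolic_l1])
  let ?g = "of_coords (\<lambda>i. if i = l then -1 else 1)"
  show c: "even_signed_perm ?c"
    by (rule even_signed_perm_signed_perm[OF flip_permutes _ prod_signs_end]) auto
  show "?c (?c x) = x" for x
    by (rule signed_perm_involution[OF flip_in]) (use l4 in \<open>auto simp: flip_def\<close>)
  show "?g \<bullet> ?c x = ?g \<bullet> x" for x
  proof -
    have "?g \<bullet> ?c x = (\<Sum>i\<in>{1..l}. (if flip i = l then -1 else 1) * (x \<bullet> e (flip i)))"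
      by (subst inner_coords) (use l4 in \<open>auto intro!: sum.cong simp: flip_def\<close>)
    also have "\<dots> = (\<Sum>i\<in>{1..l}. (if i = l then -1 else 1) * (x \<bullet> e i))"
      using sum.permute[OF flip_permutes, of "\<lambda>i. (if i = l then -1 else 1) * (x \<bullet> e i)"]
      by (simp add: comp_def)
    also have "\<dots> = ?g \<bullet> x" by (subst inner_coords) (auto intro!: sum.cong)
    finally show ?thesis .
  qed
  have ce: "signed_perm flip s (e i) = s (flip i) *\<^sub>R e (flip i)" if "i \<in> {1..l}" for s i
    using signed_perm_e[OF that, of flip] flip_in by simp
  fix i assume i: "i \<in> {1..l} - {l - 1}"
  consider "i = 1" | "1 < i" "i < l - 1" | "i = l" using i by force
  then show "- ?c (simple i) \<in> pos_roots"
  proof cases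
    case 1
    then show ?thesis using l4 pos_rootsI(2)[of "l - 1" l]
      by (auto simp: D_simple_def signed_perm_diff ce flip_def)
  next
    case 2
    then show ?thesis using l4 pos_rootsI(1)[of "l - i" "l + 1 - i"]
      by (auto simp: D_simple_def signed_perm_diff ce flip_def)
  next
    case 3
    then show ?thesis using l4 pos_rootsI(1)[of 1 2]
      by (auto simp: D_simple_def signed_perm_add ce flip_def)
  qed
qed

lemma omega_1: "omega simple l 1 = signed_perm id (\<lambda>i. if i = 1 \<or> i = l then -1 else 1)"
  unfolding omega_def longest_element_full longest_element_1
  by (rule ext, rule coord_eqI) auto

lemma omega_l: "omega simple l l = signed_perm flip (\<lambda>i. -1)"
  unfolding omega_def longest_element_full longest_element_l
  by (rule ext, rule coord_eqI) auto

lemma omega_l1: "omega simple l (l - 1) = signed_perm flip (\<lambda>i. if i = 1 \<or> i = l then 1 else -1)"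
  unfolding omega_def longest_element_full longest_element_l1
  by (rule ext, rule coord_eqI) auto

lemma omega_in_refl_group:
  "omega simple l 1 \<in> refl_group roots" "omega simple l (l - 1) \<in> refl_group roots"
  "omega simple l l \<in> refl_group roots"
  unfolding omega_def
  by (intro refl_group_comp longest_element_in_refl_group[OF parabolic_full]
      longest_element_in_refl_group[OF parabolic_1] longest_element_in_refl_group[OF parabolic_l1]
      longest_element_in_refl_group[OF parabolic_l])+

end

section \<open>The stabilizer of the fundamental alcove\<close>

lemma coset_eq_iff:
  fixes x y :: "'a::real_vector"
  assumes "0 \<in> L" "\<And>a b. a \<in> L \<Longrightarrow> b \<in> L \<Longrightarrow> a - b \<in> L"
  shows "x +o L = y +o L \<longleftrightarrow> x - y \<in> L"
proof
  assume "x +o L = y +o L"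
  moreover have "x \<in> x +o L" using assms(1) unfolding elt_set_plus_def by force
  ultimately obtain b where "b \<in> L" "x = y + b" unfolding elt_set_plus_def by blast
  then show "x - y \<in> L" by simp
next
  assume d: "x - y \<in> L"
  have neg: "- a \<in> L" if "a \<in> L" for a using assms(2)[OF assms(1) that] by simp
  have sub: "x +o L \<subseteq> y +o L" if d: "x - y \<in> L" for x y
  proof
    fix c assume "c \<in> x +o L"
    then obtain b where b: "b \<in> L" "c = x + b" unfolding elt_set_plus_def by blast
    have "(x - y) - (- b) \<in> L" using assms(2)[OF d neg[OF b(1)]] .
    moreover have "c = y + ((x - y) - (- b))" using b by simp
    ultimately show "c \<in> y +o L" unfolding elt_set_plus_def by blast
  qed
  have "y - x \<in> L" using neg[OF d] by simp
  then show "x +o L = y +o L" using sub d by blast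
qed

lemma linear_image_coset:
  assumes "linear w" "w ` L = L"
  shows "w ` (x +o L) = w x +o L"
proof -
  have coset: "y +o L = (\<lambda>b. y + b) ` L" for y unfolding elt_set_plus_def by auto
  have "w ` (x +o L) = (\<lambda>b. w x + b) ` (w ` L)"
    unfolding coset image_image using linear_add[OF assms(1)] by simp
  then show ?thesis unfolding coset assms(2) .
qed

context type_D
begin

abbreviation coweights :: "'a set" where "coweights \<equiv> coweight_lattice roots"
abbreviation fundamental_alcove :: "'a set" where "fundamental_alcove \<equiv> alcove roots simple l"

lemma coweights_iff: "x \<in> coweights \<longleftrightarrow> (\<forall>\<beta>\<in>pos_roots. \<beta> \<bullet> x \<in> \<int>)"
  unfolding coweight_lattice_def roots_eq by auto

lemma coweights_0: "0 \<in> coweights"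
  by (simp add: coweights_iff)

lemma coweights_add: "x \<in> coweights \<Longrightarrow> y \<in> coweights \<Longrightarrow> x + y \<in> coweights"
  by (simp add: coweights_iff inner_add_right)

lemma coweights_minus: "x \<in> coweights \<Longrightarrow> - x \<in> coweights"
  by (simp add: coweights_iff)

lemma coweights_diff: "x \<in> coweights \<Longrightarrow> y \<in> coweights \<Longrightarrow> x - y \<in> coweights"
  by (simp add: coweights_iff inner_diff_right)

lemma even_signed_perm_coweights:
  assumes "even_signed_perm w" "x \<in> coweights"
  shows "w x \<in> coweights"
proof -
  obtain w' where w': "even_signed_perm w'" "\<And>x y. x \<bullet> w y = w' x \<bullet> y"
    using even_signed_perm_inverse[OF assms(1)] by metis
  then show ?thesis
    using assms(2) even_signed_perm_roots[OF w'(1)] unfolding coweight_lattice_def by simp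
qed

lemma even_signed_perm_coset:
  assumes w: "even_signed_perm w" and L: "\<And>v x. even_signed_perm v \<Longrightarrow> x \<in> L \<Longrightarrow> v x \<in> L"
  shows "w ` (x +o L) = w x +o L"
proof (rule linear_image_coset[OF even_signed_perm_linear[OF w]])
  obtain w' where w': "even_signed_perm w'" "w \<circ> w' = id"
    using even_signed_perm_inverse[OF w] by metis
  have "b \<in> w ` L" if "b \<in> L" for b
    using L[OF w'(1) that] w'(2) by (metis comp_apply id_apply image_eqI)
  then show "w ` L = L" using L[OF w] by blast
qed

lemma highest_root_eq: "highest_root roots simple l = e 1 + e 2"
  unfolding highest_root_def
proof (rule the_equality)
  have cone: "e 1 + e 2 - \<gamma> \<in> simple_cone" if "\<gamma> \<in> roots" for \<gamma>
  proof -
    obtain \<beta> where \<beta>: "\<beta> \<in> pos_roots" "\<gamma> = \<beta> \<or> \<gamma> = - \<beta>" using \<open>\<gamma> \<in> roots\<close> unfolding roots_eq by blast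
    from \<beta>(1) show ?thesis
    proof (cases rule: pos_rootsE)
      case (diff i k)
      have "e 1 + e 2 - (e i - e k) = (e 1 - e i) + (e 2 + e k)"
        "e 1 + e 2 - (- (e i - e k)) = (e 1 - e k) + (e 2 + e i)" by simp_all
      moreover have "e 1 - e i \<in> simple_cone" "e 2 + e k \<in> simple_cone"
        "e 1 - e k \<in> simple_cone" "e 2 + e i \<in> simple_cone"
        using diff l4 by (auto intro!: diff_in_cone sum_in_cone)
      ultimately show ?thesis using \<beta>(2) diff by (metis simple_cone_add)
    next
      case (sum i k)
      have "e 1 + e 2 - (e i + e k) = (e 1 - e i) + (e 2 - e k)"
        "e 1 + e 2 - (- (e i + e k)) = (e 1 + e i) + (e 2 + e k)" by simp_all
      moreover have "e 1 - e i \<in> simple_cone" "e 2 - e k \<in> simple_cone"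
        "e 1 + e i \<in> simple_cone" "e 2 + e k \<in> simple_cone"
        using sum l4 by (auto intro!: diff_in_cone sum_in_cone)
      ultimately show ?thesis using \<beta>(2) sum by (metis simple_cone_add)
    qed
  qed
  have mem: "e 1 + e 2 \<in> roots" using pos_rootsI(2)[of 1 2] l4 unfolding roots_eq by auto
  then show max: "e 1 + e 2 \<in> roots \<and> (\<forall>\<gamma>\<in>roots. \<exists>c. e 1 + e 2 - \<gamma> = (\<Sum>i = 1..l. real (c i) *\<^sub>R simple i))"
    using cone unfolding simple_cone_def by blast
  fix \<beta> assume \<beta>: "\<beta> \<in> roots \<and> (\<forall>\<gamma>\<in>roots. \<exists>c. \<beta> - \<gamma> = (\<Sum>i = 1..l. real (c i) *\<^sub>R simple i))"
  \<comment> \<open>The difference and its negative both have nonnegative coefficients, whose sums are heights.\<close>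
  have height: "weyl_vector \<bullet> (\<Sum>i = 1..l. real (c i) *\<^sub>R simple i) = (\<Sum>i = 1..l. real (c i))" for c
    by (simp add: inner_sum_right weyl_vector_simple)
  obtain c where c: "\<beta> - (e 1 + e 2) = (\<Sum>i = 1..l. real (c i) *\<^sub>R simple i)"
    using \<beta> mem by blast
  obtain d where d: "(e 1 + e 2) - \<beta> = (\<Sum>i = 1..l. real (d i) *\<^sub>R simple i)"
    using \<beta> max by blast
  have "(\<Sum>i = 1..l. real (c i)) = - (\<Sum>i = 1..l. real (d i))"
    unfolding height[symmetric] c[symmetric] d[symmetric] by (simp add: inner_diff_right)
  moreover have "0 \<le> (\<Sum>i = 1..l. real (c i))" "0 \<le> (\<Sum>i = 1..l. real (d i))" by (auto intro: sum_nonneg)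
  ultimately have "(\<Sum>i = 1..l. real (c i)) = 0" by linarith
  then have "c i = 0" if "i \<in> {1..l}" for i using that by (subst (asm) sum_nonneg_eq_0_iff) auto
  then have "(\<Sum>i = 1..l. real (c i) *\<^sub>R simple i) = 0" by (intro sum.neutral) auto
  then show "\<beta> = e 1 + e 2" using c by simp
qed

lemma alcove_iff:
  "x \<in> fundamental_alcove \<longleftrightarrow>
    (\<forall>i\<in>{1..<l}. x \<bullet> e (i + 1) < x \<bullet> e i) \<and> 0 < x \<bullet> e (l - 1) + x \<bullet> e l \<and> x \<bullet> e 1 + x \<bullet> e 2 < 1"
proof -
  have "{1..l} = insert l {1..<l}" using l4 by auto
  then have "(\<forall>i\<in>{1..l}. 0 < simple i \<bullet> x) \<longleftrightarrow>
      (\<forall>i\<in>{1..<l}. x \<bullet> e (i + 1) < x \<bullet> e i) \<and> 0 < x \<bullet> e (l - 1) + x \<bullet> e l"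
    by (auto simp: D_simple_def inner_diff_left inner_add_left inner_commute inner_add_right inner_diff_right)
  then show ?thesis
    unfolding alcove_def highest_root_eq by (simp add: inner_add_left inner_commute inner_add_right inner_diff_right)
qed

lemma alcove_decreasing:
  assumes x: "x \<in> fundamental_alcove" and "1 \<le> i" "i < k" "k \<le> l"
  shows "x \<bullet> e k < x \<bullet> e i"
proof -
  have "i + d \<le> l \<Longrightarrow> 0 < d \<Longrightarrow> x \<bullet> e (i + d) < x \<bullet> e i" for d
  proof (induction d)
    case (Suc d)
    have "x \<bullet> e (i + d + 1) < x \<bullet> e (i + d)"
      using x Suc.prems(1) assms(2) unfolding alcove_iff by (elim conjE ballE[of _ _ "i + d"]) auto
    then show ?case using Suc by (cases "d = 0") auto
  qed simp
  from this[of "k - i"] show ?thesis using assms by simp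
qed

lemma alcove_weakly_decreasing:
  assumes x: "x \<in> fundamental_alcove" and "1 \<le> i" "i \<le> k" "k \<le> l"
  shows "x \<bullet> e k \<le> x \<bullet> e i"
  using alcove_decreasing[OF assms(1,2), of k] assms by (cases "i = k") auto

lemma alcove_pos_root:
  assumes x: "x \<in> fundamental_alcove" and \<beta>: "\<beta> \<in> pos_roots"
  shows "0 < \<beta> \<bullet> x" "\<beta> \<bullet> x < 1"
proof -
  have ends: "0 < x \<bullet> e (l - 1) + x \<bullet> e l" "x \<bullet> e 1 + x \<bullet> e 2 < 1" using x unfolding alcove_iff by auto
  have "0 < \<beta> \<bullet> x \<and> \<beta> \<bullet> x < 1"
    using \<beta>
  proof (cases rule: pos_rootsE)
    case (diff i k)
    have "\<beta> \<bullet> x = x \<bullet> e i - x \<bullet> e k" by (simp add: diff inner_diff_left inner_commute inner_add_right inner_diff_right)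
    moreover have "x \<bullet> e k < x \<bullet> e i" "x \<bullet> e i \<le> x \<bullet> e 1" "x \<bullet> e (l - 1) \<le> x \<bullet> e 2" "x \<bullet> e l \<le> x \<bullet> e k"
      using diff l4 by (auto intro!: alcove_decreasing[OF x] alcove_weakly_decreasing[OF x])
    ultimately show ?thesis using ends by linarith
  next
    case (sum i k)
    have "\<beta> \<bullet> x = x \<bullet> e i + x \<bullet> e k" by (simp add: sum inner_add_left inner_commute inner_add_right inner_diff_right)
    moreover have "x \<bullet> e i \<le> x \<bullet> e 1" "x \<bullet> e k \<le> x \<bullet> e 2" "x \<bullet> e (l - 1) \<le> x \<bullet> e i" "x \<bullet> e l \<le> x \<bullet> e k"
      using sum l4 by (auto intro!: alcove_decreasing[OF x] alcove_weakly_decreasing[OF x])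
    ultimately show ?thesis using ends by linarith
  qed
  then show "0 < \<beta> \<bullet> x" "\<beta> \<bullet> x < 1" by auto
qed

lemma of_coords_half_in_coweights:
  assumes "\<And>i. i \<in> {1..l} \<Longrightarrow> f i = 1/2 \<or> f i = - 1/2"
  shows "of_coords f \<in> coweights"
  unfolding coweights_iff
proof
  fix \<beta> assume "\<beta> \<in> pos_roots"
  then show "\<beta> \<bullet> of_coords f \<in> \<int>"
  proof (cases rule: pos_rootsE)
    case (diff i k)
    then have ik: "i \<in> {1..l}" "k \<in> {1..l}" by auto
    have "f i - f k = 0 \<or> f i - f k = 1 \<or> f i - f k = - 1"
      using assms[OF ik(1)] assms[OF ik(2)] by (elim disjE) simp_all
    then have "f i - f k \<in> \<int>" by auto
    then show ?thesis using ik diff by (simp add: inner_diff_left)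
  next
    case (sum i k)
    then have ik: "i \<in> {1..l}" "k \<in> {1..l}" by auto
    have "f i + f k = 0 \<or> f i + f k = 1 \<or> f i + f k = - 1"
      using assms[OF ik(1)] assms[OF ik(2)] by (elim disjE) simp_all
    then have "f i + f k \<in> \<int>" by auto
    then show ?thesis using ik sum by (simp add: inner_add_left)
  qed
qed

text \<open>Together with \<open>e 1\<close> these are the nonzero minuscule coweights.\<close>

abbreviation coweight_l :: 'a where "coweight_l \<equiv> of_coords (\<lambda>i. 1/2)"
abbreviation coweight_l1 :: 'a where "coweight_l1 \<equiv> of_coords (\<lambda>i. if i = l then - 1/2 else 1/2)"

text \<open>
  The sums and differences of two coordinates are \<open>0\<close> or \<open>1\<close>, so the first coordinate is \<open>0\<close>, \<open>1\<close> or
  \<open>1/2\<close>; comparing with it determines the others, the last one up to sign.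
\<close>

lemma minuscule_coweight_cases:
  assumes z: "z \<in> coweights" and b: "\<And>\<beta>. \<beta> \<in> pos_roots \<Longrightarrow> -1 < \<beta> \<bullet> z \<and> \<beta> \<bullet> z < 2"
  shows "z \<in> {0, e 1, coweight_l1, coweight_l}"
proof -
  have 01: "\<beta> \<bullet> z = 0 \<or> \<beta> \<bullet> z = 1" if "\<beta> \<in> pos_roots" for \<beta>
  proof -
    have "\<beta> \<bullet> z \<in> \<int>" using z that unfolding coweights_iff by blast
    then obtain n where "\<beta> \<bullet> z = of_int n" by (rule Ints_cases)
    then show ?thesis using b[OF that] by auto
  qed
  have pair: "(z \<bullet> e i - z \<bullet> e k = 0 \<or> z \<bullet> e i - z \<bullet> e k = 1) \<and> (z \<bullet> e i + z \<bullet> e k = 0 \<or> z \<bullet> e i + z \<bullet> e k = 1)"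
    if "1 \<le> i" "i < k" "k \<le> l" for i k
    using 01[OF pos_rootsI(1)[OF that]] 01[OF pos_rootsI(2)[OF that]]
    by (simp add: inner_diff_left inner_add_left inner_commute inner_add_right inner_diff_right)
  consider "z \<bullet> e 1 = 0" | "z \<bullet> e 1 = 1" | "z \<bullet> e 1 = 1/2"
    using pair[of 1 2] l4 by force
  then show ?thesis
  proof cases
    case 1
    have "z = 0"
    proof (rule coord_eqI)
      fix i assume "i \<in> {1..l}"
      then show "z \<bullet> e i = 0 \<bullet> e i" using pair[of 1 i] 1 by (cases "i = 1") auto
    qed
    then show ?thesis by simp
  next
    case 2
    have "z = e 1"
    proof (rule coord_eqI)
      fix i assume "i \<in> {1..l}"
      then show "z \<bullet> e i = e 1 \<bullet> e i" using pair[of 1 i] 2 by (cases "i = 1") (auto simp: e_inner)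
    qed
    then show ?thesis by simp
  next
    case 3
    have half: "z \<bullet> e i = 1/2" if "1 \<le> i" "i < l" for i
      using pair[of 1 i] pair[of i l] 3 that by (cases "i = 1") auto
    have "z \<bullet> e l = 1/2 \<or> z \<bullet> e l = - 1/2" using pair[of 1 l] 3 l4 by auto
    then show ?thesis
    proof
      assume "z \<bullet> e l = 1/2"
      then have "z = coweight_l" using half by (intro coord_eqI) (metis atLeastAtMost_iff le_neq_implies_less of_coords_inner)
      then show ?thesis by simp
    next
      assume "z \<bullet> e l = - 1/2"
      then have "z = coweight_l1" using half by (intro coord_eqI) (metis (mono_tags) atLeastAtMost_iff le_neq_implies_less of_coords_inner)
      then show ?thesis by simp
    qed
  qed
qed

end

context type_D_even
begin

text \<open>The pairs whose affine map \<open>x \<mapsto> \<omega> x + z\<close> is a symmetry of the fundamental alcove.\<close>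

definition alcove_symmetries :: "(('a \<Rightarrow> 'a) \<times> 'a) set" where
  "alcove_symmetries = {(id, 0), (omega simple l 1, e 1),
     (omega simple l (l - 1), coweight_l1), (omega simple l l, coweight_l)}"

lemma alcove_symmetry_involution:
  assumes "(\<omega>, z) \<in> alcove_symmetries"
  shows "\<omega> (\<omega> x) = x" "\<omega> z = - z"
proof -
  note defs = omega_1 omega_l omega_l1
  have "\<omega> (\<omega> x) = x \<and> \<omega> z = - z"
    using assms unfolding alcove_symmetries_def
  proof (elim insertE emptyE)
    assume "(\<omega>, z) = (omega simple l 1, e 1)"
    then show ?thesis
      using l4 unfolding defs
      by (auto intro!: signed_perm_involution coord_eqI simp: e_inner)
  next
    assume "(\<omega>, z) = (omega simple l (l - 1), coweight_l1)"
    then show ?thesis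
      using l4 flip_in unfolding defs
      by (auto intro!: signed_perm_involution coord_eqI simp: e_inner) (auto simp: flip_def)
  next
    assume "(\<omega>, z) = (omega simple l l, coweight_l)"
    then show ?thesis
      using l4 flip_in unfolding defs
      by (auto intro!: signed_perm_involution coord_eqI simp: e_inner)
  qed simp
  then show "\<omega> (\<omega> x) = x" "\<omega> z = - z" by auto
qed

lemma alcove_symmetry_refl_group:
  "(\<omega>, z) \<in> alcove_symmetries \<Longrightarrow> \<omega> \<in> refl_group roots"
  using omega_in_refl_group id_in_refl_group unfolding alcove_symmetries_def by blast

lemma alcove_symmetry_coweight:
  "(\<omega>, z) \<in> alcove_symmetries \<Longrightarrow> z \<in> coweights"
proof -
  have "e 1 \<in> coweights"
    unfolding coweights_iff
  proof
    fix \<beta> assume "\<beta> \<in> pos_roots"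
    then show "\<beta> \<bullet> e 1 \<in> \<int>"
      using l4 by (cases rule: pos_rootsE) (auto simp: inner_diff_left inner_add_left e_inner)
  qed
  moreover have "coweight_l1 \<in> coweights" "coweight_l \<in> coweights"
    by (rule of_coords_half_in_coweights; simp)+
  ultimately show "(\<omega>, z) \<in> alcove_symmetries \<Longrightarrow> z \<in> coweights"
    using coweights_0 unfolding alcove_symmetries_def by blast
qed

lemma alcove_symmetry_alcove:
  assumes "(\<omega>, z) \<in> alcove_symmetries" and x: "x \<in> fundamental_alcove"
  shows "\<omega> x + z \<in> fundamental_alcove"
proof -
  note defs = omega_1 omega_l omega_l1
  note dec = alcove_decreasing[OF x]
  have ends: "0 < x \<bullet> e (l - 1) + x \<bullet> e l" "x \<bullet> e 1 + x \<bullet> e 2 < 1" using x unfolding alcove_iff by auto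
  show ?thesis
    using assms(1) unfolding alcove_symmetries_def
  proof (elim insertE emptyE)
    assume "(\<omega>, z) = (omega simple l 1, e 1)"
    then have c: "(\<omega> x + z) \<bullet> e i = (if i = 1 then 1 - x \<bullet> e 1 else if i = l then - (x \<bullet> e l) else x \<bullet> e i)"
      if "i \<in> {1..l}" for i
      using l4 that unfolding defs by (auto simp: inner_add_left e_inner)
    show ?thesis
      unfolding alcove_iff
    proof (intro conjI ballI)
      fix i assume i: "i \<in> {1..<l}"
      show "(\<omega> x + z) \<bullet> e (i + 1) < (\<omega> x + z) \<bullet> e i"
        using i l4 ends dec[of i "i + 1"] by (auto simp: c numeral_2_eq_2)
    qed (use l4 ends dec[of "l - 1" l] dec[of 1 2] in \<open>auto simp: c numeral_2_eq_2\<close>)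
  next
    assume "(\<omega>, z) = (omega simple l (l - 1), coweight_l1)"
    then have c: "(\<omega> x + z) \<bullet> e i = (if i = 1 then 1/2 + x \<bullet> e l else
        if i = l then x \<bullet> e 1 - 1/2 else 1/2 - x \<bullet> e (l + 1 - i))"
      if "i \<in> {1..l}" for i
      using l4 that unfolding defs by (auto simp: inner_add_left flip_def)
    show ?thesis
      unfolding alcove_iff
    proof (intro conjI ballI)
      fix i assume i: "i \<in> {1..<l}"
      consider "i = 1" | "1 < i" "i < l - 1" | "i = l - 1" using i by force
      then show "(\<omega> x + z) \<bullet> e (i + 1) < (\<omega> x + z) \<bullet> e i"
        using i l4 ends dec[of "l - i" "l + 1 - i"] by cases (auto simp: c numeral_2_eq_2)
    qed (use l4 ends dec[of "l - 1" l] dec[of 1 2] in \<open>auto simp: c numeral_2_eq_2\<close>)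
  next
    assume "(\<omega>, z) = (omega simple l l, coweight_l)"
    then have c: "(\<omega> x + z) \<bullet> e i = 1/2 - x \<bullet> e (l + 1 - i)"
      if "i \<in> {1..l}" for i
      using l4 that unfolding defs by (auto simp: inner_add_left flip_def)
    show ?thesis
      unfolding alcove_iff
    proof (intro conjI ballI)
      fix i assume i: "i \<in> {1..<l}"
      then show "(\<omega> x + z) \<bullet> e (i + 1) < (\<omega> x + z) \<bullet> e i"
        using i l4 dec[of "l - i" "l + 1 - i"] by (auto simp: c)
    qed (use l4 ends in \<open>auto simp: c numeral_2_eq_2\<close>)
  qed (use x in simp)
qed

lemma alcove_symmetry_in_stabilizer:
  assumes \<omega>: "(\<omega>, z) \<in> alcove_symmetries"
  shows "\<omega> \<in> alcove_stabilizer roots simple l"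
proof -
  have W: "\<omega> \<in> refl_group roots" by (rule alcove_symmetry_refl_group[OF \<omega>])
  note esp = refl_group_even_signed_perm[OF W]
  have lin: "linear \<omega>" by (rule linear_refl_group[OF W])
  let ?A = "(\<lambda>x. x +o coweights) ` fundamental_alcove"
  have move: "\<omega> ` (x +o coweights) = (\<omega> x + z) +o coweights" for x
  proof -
    have "\<omega> ` (x +o coweights) = \<omega> x +o coweights"
      by (rule even_signed_perm_coset[OF esp]) (rule even_signed_perm_coweights)
    also have "\<dots> = (\<omega> x + z) +o coweights"
      using coweights_minus[OF alcove_symmetry_coweight[OF \<omega>]]
      by (subst coset_eq_iff) (auto intro: coweights_0 coweights_diff)
    finally show ?thesis .
  qed
  have "(\<lambda>t. \<omega> ` t) ` ?A = ?A"
  proof (intro equalityI subsetI)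
    fix t assume "t \<in> (\<lambda>t. \<omega> ` t) ` ?A"
    then obtain x where "x \<in> fundamental_alcove" "t = \<omega> ` (x +o coweights)" by blast
    then show "t \<in> ?A" using alcove_symmetry_alcove[OF \<omega>] move by blast
  next
    fix t assume "t \<in> ?A"
    then obtain x where x: "x \<in> fundamental_alcove" "t = x +o coweights" by blast
    have "\<omega> (\<omega> x + z) + z = x"
      using alcove_symmetry_involution[OF \<omega>] by (simp add: linear_add[OF lin])
    then have "t = \<omega> ` ((\<omega> x + z) +o coweights)" using move x(2) by simp
    then show "t \<in> (\<lambda>t. \<omega> ` t) ` ?A" using alcove_symmetry_alcove[OF \<omega> x(1)] by blast
  qed
  then show ?thesis using W unfolding alcove_stabilizer_def by (simp add: Let_def)
qed

text \<open>
  If \<open>w\<close> moves a point \<open>x\<close> of the alcove to the alcove translated by a coweight \<open>z\<close>, then the positive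
  roots take values strictly between \<open>-1\<close> and \<open>2\<close> on \<open>z\<close>.  So \<open>z\<close> belongs to one of the alcove
  symmetries, and undoing this symmetry leaves an element mapping \<open>x\<close> into the alcove, hence the
  identity.
\<close>

lemma stabilizer_is_alcove_symmetry:
  assumes w: "w \<in> alcove_stabilizer roots simple l"
  shows "\<exists>z. (w, z) \<in> alcove_symmetries"
proof -
  let ?A = "(\<lambda>x. x +o coweights) ` fundamental_alcove"
  have W: "w \<in> refl_group roots" and im: "(\<lambda>t. w ` t) ` ?A = ?A"
    using w unfolding alcove_stabilizer_def by (auto simp: Let_def)
  note esp = refl_group_even_signed_perm[OF W]
  define x where "x = of_coords (\<lambda>i. (real l + 1 - real i) / (4 * real l))"
  have xc: "x \<bullet> e i = (real l + 1 - real i) / (4 * real l)" if "i \<in> {1..l}" for i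
    using that by (simp add: x_def)
  have x: "x \<in> fundamental_alcove"
    unfolding alcove_iff using l4 by (auto simp: xc divide_strict_right_mono field_simps)
  have "w ` (x +o coweights) \<in> ?A" using im x by blast
  then obtain y where y: "y \<in> fundamental_alcove" "w ` (x +o coweights) = y +o coweights" by blast
  have "x \<in> x +o coweights" using coweights_0 unfolding elt_set_plus_def by force
  then have "w x \<in> y +o coweights" using y(2) by blast
  then obtain z' where z': "z' \<in> coweights" "w x = y + z'" unfolding elt_set_plus_def by blast
  define z where "z = - z'"
  have z: "z \<in> coweights" "y = w x + z" using z' coweights_minus by (auto simp: z_def)
  obtain w' where w': "even_signed_perm w'" "\<And>x y. x \<bullet> w y = w' x \<bullet> y"
    using even_signed_perm_inverse[OF esp] by metis
  have "-1 < \<beta> \<bullet> z \<and> \<beta> \<bullet> z < 2" if \<beta>: "\<beta> \<in> pos_roots" for \<beta>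
  proof -
    have "w' \<beta> \<in> roots" using even_signed_perm_roots[OF w'(1)] \<beta> unfolding roots_eq by blast
    then obtain \<gamma> where "\<gamma> \<in> pos_roots" "w' \<beta> = \<gamma> \<or> w' \<beta> = - \<gamma>" unfolding roots_eq by blast
    then have "-1 < w' \<beta> \<bullet> x" "w' \<beta> \<bullet> x < 1" using alcove_pos_root[OF x, of \<gamma>] by auto
    moreover have "\<beta> \<bullet> z = \<beta> \<bullet> y - w' \<beta> \<bullet> x" using z(2) w'(2) by (simp add: inner_add_right)
    ultimately show ?thesis using alcove_pos_root[OF y(1) \<beta>] by linarith
  qed
  then have "z \<in> {0, e 1, coweight_l1, coweight_l}" by (rule minuscule_coweight_cases[OF z(1)])
  then obtain \<omega> where \<omega>: "(\<omega>, z) \<in> alcove_symmetries" unfolding alcove_symmetries_def by blast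
  have lin: "linear \<omega>" by (rule linear_refl_group[OF alcove_symmetry_refl_group[OF \<omega>]])
  have "\<omega> (w x) = \<omega> y + z"
  proof -
    have "w x = y - z" using z(2) by simp
    then show ?thesis using alcove_symmetry_involution(2)[OF \<omega>] by (simp add: linear_diff[OF lin])
  qed
  then have v: "(\<omega> \<circ> w) x \<in> fundamental_alcove" using alcove_symmetry_alcove[OF \<omega> y(1)] by simp
  have "\<omega> \<circ> w = id"
  proof (rule even_signed_perm_chamber)
    show "even_signed_perm (\<omega> \<circ> w)"
      using W alcove_symmetry_refl_group[OF \<omega>] by (intro refl_group_even_signed_perm refl_group_comp)
    show "0 < x \<bullet> e i" if "i \<in> {1..l}" for i using that l4 by (simp add: xc)
    show "x \<bullet> e k < x \<bullet> e i" if "1 \<le> i" "i < k" "k \<le> l" for i k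
      by (rule alcove_decreasing[OF x that])
    show "(\<omega> \<circ> w) x \<bullet> e k < (\<omega> \<circ> w) x \<bullet> e i" if "1 \<le> i" "i < k" "k \<le> l" for i k
      by (rule alcove_decreasing[OF v that])
    show "0 < (\<omega> \<circ> w) x \<bullet> e (l - 1) + (\<omega> \<circ> w) x \<bullet> e l" using v unfolding alcove_iff by blast
  qed (use l4 in simp)
  then have "\<omega> (w u) = u" for u by (metis comp_apply id_apply)
  then have "w = \<omega>" using alcove_symmetry_involution(1)[OF \<omega>] by (metis ext)
  then show ?thesis using \<omega> by blast
qed

theorem alcove_stabilizer_eq:
  "alcove_stabilizer roots simple l = {id, omega simple l 1, omega simple l (l - 1), omega simple l l}"
proof -
  have "alcove_stabilizer roots simple l = fst ` alcove_symmetries"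
    using alcove_symmetry_in_stabilizer stabilizer_is_alcove_symmetry by force
  then show ?thesis unfolding alcove_symmetries_def by simp
qed

end

section \<open>Counting families of pairwise inequivalent elements\<close>

definition separated :: "('b \<Rightarrow> 'b \<Rightarrow> bool) \<Rightarrow> 'b set \<Rightarrow> 'i set \<Rightarrow> ('i \<Rightarrow> 'b) set" where
  "separated R A I = {x \<in> I \<rightarrow>\<^sub>E A. \<forall>i\<in>I. \<forall>k\<in>I. i \<noteq> k \<longrightarrow> \<not> R (x i) (x k)}"

lemma finite_separated: "finite I \<Longrightarrow> finite A \<Longrightarrow> finite (separated R A I)"
  unfolding separated_def by (rule finite_subset[of _ "I \<rightarrow>\<^sub>E A"]) (auto intro: finite_PiE)

lemma separated_in: "x \<in> separated R A I \<Longrightarrow> i \<in> I \<Longrightarrow> x i \<in> A"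
  unfolding separated_def by auto

lemma separated_undefined: "x \<in> separated R A I \<Longrightarrow> i \<notin> I \<Longrightarrow> x i = undefined"
  unfolding separated_def by (auto simp: PiE_def extensional_def)

lemma separated_neq: "x \<in> separated R A I \<Longrightarrow> i \<in> I \<Longrightarrow> k \<in> I \<Longrightarrow> i \<noteq> k \<Longrightarrow> \<not> R (x i) (x k)"
  unfolding separated_def by auto

lemma separatedI:
  assumes "\<And>i. i \<in> I \<Longrightarrow> x i \<in> A" "\<And>i. i \<notin> I \<Longrightarrow> x i = undefined"
    "\<And>i k. i \<in> I \<Longrightarrow> k \<in> I \<Longrightarrow> i \<noteq> k \<Longrightarrow> \<not> R (x i) (x k)"
  shows "x \<in> separated R A I"
  using assms unfolding separated_def by (auto simp: PiE_def extensional_def)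

text \<open>
  Each entry excludes its whole equivalence class for the others, so a family of \<open>j\<close> entries extends
  in \<open>card A - c * j\<close> ways.
\<close>

lemma card_separated_uniform:
  fixes R :: "'b \<Rightarrow> 'b \<Rightarrow> bool" and I :: "'i set"
  assumes "finite I" and A: "finite A" and R: "reflp R" "symp R" "transp R"
    and c: "\<And>a. a \<in> A \<Longrightarrow> card {b \<in> A. R a b} = c"
  shows "real (card (separated R A I)) = (\<Prod>j<card I. real (card A) - real c * real j)"
  using assms(1)
proof induction
  case empty
  have "separated R A ({} :: 'i set) = {\<lambda>_. undefined}"
    by (auto simp: separated_def)
  then show ?case by simp
next
  case (insert i I)
  define Opt where "Opt x = {a \<in> A. \<forall>k\<in>I. \<not> R (x k) a}" for x :: "'i \<Rightarrow> 'b"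
  have opt: "real (card (Opt x)) = real (card A) - real c * real (card I)" if x: "x \<in> separated R A I" for x
  proof -
    define U where "U = (\<Union>k\<in>I. {b \<in> A. R (x k) b})"
    have "card U = (\<Sum>k\<in>I. card {b \<in> A. R (x k) b})"
      unfolding U_def
    proof (rule card_UN_disjoint)
      show "\<forall>k\<in>I. \<forall>j\<in>I. k \<noteq> j \<longrightarrow> {b \<in> A. R (x k) b} \<inter> {b \<in> A. R (x j) b} = {}"
      proof (intro ballI impI)
        fix k j assume kj: "k \<in> I" "j \<in> I" "k \<noteq> j"
        have False if "R (x k) b" "R (x j) b" for b
          using that separated_neq[OF x kj] R by (meson sympD transpD)
        then show "{b \<in> A. R (x k) b} \<inter> {b \<in> A. R (x j) b} = {}" by blast
      qed
    qed (use insert A in auto)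
    also have "\<dots> = card I * c" using c separated_in[OF x] by simp
    finally have "card U = card I * c" .
    moreover have "U \<subseteq> A" unfolding U_def by blast
    moreover have "Opt x = A - U" unfolding Opt_def U_def by blast
    moreover have "card U \<le> card A" using A \<open>U \<subseteq> A\<close> by (rule card_mono)
    ultimately show ?thesis
      using A by (simp add: card_Diff_subset finite_subset of_nat_diff)
  qed
  have "bij_betw (\<lambda>(x, a). x(i := a)) (SIGMA x:separated R A I. Opt x) (separated R A (insert i I))"
  proof (rule bij_betw_byWitness[of _ "\<lambda>y. (restrict y I, y i)"])
    show "\<forall>p\<in>(SIGMA x:separated R A I. Opt x). (restrict ((\<lambda>(x, a). x(i := a)) p) I, (\<lambda>(x, a). x(i := a)) p i) = p"
    proof
      fix p assume "p \<in> (SIGMA x:separated R A I. Opt x)"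
      then obtain x a where x: "x \<in> separated R A I" and p: "p = (x, a)" by blast
      have "restrict (x(i := a)) I k = x k" for k
        using separated_undefined[OF x, of k] insert.hyps(2) by (cases "k \<in> I") auto
      then show "(restrict ((\<lambda>(x, a). x(i := a)) p) I, (\<lambda>(x, a). x(i := a)) p i) = p"
        unfolding p by auto
    qed
    show "\<forall>y\<in>separated R A (insert i I). (\<lambda>(x, a). x(i := a)) (restrict y I, y i) = y"
    proof
      fix y assume y: "y \<in> separated R A (insert i I)"
      have "((restrict y I)(i := y i)) k = y k" for k
        using separated_undefined[OF y, of k] by (cases "k \<in> insert i I") auto
      then show "(\<lambda>(x, a). x(i := a)) (restrict y I, y i) = y" by auto
    qed
    show "(\<lambda>(x, a). x(i := a)) ` (SIGMA x:separated R A I. Opt x) \<subseteq> separated R A (insert i I)"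
    proof clarify
      fix x a assume x: "x \<in> separated R A I" and a: "a \<in> Opt x"
      show "x(i := a) \<in> separated R A (insert i I)"
      proof (rule separatedI)
        show "(x(i := a)) j \<in> A" if "j \<in> insert i I" for j
          using that a separated_in[OF x] by (auto simp: Opt_def)
        show "(x(i := a)) j = undefined" if "j \<notin> insert i I" for j
          using that separated_undefined[OF x] by auto
        show "\<not> R ((x(i := a)) j) ((x(i := a)) k)" if "j \<in> insert i I" "k \<in> insert i I" "j \<noteq> k" for j k
          using that a separated_neq[OF x, of j k] R(2) by (auto simp: Opt_def dest: sympD)
      qed
    qed
    show "(\<lambda>y. (restrict y I, y i)) ` separated R A (insert i I) \<subseteq> (SIGMA x:separated R A I. Opt x)"
    proof clarify
      fix y assume y: "y \<in> separated R A (insert i I)"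
      have "restrict y I \<in> separated R A I"
        by (rule separatedI) (use separated_in[OF y] separated_neq[OF y] in auto)
      moreover have "y i \<in> Opt (restrict y I)"
        using separated_in[OF y] separated_neq[OF y] insert.hyps(2) by (auto simp: Opt_def)
      ultimately show "restrict y I \<in> separated R A I \<and> y i \<in> Opt (restrict y I)" by blast
    qed
  qed
  then have "card (separated R A (insert i I)) = card (SIGMA x:separated R A I. Opt x)"
    by (simp add: bij_betw_same_card)
  also have "\<dots> = (\<Sum>x\<in>separated R A I. card (Opt x))"
    using A insert.hyps(1) by (intro card_SigmaI finite_separated) (auto simp: Opt_def)
  finally have "real (card (separated R A (insert i I))) = (\<Sum>x\<in>separated R A I. real (card (Opt x)))"
    by simp
  also have "\<dots> = real (card (separated R A I)) * (real (card A) - real c * real (card I))"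
    using opt by simp
  finally show ?case using insert by simp
qed

text \<open>At most one entry lies in the additional class \<open>B\<close>.\<close>

lemma card_separated_Un_class:
  fixes I :: "'i set"
  assumes I: "finite I" and fin: "finite A" "finite B"
    and "symp R" and disj: "A \<inter> B = {}"
    and B: "\<And>a b. a \<in> B \<Longrightarrow> b \<in> B \<Longrightarrow> R a b" and AB: "\<And>a b. a \<in> A \<Longrightarrow> b \<in> B \<Longrightarrow> \<not> R a b"
    and f: "\<And>J :: 'i set. finite J \<Longrightarrow> real (card (separated R A J)) = f (card J)"
  shows "real (card (separated R (A \<union> B) I)) = f (card I) + real (card I) * real (card B) * f (card I - 1)"
proof -
  define F where "F i = (\<lambda>(x, b). x(i := b)) ` (separated R A (I - {i}) \<times> B)" for i
  have sym: "R a b \<Longrightarrow> R b a" for a b using \<open>symp R\<close> by (rule sympD)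
  have F: "F i = {y \<in> separated R (A \<union> B) I. y i \<in> B}" if i: "i \<in> I" for i
  proof (intro equalityI subsetI)
    fix y assume "y \<in> F i"
    then obtain x b where x: "x \<in> separated R A (I - {i})" and b: "b \<in> B" and y: "y = x(i := b)"
      unfolding F_def by auto
    have "y \<in> separated R (A \<union> B) I"
    proof (rule separatedI)
      show "y k \<in> A \<union> B" if "k \<in> I" for k using that separated_in[OF x] b y by auto
      show "y k = undefined" if "k \<notin> I" for k using that separated_undefined[OF x] i y by auto
      show "\<not> R (y j) (y k)" if "j \<in> I" "k \<in> I" "j \<noteq> k" for j k
        using that separated_neq[OF x, of j k] separated_in[OF x] AB b y sym by auto metis
    qed
    then show "y \<in> {y \<in> separated R (A \<union> B) I. y i \<in> B}" using b y by simp
  next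
    fix y assume "y \<in> {y \<in> separated R (A \<union> B) I. y i \<in> B}"
    then have y: "y \<in> separated R (A \<union> B) I" "y i \<in> B" by auto
    have "y k \<in> A" if "k \<in> I - {i}" for k
      using that separated_in[OF y(1), of k] separated_neq[OF y(1), of k i] i y(2) B by auto
    then have "y(i := undefined) \<in> separated R A (I - {i})"
      using separated_undefined[OF y(1)] separated_neq[OF y(1)] by (intro separatedI) auto
    moreover have "y = (y(i := undefined))(i := y i)" by simp
    ultimately show "y \<in> F i" unfolding F_def using y(2)
      by (intro image_eqI[of _ _ "(y(i := undefined), y i)"]) auto
  qed
  have card_F: "card (F i) = card (separated R A (I - {i})) * card B" if i: "i \<in> I" for i
  proof -
    have "inj_on (\<lambda>(x, b). x(i := b)) (separated R A (I - {i}) \<times> B)"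
    proof (rule inj_onI, clarify)
      fix x b x' b' assume x: "x \<in> separated R A (I - {i})" "x' \<in> separated R A (I - {i})"
        and eq: "x(i := b) = x'(i := b')"
      have "x k = x' k" for k
        using fun_cong[OF eq, of k] separated_undefined[OF x(1), of i] separated_undefined[OF x(2), of i]
        by (cases "k = i") auto
      then show "x = x' \<and> b = b'" using fun_cong[OF eq, of i] by auto
    qed
    then show ?thesis unfolding F_def by (simp add: card_image card_cartesian_product)
  qed
  have split: "separated R (A \<union> B) I = separated R A I \<union> (\<Union>i\<in>I. F i)"
  proof (intro equalityI subsetI)
    fix y assume y: "y \<in> separated R (A \<union> B) I"
    show "y \<in> separated R A I \<union> (\<Union>i\<in>I. F i)"
    proof (cases "\<exists>i\<in>I. y i \<in> B")
      case True
      then show ?thesis using F y by blast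
    next
      case False
      then have "y \<in> separated R A I"
        using separated_in[OF y] separated_undefined[OF y] separated_neq[OF y] by (intro separatedI) auto
      then show ?thesis by simp
    qed
  next
    fix y assume "y \<in> separated R A I \<union> (\<Union>i\<in>I. F i)"
    then show "y \<in> separated R (A \<union> B) I"
      using F separated_in[of y R A I] separated_undefined[of y R A I] separated_neq[of y R A I]
      by (auto intro!: separatedI)
  qed
  have fin_F: "finite (F i)" for i
    unfolding F_def using fin I by (auto intro!: finite_separated)
  have "card (\<Union>i\<in>I. F i) = (\<Sum>i\<in>I. card (F i))"
  proof (rule card_UN_disjoint)
    show "\<forall>i\<in>I. \<forall>j\<in>I. i \<noteq> j \<longrightarrow> F i \<inter> F j = {}"
      using F separated_neq[of _ R "A \<union> B" I] B by blast
  qed (use I fin_F in auto)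
  moreover have "separated R A I \<inter> (\<Union>i\<in>I. F i) = {}"
    using F separated_in[of _ R A I] disj by blast
  ultimately have "card (separated R (A \<union> B) I) =
      card (separated R A I) + (\<Sum>i\<in>I. card (separated R A (I - {i})) * card B)"
    using I fin fin_F card_F by (simp add: split card_Un_disjoint finite_separated)
  then have "real (card (separated R (A \<union> B) I)) = f (card I) + (\<Sum>i\<in>I. f (card (I - {i})) * real (card B))"
    using f I by simp
  also have "(\<Sum>i\<in>I. f (card (I - {i})) * real (card B)) = real (card I) * real (card B) * f (card I - 1)"
    using I by simp
  finally show ?thesis .
qed

section \<open>Residues up to sign\<close>

definition sign_cong :: "int \<Rightarrow> int \<Rightarrow> int \<Rightarrow> bool" where
  "sign_cong n a b \<longleftrightarrow> n dvd a - b \<or> n dvd a + b"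

lemma sign_cong_equiv: "reflp (sign_cong n)" "symp (sign_cong n)" "transp (sign_cong n)"
proof -
  show "reflp (sign_cong n)" by (rule reflpI) (simp add: sign_cong_def)
  show "symp (sign_cong n)"
    by (rule sympI) (auto simp: sign_cong_def dvd_diff_commute add.commute)
  show "transp (sign_cong n)"
  proof (rule transpI)
    fix a b c assume "sign_cong n a b" "sign_cong n b c"
    then consider "n dvd a - b" "n dvd b - c" | "n dvd a - b" "n dvd b + c"
      | "n dvd a + b" "n dvd b - c" | "n dvd a + b" "n dvd b + c"
      unfolding sign_cong_def by blast
    then show "sign_cong n a c"
    proof cases
      case 1
      then show ?thesis using dvd_add[of n "a - b" "b - c"] by (simp add: sign_cong_def)
    next
      case 2
      then show ?thesis using dvd_add[of n "a - b" "b + c"] by (simp add: sign_cong_def)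
    next
      case 3
      then show ?thesis using dvd_diff[of n "a + b" "b - c"] by (simp add: sign_cong_def)
    next
      case 4
      then show ?thesis using dvd_diff[of n "a + b" "b + c"] by (simp add: sign_cong_def)
    qed
  qed
qed

definition parity_residues :: "int \<Rightarrow> bool \<Rightarrow> int set" where
  "parity_residues q p = {a \<in> {0..<2 * q}. even a = p}"

lemma finite_parity_residues [simp]: "finite (parity_residues q p)"
  unfolding parity_residues_def by (rule finite_subset[of _ "{0..<2 * q}"]) auto

lemma card_parity_residues:
  assumes "0 \<le> q"
  shows "card (parity_residues q p) = nat q"
proof -
  have "bij_betw (\<lambda>k. 2 * k + of_bool (\<not> p)) {0..<q} (parity_residues q p)"
    by (rule bij_betw_byWitness[of _ "\<lambda>a. a div 2"]) (auto simp: parity_residues_def elim!: oddE)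
  then show ?thesis using bij_betw_same_card by fastforce
qed

lemma small_multiple:
  fixes n x :: int
  assumes "n dvd x" "0 < n" "- 2 * n < x" "x < 2 * n"
  shows "x = - n \<or> x = 0 \<or> x = n"
proof -
  obtain k where k: "x = n * k" using assms(1) by blast
  have "n * (- 2) < n * k" "n * k < n * 2" using assms(3,4) k by (simp_all add: mult.commute)
  then have "- 2 < k" "k < 2" using assms(2) mult_less_cancel_left_pos by blast+
  then have "k = -1 \<or> k = 0 \<or> k = 1" by linarith
  then show ?thesis using k by auto
qed

lemma card_sign_class_2:
  fixes q :: int
  assumes "0 < q" and a: "a \<in> {a \<in> parity_residues q p. \<not> q dvd a}"
  shows "card {b \<in> {a \<in> parity_residues q p. \<not> q dvd a}. sign_cong (2 * q) a b} = 2"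
proof -
  have a': "0 < a" "a < 2 * q" "even a = p" "\<not> q dvd a" "a \<noteq> q"
    using a by (auto simp: parity_residues_def order.order_iff_strict)
  have "{b \<in> {a \<in> parity_residues q p. \<not> q dvd a}. sign_cong (2 * q) a b} = {a, 2 * q - a}" (is "?L = _")
  proof (intro equalityI subsetI)
    fix b assume "b \<in> ?L"
    then have b: "0 \<le> b" "b < 2 * q" "2 * q dvd a - b \<or> 2 * q dvd a + b"
      by (auto simp: parity_residues_def sign_cong_def)
    from b(3) show "b \<in> {a, 2 * q - a}"
    proof
      assume "2 * q dvd a - b"
      then show ?thesis using small_multiple[of "2 * q" "a - b"] a' b by auto
    next
      assume "2 * q dvd a + b"
      then show ?thesis using small_multiple[of "2 * q" "a + b"] a' b by auto
    qed
  next
    fix b assume "b \<in> {a, 2 * q - a}"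
    moreover have "q dvd 2 * q - a \<longleftrightarrow> q dvd a" by (simp add: dvd_diff_right_iff)
    ultimately show "b \<in> ?L"
      using a' by (auto simp: parity_residues_def sign_cong_def)
  qed
  then show ?thesis using a' by auto
qed

text \<open>
  In \<open>{0..<4 * h}\<close> each of \<open>a\<close> and \<open>- a\<close> has two representatives modulo \<open>2 * h\<close>; they have the same parity and
  coincide only if \<open>h\<close> divides \<open>a\<close>.
\<close>

lemma card_sign_class_4:
  fixes h :: int
  assumes "0 < h" and a: "a \<in> {a \<in> parity_residues (2 * h) p. \<not> h dvd a}"
  shows "card {b \<in> {a \<in> parity_residues (2 * h) p. \<not> h dvd a}. sign_cong (2 * h) a b} = 4"
proof -
  define a' where "a' = (if a < 2 * h then a + 2 * h else a - 2 * h)"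
  have a1: "0 < a" "a < 4 * h" "even a = p" "\<not> h dvd a" "a \<noteq> h" "a \<noteq> 2 * h" "a \<noteq> 3 * h"
    using a by (auto simp: parity_residues_def order.order_iff_strict)
  have "{b \<in> {a \<in> parity_residues (2 * h) p. \<not> h dvd a}. sign_cong (2 * h) a b} = {a, a', 4 * h - a, 4 * h - a'}"
    (is "?L = _")
  proof (intro equalityI subsetI)
    fix b assume "b \<in> ?L"
    then have b: "0 \<le> b" "b < 4 * h" "2 * h dvd a - b \<or> 2 * h dvd a + b"
      by (auto simp: parity_residues_def sign_cong_def)
    from b(3) show "b \<in> {a, a', 4 * h - a, 4 * h - a'}"
    proof
      assume "2 * h dvd a - b"
      then have "a - b = - (2 * h) \<or> a - b = 0 \<or> a - b = 2 * h"
        using small_multiple[of "2 * h" "a - b"] a1 b by auto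
      then have "b = a \<or> b = a' \<or> b = 4 * h - a \<or> b = 4 * h - a'"
        using a1(1,2) b(1,2) unfolding a'_def by (smt (verit))
      then show ?thesis by simp
    next
      assume "2 * h dvd a + b"
      then have "2 * h dvd a + b - 4 * h" by (simp add: dvd_diff)
      then have "a + b - 4 * h = - (2 * h) \<or> a + b - 4 * h = 0 \<or> a + b - 4 * h = 2 * h"
        using small_multiple[of "2 * h" "a + b - 4 * h"] a1 b by auto
      then have "b = a \<or> b = a' \<or> b = 4 * h - a \<or> b = 4 * h - a'"
        using a1(1,2) b(1,2) unfolding a'_def by (smt (verit))
      then show ?thesis by simp
    qed
  next
    fix b assume b: "b \<in> {a, a', 4 * h - a, 4 * h - a'}"
    have "h dvd a' \<longleftrightarrow> h dvd a" by (auto simp: a'_def dvd_add_left_iff dvd_diff_left_iff)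
    moreover have "h dvd 4 * h - x \<longleftrightarrow> h dvd x" for x by (simp add: dvd_diff_right_iff)
    ultimately have "\<not> h dvd b" using b a1 by auto
    moreover have "sign_cong (2 * h) a b"
    proof -
      have "2 * h dvd 4 * h" by simp
      then show ?thesis using b
        by (auto simp: sign_cong_def a'_def algebra_simps split: if_splits)
    qed
    moreover have "b \<in> parity_residues (2 * h) p"
      using b a1 by (auto simp: parity_residues_def a'_def split: if_splits)
    ultimately show "b \<in> ?L" by simp
  qed
  moreover have "card {a, a', 4 * h - a, 4 * h - a'} = 4"
    using a1 by (auto simp: a'_def card_insert_if)
  ultimately show ?thesis by simp
qed

text \<open>
  With \<open>d = q\<close> these are the residues in full classes up to sign modulo \<open>2 * q\<close>, with \<open>d = q div 2\<close> those in
  full classes up to sign modulo \<open>q\<close>.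
\<close>

definition generic_residues :: "int \<Rightarrow> int \<Rightarrow> bool \<Rightarrow> int set" where
  "generic_residues d q p = {a \<in> parity_residues q p. \<not> d dvd a}"

lemma finite_generic_residues [simp]: "finite (generic_residues d q p)"
  by (simp add: generic_residues_def)

lemma multiples_below_twice:
  fixes q a :: int
  assumes "0 < q" "0 \<le> a" "a < 2 * q"
  shows "q dvd a \<longleftrightarrow> a = 0 \<or> a = q"
  using small_multiple[of q a] assms by auto

lemma multiples_below_four_times:
  fixes h a :: int
  assumes "0 < h" "0 \<le> a" "a < 4 * h"
  shows "h dvd a \<longleftrightarrow> a = 0 \<or> a = h \<or> a = 2 * h \<or> a = 3 * h"
proof
  assume "h dvd a"
  then have "h dvd a - 2 * h" by simp
  then show "a = 0 \<or> a = h \<or> a = 2 * h \<or> a = 3 * h"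
  proof -
    assume d: "h dvd a - 2 * h"
    show ?thesis
    proof (cases "a = 0")
      case False
      then show ?thesis using small_multiple[OF d] assms by auto
    qed simp
  qed
qed auto

lemma real_card_generic_residues_2:
  assumes "0 < q"
  shows "real (card (generic_residues q q p)) =
    (if odd q then of_int q - 1 else if p then of_int q - 2 else of_int q)"
proof -
  let ?M = "{a \<in> {0, q}. even a = p}"
  have M: "?M \<subseteq> parity_residues q p" using assms by (auto simp: parity_residues_def)
  have "generic_residues q q p = parity_residues q p - ?M"
    using multiples_below_twice[OF assms] by (auto simp: generic_residues_def parity_residues_def)
  moreover have "card ?M \<le> card (parity_residues q p)" by (rule card_mono[OF _ M]) simp
  ultimately have "real (card (generic_residues q q p)) = of_int q - real (card ?M)"
    using assms M by (simp add: card_Diff_subset card_parity_residues of_nat_diff)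
  moreover have "?M = (if odd q then {if p then 0 else q} else if p then {0, q} else {})"
    by auto
  ultimately show ?thesis using assms by auto
qed

lemma real_card_generic_residues_4:
  assumes "0 < h"
  shows "real (card (generic_residues h (2 * h) p)) =
    (if odd h then 2 * of_int h - 2 else if p then 2 * of_int h - 4 else 2 * of_int h)"
proof -
  let ?M = "{a \<in> {0, h, 2 * h, 3 * h}. even a = p}"
  have M: "?M \<subseteq> parity_residues (2 * h) p" using assms by (auto simp: parity_residues_def)
  have "generic_residues h (2 * h) p = parity_residues (2 * h) p - ?M"
    using multiples_below_four_times[OF assms] by (auto simp: generic_residues_def parity_residues_def)
  moreover have "card ?M \<le> card (parity_residues (2 * h) p)" by (rule card_mono[OF _ M]) simp
  ultimately have "real (card (generic_residues h (2 * h) p)) = 2 * of_int h - real (card ?M)"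
    using assms M by (simp add: card_Diff_subset card_parity_residues of_nat_diff)
  moreover have "?M = (if odd h then if p then {0, 2 * h} else {h, 3 * h} else
      if p then {0, h, 2 * h, 3 * h} else {})"
    by auto
  ultimately show ?thesis using assms by auto
qed

lemma card_separated_generic_2:
  assumes "0 < q" "finite (I :: nat set)"
  shows "real (card (separated (sign_cong (2 * q)) (generic_residues q q p) I)) =
    (\<Prod>j<card I. real (card (generic_residues q q p)) - 2 * real j)"
proof -
  have "real (card (separated (sign_cong (2 * q)) (generic_residues q q p) I)) =
      (\<Prod>j<card I. real (card (generic_residues q q p)) - real 2 * real j)"
    by (rule card_separated_uniform[OF assms(2) finite_generic_residues sign_cong_equiv])
      (use card_sign_class_2[OF assms(1)] in \<open>simp add: generic_residues_def\<close>)
  then show ?thesis by simp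
qed

lemma card_separated_generic_4:
  assumes "0 < h" "finite (I :: nat set)"
  shows "real (card (separated (sign_cong (2 * h)) (generic_residues h (2 * h) p) I)) =
    (\<Prod>j<card I. real (card (generic_residues h (2 * h) p)) - 4 * real j)"
proof -
  have "real (card (separated (sign_cong (2 * h)) (generic_residues h (2 * h) p) I)) =
      (\<Prod>j<card I. real (card (generic_residues h (2 * h) p)) - real 4 * real j)"
    by (rule card_separated_uniform[OF assms(2) finite_generic_residues sign_cong_equiv])
      (use card_sign_class_4[OF assms(1)] in \<open>simp add: generic_residues_def\<close>)
  then show ?thesis by simp
qed

lemma not_sign_cong_multiple:
  assumes "d dvd n" "\<not> d dvd a" "d dvd b"
  shows "\<not> sign_cong n a b"
proof
  assume "sign_cong n a b"
  then have "d dvd a - b \<or> d dvd a + b" using assms(1) dvd_trans unfolding sign_cong_def by blast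
  then have "d dvd (a - b) + b \<or> d dvd (a + b) - b" using assms(3) dvd_add dvd_diff by blast
  then show False using assms(2) by simp
qed

text \<open>
  For odd \<open>q\<close> each parity contains exactly one residue modulo \<open>2 * q\<close> that is congruent to its negative.
\<close>

lemma card_separated_odd:
  assumes q: "0 < q" "odd q" and n: "0 < n"
  shows "real (card (separated (sign_cong (2 * q)) (parity_residues q p) {1..n})) =
    (\<Prod>i=1..n-1. of_int q - (2 * real i - 1)) * (of_int q - (real n - 1))"
proof -
  let ?f = "\<lambda>k. \<Prod>j<k. (of_int q - 1) - 2 * real j"
  obtain k where k: "n = Suc k" using n by (cases n) auto
  define s where "s = (if p then 0 else q)"
  have "parity_residues q p = generic_residues q q p \<union> {s}"
    using multiples_below_twice[OF q(1)] q by (auto simp: generic_residues_def parity_residues_def s_def)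
  moreover have "real (card (separated (sign_cong (2 * q)) (generic_residues q q p \<union> {s}) {1..n})) =
      ?f (card {1..n}) + real (card {1..n}) * real (card {s}) * ?f (card {1..n} - 1)"
  proof (rule card_separated_Un_class)
    show "generic_residues q q p \<inter> {s} = {}" by (auto simp: generic_residues_def s_def)
    show "sign_cong (2 * q) a b" if "a \<in> {s}" "b \<in> {s}" for a b
      using that by (simp add: sign_cong_def)
    show "\<not> sign_cong (2 * q) a b" if "a \<in> generic_residues q q p" "b \<in> {s}" for a b
      by (rule not_sign_cong_multiple[of q]) (use that in \<open>auto simp: generic_residues_def s_def\<close>)
    show "real (card (separated (sign_cong (2 * q)) (generic_residues q q p) J)) = ?f (card J)"
      if "finite J" for J :: "nat set"
      using card_separated_generic_2[OF q(1) that, of p] real_card_generic_residues_2[OF q(1), of p] q(2)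
      by simp
  qed (use sign_cong_equiv in auto)
  moreover have "(\<Prod>i=1..n-1. of_int q - (2 * real i - 1)) = ?f k"
    unfolding k by (simp add: prod.atLeast1_atMost_eq algebra_simps)
  ultimately show ?thesis unfolding k by (simp add: algebra_simps)
qed

lemma card_separated_even_odd_residues:
  assumes q: "0 < q" "even q" and n: "0 < n"
  shows "real (card (separated (sign_cong (2 * q)) (parity_residues q False) {1..n})) =
    of_int q * (\<Prod>i=1..n-1. of_int q - 2 * real i)"
proof -
  obtain k where k: "n = Suc k" using n by (cases n) auto
  have "parity_residues q False = generic_residues q q False"
    using multiples_below_twice[OF q(1)] q by (auto simp: generic_residues_def parity_residues_def)
  then show ?thesis
    using card_separated_generic_2[OF q(1), of "{1..n}" False] real_card_generic_residues_2[OF q(1), of False] q(2)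
    unfolding k by (simp add: prod.lessThan_Suc_shift prod.atLeast1_atMost_eq del: prod.lessThan_Suc)
qed

text \<open>
  For even \<open>q\<close> both residues congruent to their negatives, \<open>0\<close> and \<open>q\<close>, are even, so two classes of
  one element are added in turn.
\<close>

lemma card_separated_even_even_residues:
  assumes q: "0 < q" "even q" and n: "2 \<le> n"
  shows "real (card (separated (sign_cong (2 * q)) (parity_residues q True) {1..n})) =
    (\<Prod>i=1..n-2. of_int q - 2 * real i) * (of_int q * (of_int q - 2 * real n + 2) + real n * (real n - 1))"
proof -
  let ?f = "\<lambda>k. \<Prod>j<k. (of_int q - 2) - 2 * real j"
  let ?g = "\<lambda>k. ?f k + real k * ?f (k - 1)"
  obtain k where k: "n = Suc (Suc k)" using n by (metis Suc_le_D numeral_2_eq_2 Suc_le_mono)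
  let ?G = "generic_residues q q True"
  have f: "real (card (separated (sign_cong (2 * q)) ?G J)) = ?f (card J)" if "finite J" for J :: "nat set"
    using card_separated_generic_2[OF q(1) that, of True] real_card_generic_residues_2[OF q(1), of True] q(2)
    by simp
  have g: "real (card (separated (sign_cong (2 * q)) (?G \<union> {0}) J)) = ?g (card J)"
    if J: "finite J" for J :: "nat set"
  proof -
    have "real (card (separated (sign_cong (2 * q)) (?G \<union> {0}) J)) =
        ?f (card J) + real (card J) * real (card {0 :: int}) * ?f (card J - 1)"
    proof (rule card_separated_Un_class[OF J])
      show "\<not> sign_cong (2 * q) a b" if "a \<in> ?G" "b \<in> {0}" for a b
        by (rule not_sign_cong_multiple[of q]) (use that in \<open>auto simp: generic_residues_def\<close>)
      show "?G \<inter> {0} = {}" by (auto simp: generic_residues_def)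
      show "sign_cong (2 * q) a b" if "a \<in> {0}" "b \<in> {0}" for a b
        using that by (simp add: sign_cong_def)
    qed (use sign_cong_equiv f in auto)
    then show ?thesis by simp
  qed
  have "parity_residues q True = (?G \<union> {0}) \<union> {q}"
    using multiples_below_twice[OF q(1)] q by (auto simp: generic_residues_def parity_residues_def)
  moreover have "real (card (separated (sign_cong (2 * q)) ((?G \<union> {0}) \<union> {q}) {1..n})) =
        ?g (card {1..n}) + real (card {1..n}) * real (card {q}) * ?g (card {1..n} - 1)"
  proof (rule card_separated_Un_class)
    show "(?G \<union> {0}) \<inter> {q} = {}" using q by (auto simp: generic_residues_def)
    show "sign_cong (2 * q) a b" if "a \<in> {q}" "b \<in> {q}" for a b
      using that by (simp add: sign_cong_def)
    show "\<not> sign_cong (2 * q) a b" if "a \<in> ?G \<union> {0}" "b \<in> {q}" for a b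
    proof (cases "a = 0")
      case True
      then show ?thesis using that q small_multiple[of "2 * q" q] by (auto simp: sign_cong_def)
    next
      case False
      then show ?thesis
        by (intro not_sign_cong_multiple[of q]) (use that in \<open>auto simp: generic_residues_def\<close>)
    qed
  qed (use sign_cong_equiv g in auto)
  moreover have "(\<Prod>i=1..n-2. of_int q - 2 * real i) = ?f k"
    unfolding k by (simp add: prod.atLeast1_atMost_eq algebra_simps)
  ultimately show ?thesis unfolding k by (simp add: algebra_simps)
qed

text \<open>The residues modulo \<open>4 * h\<close> that differ from their mirror image \<open>2 * h - a\<close>.\<close>

definition unbalanced_residues :: "int \<Rightarrow> bool \<Rightarrow> int set" where
  "unbalanced_residues h p = {a \<in> parity_residues (2 * h) p. \<not> 4 * h dvd 2 * a - 2 * h}"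

lemma unbalanced_residues_eq:
  assumes h: "0 < h"
  shows "unbalanced_residues h p = generic_residues h (2 * h) p \<union> (if p then {0, 2 * h} else {})"
proof -
  have "4 * h dvd 2 * a - 2 * h \<longleftrightarrow> a = h \<or> a = 3 * h" if "0 \<le> a" "a < 4 * h" for a
  proof -
    have "4 * h dvd 2 * a - 2 * h \<longleftrightarrow> 2 * (2 * h) dvd 2 * (a - h)" by (simp add: algebra_simps)
    also have "\<dots> \<longleftrightarrow> 2 * h dvd a - h" by (subst dvd_mult_cancel_left) simp
    also have "\<dots> \<longleftrightarrow> a = h \<or> a = 3 * h" using small_multiple[of "2 * h" "a - h"] that h by auto
    finally show ?thesis .
  qed
  note * = this
  show ?thesis
  proof (rule Set.set_eqI)
    fix a
    show "a \<in> unbalanced_residues h p \<longleftrightarrow>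
        a \<in> generic_residues h (2 * h) p \<union> (if p then {0, 2 * h} else {})"
    proof (cases "a \<in> parity_residues (2 * h) p")
      case True
      then have a: "0 \<le> a" "a < 4 * h" "even a = p" by (auto simp: parity_residues_def)
      have "a \<in> unbalanced_residues h p \<longleftrightarrow> \<not> (a = h \<or> a = 3 * h)"
        using True *[OF a(1,2)] unfolding unbalanced_residues_def by blast
      moreover have "a \<in> generic_residues h (2 * h) p \<longleftrightarrow> \<not> (a = 0 \<or> a = h \<or> a = 2 * h \<or> a = 3 * h)"
        using True multiples_below_four_times[OF h a(1,2)] unfolding generic_residues_def by blast
      moreover have "a = 0 \<or> a = 2 * h \<Longrightarrow> p" using a(3) by auto
      moreover have "h \<noteq> 0" using h by simp
      ultimately show ?thesis by auto
    next
      case False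
      moreover have "0 \<in> parity_residues (2 * h) True" "2 * h \<in> parity_residues (2 * h) True"
        using h by (auto simp: parity_residues_def)
      ultimately show ?thesis by (auto simp: unbalanced_residues_def generic_residues_def)
    qed
  qed
qed

text \<open>
  Besides classes of four elements the even residues contain the class \<open>{0, 2 * h}\<close>.
\<close>

lemma card_separated_unbalanced_even:
  assumes h: "0 < h" and n: "0 < n"
  shows "real (card (separated (sign_cong (2 * h)) (unbalanced_residues h True) {1..n})) =
    (\<Prod>i=1..n-1. 2 * of_int h - (4 * real i - (if odd h then 2 else 0))) *
    (2 * of_int h - 2 * real n + (if odd h then 2 else 0))"
proof -
  let ?f = "\<lambda>k. \<Prod>j<k. (2 * of_int h - (if odd h then 2 else 4)) - 4 * real j"
  obtain k where k: "n = Suc k" using n by (cases n) auto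
  let ?G = "generic_residues h (2 * h) True"
  have "real (card (separated (sign_cong (2 * h)) (?G \<union> {0, 2 * h}) {1..n})) =
      ?f (card {1..n}) + real (card {1..n}) * real (card {0, 2 * h}) * ?f (card {1..n} - 1)"
  proof (rule card_separated_Un_class)
    show "?G \<inter> {0, 2 * h} = {}" by (auto simp: generic_residues_def)
    show "sign_cong (2 * h) a b" if "a \<in> {0, 2 * h}" "b \<in> {0, 2 * h}" for a b
      using that by (auto simp: sign_cong_def)
    show "\<not> sign_cong (2 * h) a b" if "a \<in> ?G" "b \<in> {0, 2 * h}" for a b
      by (rule not_sign_cong_multiple[of h]) (use that in \<open>auto simp: generic_residues_def\<close>)
    show "real (card (separated (sign_cong (2 * h)) ?G J)) = ?f (card J)" if "finite J" for J :: "nat set"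
      using card_separated_generic_4[OF h that, of True] real_card_generic_residues_4[OF h, of True]
      by simp
  qed (use sign_cong_equiv in auto)
  moreover have "(\<Prod>i=1..n-1. 2 * of_int h - (4 * real i - (if odd h then 2 else 0))) = ?f k"
    unfolding k by (simp add: prod.atLeast1_atMost_eq algebra_simps)
  ultimately show ?thesis
    using h unfolding k unbalanced_residues_eq[OF h] by (cases "odd h") (simp_all add: algebra_simps)
qed

lemma card_separated_unbalanced_odd:
  assumes h: "0 < h" and n: "0 < n"
  shows "real (card (separated (sign_cong (2 * h)) (unbalanced_residues h False) {1..n})) =
    (\<Prod>i=1..n-1. 2 * of_int h - (4 * real i - (if odd h then 2 else 0))) *
    (2 * of_int h - (if odd h then 4 * real n - 2 else 0))"
proof -
  obtain k where k: "n = Suc k" using n by (cases n) auto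
  have "real (card (separated (sign_cong (2 * h)) (unbalanced_residues h False) {1..n})) =
      (\<Prod>j<n. (2 * of_int h - (if odd h then 2 else 0)) - 4 * real j)"
    using card_separated_generic_4[OF h, of "{1..n}" False] real_card_generic_residues_4[OF h, of False]
    unfolding unbalanced_residues_eq[OF h] by simp
  also have "\<dots> = (\<Prod>i=1..n-1. 2 * of_int h - (4 * real i - (if odd h then 2 else 0))) *
    (2 * of_int h - (if odd h then 4 * real n - 2 else 0))"
  proof (cases "odd h")
    case True
    then show ?thesis unfolding k by (simp add: prod.atLeast1_atMost_eq algebra_simps)
  next
    case False
    then show ?thesis
      unfolding k by (simp add: prod.lessThan_Suc_shift prod.atLeast1_atMost_eq algebra_simps del: prod.lessThan_Suc)
  qed
  finally show ?thesis .
qed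

section \<open>Points of the toric complement as families of residues\<close>

context type_D
begin

abbreviation scaled_coweights :: "nat \<Rightarrow> 'a set" where
  "scaled_coweights q \<equiv> (\<lambda>z. real q *\<^sub>R z) ` coweights"

text \<open>The argument gives the doubled coordinates, which are integers for a coweight.\<close>

definition half_point :: "(nat \<Rightarrow> int) \<Rightarrow> 'a" where
  "half_point X = of_coords (\<lambda>i. of_int (X i) / 2)"

lemma half_point_inner [simp]: "i \<in> {1..l} \<Longrightarrow> half_point X \<bullet> e i = of_int (X i) / 2"
  by (simp add: half_point_def)

lemma half_point_diff: "half_point X - half_point Y = half_point (\<lambda>i. X i - Y i)"
  by (rule coord_eqI) (simp add: inner_diff_left diff_divide_distrib)

lemma half_in_Ints_iff: "of_int a / 2 \<in> (\<int> :: real set) \<longleftrightarrow> even a"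
proof
  assume "of_int a / 2 \<in> (\<int> :: real set)"
  then obtain n :: int where "of_int a / 2 = (of_int n :: real)" by (rule Ints_cases)
  then have "(of_int a :: real) = of_int (2 * n)" by simp
  then have "a = 2 * n" by (simp only: of_int_eq_iff)
  then show "even a" by simp
qed (auto elim!: evenE)

lemma half_point_in_coweights:
  "half_point X \<in> coweights \<longleftrightarrow> (\<forall>i\<in>{1..l}. \<forall>k\<in>{1..l}. even (X i) = even (X k))"
proof
  assume X: "half_point X \<in> coweights"
  have lt: "even (X i) = even (X k)" if "1 \<le> i" "i < k" "k \<le> l" for i k
  proof -
    have "(e i - e k) \<bullet> half_point X \<in> \<int>"
      using X pos_rootsI(1)[OF that] unfolding coweights_iff by blast
    moreover have "(e i - e k) \<bullet> half_point X = of_int (X i - X k) / 2"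
      using that by (simp add: inner_diff_left inner_commute[of _ "half_point X"] inner_diff_right inner_add_right diff_divide_distrib)
    ultimately have "of_int (X i - X k) / 2 \<in> (\<int> :: real set)" by simp
    then show ?thesis unfolding half_in_Ints_iff by simp
  qed
  show "\<forall>i\<in>{1..l}. \<forall>k\<in>{1..l}. even (X i) = even (X k)"
  proof (intro ballI)
    fix i k assume "i \<in> {1..l}" "k \<in> {1..l}"
    then show "even (X i) = even (X k)" by (metis lt linorder_neqE_nat atLeastAtMost_iff)
  qed
next
  assume X: "\<forall>i\<in>{1..l}. \<forall>k\<in>{1..l}. even (X i) = even (X k)"
  show "half_point X \<in> coweights"
    unfolding coweights_iff
  proof
    fix \<beta> assume "\<beta> \<in> pos_roots"
    then show "\<beta> \<bullet> half_point X \<in> \<int>"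
    proof (cases rule: pos_rootsE)
      case (diff i k)
      then have "even (X i - X k)" using X by auto
      moreover have "\<beta> \<bullet> half_point X = of_int (X i - X k) / 2"
        using diff by (simp add: inner_diff_left inner_commute[of _ "half_point X"] inner_diff_right inner_add_right diff_divide_distrib)
      ultimately show ?thesis using half_in_Ints_iff by metis
    next
      case (sum i k)
      then have "even (X i + X k)" using X by auto
      moreover have "\<beta> \<bullet> half_point X = of_int (X i + X k) / 2"
        using sum by (simp add: inner_add_left inner_commute[of _ "half_point X"] inner_diff_right inner_add_right add_divide_distrib)
      ultimately show ?thesis using half_in_Ints_iff by metis
    qed
  qed
qed

lemma coweight_half_pointE:
  assumes x: "x \<in> coweights"
  obtains X where "x = half_point X"
proof -
  have "2 * (x \<bullet> e i) \<in> \<int>" if i: "i \<in> {1..l}" for i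
  proof -
    define j :: nat where "j = (if i = 1 then 2 else 1)"
    have j: "j \<in> {1..l}" "i \<noteq> j" using l4 by (auto simp: j_def)
    have root: "e i + c *\<^sub>R e j \<in> roots" if "c \<in> {1, -1}" for c
    proof -
      have "e i + c *\<^sub>R e j = 1 *\<^sub>R e i + c *\<^sub>R e j" by simp
      then show ?thesis unfolding roots_signs using that i j by blast
    qed
    have "e i + e j \<in> roots" "e i - e j \<in> roots" using root[of 1] root[of "-1"] by simp_all
    then have "(e i + e j) \<bullet> x + (e i - e j) \<bullet> x \<in> \<int>"
      using x unfolding coweight_lattice_def by (intro Ints_add) blast+
    then show ?thesis by (simp add: inner_diff_left inner_add_left inner_commute inner_diff_right inner_add_right)
  qed
  then have "of_int \<lfloor>2 * (x \<bullet> e i)\<rfloor> = 2 * (x \<bullet> e i)" if "i \<in> {1..l}" for i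
    unfolding of_int_floor_cancel using that by (metis Ints_cases)
  then have "x = half_point (\<lambda>i. \<lfloor>2 * (x \<bullet> e i)\<rfloor>)"
    by (intro coord_eqI) (simp del: of_int_floor_cancel)
  then show ?thesis by (rule that)
qed

lemma half_point_in_scaled:
  assumes q: "0 < q"
  shows "half_point X \<in> scaled_coweights q \<longleftrightarrow>
    (\<forall>i\<in>{1..l}. 2 * int q dvd X i) \<or> (\<forall>i\<in>{1..l}. 2 * int q dvd X i - int q)"
proof
  assume "half_point X \<in> scaled_coweights q"
  then obtain z where z: "z \<in> coweights" "half_point X = real q *\<^sub>R z" by blast
  obtain Y where Y: "z = half_point Y" using coweight_half_pointE[OF z(1)] .
  have X: "X i = int q * Y i" if "i \<in> {1..l}" for i
  proof -
    have "half_point X \<bullet> e i = real q * (half_point Y \<bullet> e i)" using z(2) Y by simp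
    then have "(of_int (X i) :: real) = of_int (int q * Y i)" using that by simp
    then show ?thesis by (simp only: of_int_eq_iff)
  qed
  have par: "even (Y i) = even (Y 1)" if "i \<in> {1..l}" for i
  proof -
    have "1 \<in> {1..l}" using l4 by simp
    then show ?thesis using z(1) that unfolding Y half_point_in_coweights by blast
  qed
  show "(\<forall>i\<in>{1..l}. 2 * int q dvd X i) \<or> (\<forall>i\<in>{1..l}. 2 * int q dvd X i - int q)"
  proof (cases "even (Y 1)")
    case True
    then have "2 * int q dvd X i" if "i \<in> {1..l}" for i
      using par[OF that] X[OF that] by (simp add: mult.commute mult_dvd_mono)
    then show ?thesis by blast
  next
    case False
    have "2 * int q dvd X i - int q" if "i \<in> {1..l}" for i
    proof -
      have "2 * int q dvd (Y i - 1) * int q" using par[OF that] False by (intro mult_dvd_mono) auto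
      then show ?thesis by (simp add: X[OF that] algebra_simps)
    qed
    then show ?thesis by blast
  qed
next
  have I: "half_point X \<in> scaled_coweights q" if Y: "\<And>i. i \<in> {1..l} \<Longrightarrow> X i = int q * Y i"
    "\<And>i k. i \<in> {1..l} \<Longrightarrow> k \<in> {1..l} \<Longrightarrow> even (Y i) = even (Y k)" for Y
  proof (rule image_eqI)
    show "half_point X = real q *\<^sub>R half_point Y" by (rule coord_eqI) (simp add: Y(1))
    show "half_point Y \<in> coweights" unfolding half_point_in_coweights using Y(2) by blast
  qed
  assume "(\<forall>i\<in>{1..l}. 2 * int q dvd X i) \<or> (\<forall>i\<in>{1..l}. 2 * int q dvd X i - int q)"
  then show "half_point X \<in> scaled_coweights q"
  proof
    assume "\<forall>i\<in>{1..l}. 2 * int q dvd X i"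
    then have "X i = int q * (2 * (X i div (2 * int q)))" if "i \<in> {1..l}" for i
      using dvd_mult_div_cancel[of "2 * int q" "X i"] that by (metis mult.assoc mult.commute)
    then show ?thesis by (rule I) auto
  next
    assume "\<forall>i\<in>{1..l}. 2 * int q dvd X i - int q"
    then have "X i = int q * (2 * ((X i - int q) div (2 * int q)) + 1)" if "i \<in> {1..l}" for i
      using dvd_mult_div_cancel[of "2 * int q" "X i - int q"] that by (simp add: algebra_simps)
    then show ?thesis by (rule I) auto
  qed
qed

lemma scaled_coweights_0: "0 \<in> scaled_coweights q"
  using coweights_0 by (intro image_eqI[of _ _ 0]) auto

lemma scaled_coweights_diff: "a \<in> scaled_coweights q \<Longrightarrow> b \<in> scaled_coweights q \<Longrightarrow> a - b \<in> scaled_coweights q"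
  using coweights_diff by (auto simp flip: scaleR_diff_right)

lemma scaled_coweights_subset: "scaled_coweights q \<subseteq> coweights"
proof
  fix y assume "y \<in> scaled_coweights q"
  then obtain z where z: "z \<in> coweights" "y = real q *\<^sub>R z" by blast
  then show "y \<in> coweights" unfolding coweights_iff by (auto simp: Ints_mult)
qed

lemma scaled_coset_eq_iff: "x +o scaled_coweights q = y +o scaled_coweights q \<longleftrightarrow> x - y \<in> scaled_coweights q"
  by (rule coset_eq_iff[OF scaled_coweights_0 scaled_coweights_diff])

definition regular :: "nat \<Rightarrow> 'a \<Rightarrow> bool" where
  "regular q x \<longleftrightarrow> (\<forall>\<beta>\<in>roots. \<not> (\<exists>k::int. \<beta> \<bullet> x = real q * of_int k))"

lemma regular_cong:
  assumes "x - y \<in> scaled_coweights q" "regular q x"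
  shows "regular q y"
  unfolding regular_def
proof (intro ballI notI)
  fix \<beta> assume \<beta>: "\<beta> \<in> roots" and "\<exists>k::int. \<beta> \<bullet> y = real q * of_int k"
  then obtain k :: int where k: "\<beta> \<bullet> y = real q * of_int k" by blast
  obtain z where z: "z \<in> coweights" "x - y = real q *\<^sub>R z" using assms(1) by blast
  have "\<beta> \<bullet> z \<in> \<int>" using z(1) \<beta> unfolding coweight_lattice_def by blast
  then obtain n :: int where n: "\<beta> \<bullet> z = of_int n" by (rule Ints_cases)
  have "x = y + real q *\<^sub>R z" using z(2) by (simp add: algebra_simps)
  then have "\<beta> \<bullet> x = \<beta> \<bullet> y + real q * (\<beta> \<bullet> z)" by (simp add: inner_add_right)
  then have "\<beta> \<bullet> x = real q * of_int (k + n)" by (simp add: k n algebra_simps)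
  then show False using assms(2) \<beta> unfolding regular_def by blast
qed

lemma regular_half_point:
  assumes q: "0 < q"
  shows "regular q (half_point X) \<longleftrightarrow> (\<forall>i\<in>{1..l}. \<forall>k\<in>{1..l}. i \<noteq> k \<longrightarrow> \<not> sign_cong (2 * int q) (X i) (X k))"
proof -
  have mult: "(\<exists>n::int. of_int a / 2 = real q * of_int n) \<longleftrightarrow> 2 * int q dvd a" for a
  proof -
    have "of_int a / 2 = real q * of_int n \<longleftrightarrow> a = 2 * int q * n" for n :: int
    proof -
      have "of_int a / 2 = real q * of_int n \<longleftrightarrow> (of_int a :: real) = of_int (2 * int q * n)" by auto
      then show ?thesis by (simp only: of_int_eq_iff)
    qed
    then show ?thesis by (simp add: dvd_def)
  qed
  have vals: "(e i - e k) \<bullet> half_point X = of_int (X i - X k) / 2" "(e i + e k) \<bullet> half_point X = of_int (X i + X k) / 2"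
    if "1 \<le> i" "i < k" "k \<le> l" for i k
    using that by (simp_all add: inner_diff_left inner_add_left inner_commute[of _ "half_point X"] inner_diff_right inner_add_right diff_divide_distrib add_divide_distrib)
  have neg: "(\<exists>n::int. (- \<beta>) \<bullet> x = real q * of_int n) \<longleftrightarrow> (\<exists>n::int. \<beta> \<bullet> x = real q * of_int n)" for \<beta> x :: 'a
  proof -
    have "(- \<beta>) \<bullet> x = real q * of_int n \<longleftrightarrow> \<beta> \<bullet> x = real q * of_int (- n)" for n :: int by auto
    then show ?thesis by (metis minus_minus)
  qed
  have "regular q (half_point X) \<longleftrightarrow> (\<forall>\<beta>\<in>pos_roots. \<not> (\<exists>n::int. \<beta> \<bullet> half_point X = real q * of_int n))"
  proof -
    define Q where "Q \<beta> \<longleftrightarrow> \<not> (\<exists>n::int. \<beta> \<bullet> half_point X = real q * of_int n)" for \<beta>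
    have "Q (- \<beta>) \<longleftrightarrow> Q \<beta>" for \<beta> unfolding Q_def neg ..
    then show ?thesis unfolding regular_def roots_eq Q_def[symmetric] by auto
  qed
  also have "\<dots> \<longleftrightarrow> (\<forall>i k. 1 \<le> i \<longrightarrow> i < k \<longrightarrow> k \<le> l \<longrightarrow> \<not> sign_cong (2 * int q) (X i) (X k))"
  proof
    assume L: "\<forall>\<beta>\<in>pos_roots. \<not> (\<exists>n::int. \<beta> \<bullet> half_point X = real q * of_int n)"
    show "\<forall>i k. 1 \<le> i \<longrightarrow> i < k \<longrightarrow> k \<le> l \<longrightarrow> \<not> sign_cong (2 * int q) (X i) (X k)"
    proof (intro allI impI)
      fix i k assume ik: "1 \<le> i" "i < k" "k \<le> l"
      show "\<not> sign_cong (2 * int q) (X i) (X k)"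
        using bspec[OF L pos_rootsI(1)[OF ik]] bspec[OF L pos_rootsI(2)[OF ik]]
        unfolding sign_cong_def vals[OF ik] mult by blast
    qed
  next
    assume R: "\<forall>i k. 1 \<le> i \<longrightarrow> i < k \<longrightarrow> k \<le> l \<longrightarrow> \<not> sign_cong (2 * int q) (X i) (X k)"
    show "\<forall>\<beta>\<in>pos_roots. \<not> (\<exists>n::int. \<beta> \<bullet> half_point X = real q * of_int n)"
    proof
      fix \<beta> assume "\<beta> \<in> pos_roots"
      then show "\<not> (\<exists>n::int. \<beta> \<bullet> half_point X = real q * of_int n)"
      proof (cases rule: pos_rootsE)
        case (diff i k)
        then have "\<not> 2 * int q dvd X i - X k" using R unfolding sign_cong_def by blast
        then show ?thesis unfolding diff(4) vals(1)[OF diff(1-3)] mult .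
      next
        case (sum i k)
        then have "\<not> 2 * int q dvd X i + X k" using R unfolding sign_cong_def by blast
        then show ?thesis unfolding sum(4) vals(2)[OF sum(1-3)] mult .
      qed
    qed
  qed
  also have "\<dots> \<longleftrightarrow> (\<forall>i\<in>{1..l}. \<forall>k\<in>{1..l}. i \<noteq> k \<longrightarrow> \<not> sign_cong (2 * int q) (X i) (X k))"
  proof
    assume L: "\<forall>i k. 1 \<le> i \<longrightarrow> i < k \<longrightarrow> k \<le> l \<longrightarrow> \<not> sign_cong (2 * int q) (X i) (X k)"
    show "\<forall>i\<in>{1..l}. \<forall>k\<in>{1..l}. i \<noteq> k \<longrightarrow> \<not> sign_cong (2 * int q) (X i) (X k)"
    proof (intro ballI impI)
      fix i k assume "i \<in> {1..l}" "k \<in> {1..l}" "i \<noteq> k"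
      then have "\<not> sign_cong (2 * int q) (X i) (X k) \<or> \<not> sign_cong (2 * int q) (X k) (X i)"
        using L by (cases i k rule: linorder_cases) auto
      then show "\<not> sign_cong (2 * int q) (X i) (X k)" using sign_cong_equiv(2) by (metis sympD)
    qed
  qed simp
  finally show ?thesis .
qed

lemma toric_complement_half_point:
  assumes q: "0 < q"
  shows "half_point X +o scaled_coweights q \<in> toric_complement roots q \<longleftrightarrow>
    (\<forall>i\<in>{1..l}. \<forall>k\<in>{1..l}. even (X i) = even (X k)) \<and>
    (\<forall>i\<in>{1..l}. \<forall>k\<in>{1..l}. i \<noteq> k \<longrightarrow> \<not> sign_cong (2 * int q) (X i) (X k))"
proof -
  have "half_point X +o scaled_coweights q \<in> toric_complement roots q \<longleftrightarrow>
      half_point X \<in> coweights \<and> regular q (half_point X)"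
  proof
    assume "half_point X +o scaled_coweights q \<in> toric_complement roots q"
    then obtain x where x: "half_point X +o scaled_coweights q = x +o scaled_coweights q" "x \<in> coweights" "regular q x"
      unfolding toric_complement_def regular_def by blast
    have d: "half_point X - x \<in> scaled_coweights q" "x - half_point X \<in> scaled_coweights q"
      using x(1) scaled_coset_eq_iff by metis+
    have "half_point X = (half_point X - x) + x" by simp
    then have "half_point X \<in> coweights" using d(1) x(2) scaled_coweights_subset coweights_add by (metis subsetD)
    then show "half_point X \<in> coweights \<and> regular q (half_point X)" using regular_cong[OF d(2) x(3)] by blast
  next
    assume "half_point X \<in> coweights \<and> regular q (half_point X)"
    then show "half_point X +o scaled_coweights q \<in> toric_complement roots q"
      unfolding toric_complement_def regular_def by blast
  qed
  then show ?thesis unfolding half_point_in_coweights regular_half_point[OF q] .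
qed

lemma even_signed_perm_scaled_coset:
  assumes "even_signed_perm w"
  shows "w ` (x +o scaled_coweights q) = w x +o scaled_coweights q"
proof (rule even_signed_perm_coset[OF assms])
  fix v y assume v: "even_signed_perm v" and "y \<in> scaled_coweights q"
  then obtain z where "z \<in> coweights" "y = real q *\<^sub>R z" by blast
  then have "v y = real q *\<^sub>R v z" "v z \<in> coweights"
    using linear_scale[OF even_signed_perm_linear[OF v]] even_signed_perm_coweights[OF v] by auto
  then show "v y \<in> scaled_coweights q" by blast
qed

abbreviation regular_families :: "nat \<Rightarrow> bool \<Rightarrow> (nat \<Rightarrow> int) set" where
  "regular_families q p \<equiv> separated (sign_cong (2 * int q)) (parity_residues (int q) p) {1..l}"

definition fixed_families :: "nat \<Rightarrow> ('a \<Rightarrow> 'a) \<Rightarrow> bool \<Rightarrow> (nat \<Rightarrow> int) set" where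
  "fixed_families q w p = {X \<in> regular_families q p.
     w (half_point X) - half_point X \<in> scaled_coweights q}"

text \<open>
  A coset of \<open>q\<close> times the coweight lattice contains the half points of exactly two families with
  entries in \<open>{0..<2 * q}\<close>, which differ by adding \<open>q\<close> to all entries: on doubled
  coordinates this lattice is the union of the multiples of \<open>2 * q\<close> and their translate by \<open>q\<close> in every entry.
\<close>

lemma two_fixed_count:
  assumes q: "0 < q" and w: "even_signed_perm w"
  shows "2 * fixed_count roots q w = card (fixed_families q w True) + card (fixed_families q w False)"
proof -
  define T where "T = fixed_families q w True \<union> fixed_families q w False"
  define Fix where "Fix = {t \<in> toric_complement roots q. w ` t = t}"
  define F where "F X = half_point X +o scaled_coweights q" for X
  let ?X = "{1..l} \<rightarrow>\<^sub>E {0..<2 * int q}"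
  have F_eq: "F X = F Y \<longleftrightarrow> (\<forall>i\<in>{1..l}. 2 * int q dvd X i - Y i) \<or> (\<forall>i\<in>{1..l}. 2 * int q dvd X i - Y i - int q)" for X Y
    unfolding F_def scaled_coset_eq_iff half_point_diff half_point_in_scaled[OF q] ..
  have T: "T = {X \<in> ?X. F X \<in> Fix}"
  proof (rule Set.set_eqI)
    fix X
    have "F X \<in> Fix \<longleftrightarrow> F X \<in> toric_complement roots q \<and> w (half_point X) - half_point X \<in> scaled_coweights q"
      unfolding Fix_def F_def by (auto simp: even_signed_perm_scaled_coset[OF w] scaled_coset_eq_iff)
    moreover have "X \<in> regular_families q True \<union>
        regular_families q False \<longleftrightarrow>
        X \<in> ?X \<and> F X \<in> toric_complement roots q"
    proof -
      define S where "S \<longleftrightarrow> (\<forall>i\<in>{1..l}. \<forall>k\<in>{1..l}. i \<noteq> k \<longrightarrow> \<not> sign_cong (2 * int q) (X i) (X k))"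
      define E where "E p \<longleftrightarrow> (\<forall>i\<in>{1..l}. even (X i) = p)" for p
      have sep: "X \<in> regular_families q p \<longleftrightarrow>
          X \<in> ?X \<and> E p \<and> S" for p
      proof -
        have "X \<in> {1..l} \<rightarrow>\<^sub>E parity_residues (int q) p \<longleftrightarrow> X \<in> ?X \<and> E p"
          unfolding E_def parity_residues_def PiE_iff by auto
        then show ?thesis unfolding separated_def S_def by simp
      qed
      have "1 \<in> {1..l}" using l4 by simp
      then have par: "(\<forall>i\<in>{1..l}. \<forall>k\<in>{1..l}. even (X i) = even (X k)) \<longleftrightarrow> E True \<or> E False"
        unfolding E_def by metis
      show ?thesis
        unfolding F_def toric_complement_half_point[OF q] par S_def[symmetric] Un_iff sep by argo
    qed
    ultimately show "X \<in> T \<longleftrightarrow> X \<in> {X \<in> ?X. F X \<in> Fix}"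
      unfolding T_def fixed_families_def by blast
  qed
  have finX: "finite ?X" by (intro finite_PiE) auto
  then have finT: "finite T" unfolding T by simp
  have mod_mem: "restrict (\<lambda>i. a i mod (2 * int q)) {1..l} \<in> ?X" for a
    using q by (auto simp: PiE_def)
  have in_range: "0 \<le> X i \<and> X i < 2 * int q" if "X \<in> ?X" "i \<in> {1..l}" for X i
    using PiE_mem[OF that] by simp
  have surj: "F ` T = Fix"
  proof (intro equalityI subsetI)
    fix t assume "t \<in> F ` T"
    then show "t \<in> Fix" unfolding T by blast
  next
    fix t assume t: "t \<in> Fix"
    then obtain x where x: "x \<in> coweights" "t = x +o scaled_coweights q"
      unfolding Fix_def toric_complement_def by blast
    obtain X where X: "x = half_point X" using coweight_half_pointE[OF x(1)] .
    define Y where "Y = restrict (\<lambda>i. X i mod (2 * int q)) {1..l}"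
    have "2 * int q dvd X i - Y i" if "i \<in> {1..l}" for i
      using that by (simp add: Y_def mod_eq_dvd_iff[symmetric])
    then have "F Y = t" using F_eq[of X Y] x(2) X unfolding F_def by blast
    moreover have "Y \<in> ?X" unfolding Y_def by (rule mod_mem)
    ultimately show "t \<in> F ` T" using t unfolding T by blast
  qed
  have fiber: "card {Y \<in> T. F Y = t} = 2" if "t \<in> F ` T" for t
  proof -
    obtain X where X: "X \<in> ?X" "F X = t" "t \<in> Fix" using \<open>t \<in> F ` T\<close> unfolding T by blast
    define X' where "X' = restrict (\<lambda>i. (X i + int q) mod (2 * int q)) {1..l}"
    have X': "X' \<in> ?X" unfolding X'_def by (rule mod_mem)
    have X'd: "2 * int q dvd X' i - (X i + int q)" if "i \<in> {1..l}" for i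
      using that by (simp add: X'_def mod_eq_dvd_iff[symmetric])
    have ext: "Y = Z" if "Y \<in> ?X" "Z \<in> ?X" "\<And>i. i \<in> {1..l} \<Longrightarrow> 2 * int q dvd Y i - Z i" for Y Z
    proof (rule PiE_ext[OF that(1,2)])
      fix i assume i: "i \<in> {1..l}"
      then show "Y i = Z i"
        using small_multiple[OF that(3)[OF i]] q in_range[OF that(1) i] in_range[OF that(2) i] by auto
    qed
    have "{Y \<in> T. F Y = t} = {Y \<in> ?X. F Y = F X}" using X unfolding T by auto
    also have "\<dots> = {X, X'}"
    proof (intro equalityI subsetI)
      fix Y assume "Y \<in> {Y \<in> ?X. F Y = F X}"
      then have Y: "Y \<in> ?X" "F Y = F X" by auto
      from Y(2)[unfolded F_eq] show "Y \<in> {X, X'}"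
      proof
        assume "\<forall>i\<in>{1..l}. 2 * int q dvd Y i - X i"
        then show ?thesis using ext[OF Y(1) X(1)] by blast
      next
        assume d: "\<forall>i\<in>{1..l}. 2 * int q dvd Y i - X i - int q"
        have "2 * int q dvd Y i - X' i" if "i \<in> {1..l}" for i
          using dvd_diff[OF bspec[OF d that] X'd[OF that]] by (simp add: algebra_simps)
        then show ?thesis using ext[OF Y(1) X'] by blast
      qed
    next
      fix Y assume "Y \<in> {X, X'}"
      moreover have "F X' = F X" unfolding F_eq using X'd by (simp add: algebra_simps)
      ultimately show "Y \<in> {Y \<in> ?X. F Y = F X}" using X(1) X' by blast
    qed
    finally have "{Y \<in> T. F Y = t} = {X, X'}" .
    moreover have "X \<noteq> X'"
    proof
      assume "X = X'"
      then have "2 * int q dvd - int q" using X'd[of 1] l4 by simp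
      then show False using small_multiple[of "2 * int q" "- int q"] q by auto
    qed
    ultimately show ?thesis by simp
  qed
  have "card T = (\<Sum>t\<in>F ` T. card {Y \<in> T. F Y = t})"
    using sum.image_gen[OF finT, of "\<lambda>_. 1 :: nat" F] by simp
  also have "\<dots> = 2 * card (F ` T)" using fiber by simp
  finally have "card T = 2 * fixed_count roots q w"
    unfolding surj fixed_count_def Fix_def .
  moreover have "card T = card (fixed_families q w True) + card (fixed_families q w False)"
    unfolding T_def
  proof (rule card_Un_disjoint)
    show "finite (fixed_families q w True)" "finite (fixed_families q w False)"
      using finT unfolding T_def by auto
    have "even (X 1) = p" if "X \<in> fixed_families q w p" for X p
    proof -
      have "X 1 \<in> parity_residues (int q) p"
        using that l4 unfolding fixed_families_def by (auto intro: separated_in)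
      then show ?thesis by (simp add: parity_residues_def)
    qed
    then show "fixed_families q w True \<inter> fixed_families q w False = {}" by blast
  qed
  ultimately show ?thesis by simp
qed

end

section \<open>The fixed points of the alcove symmetries\<close>

context type_D
begin

lemma signed_perm_half_point_diff:
  assumes "\<And>i. i \<in> {1..l} \<Longrightarrow> s i = of_int (\<sigma> i)" "\<And>i. i \<in> {1..l} \<Longrightarrow> \<pi> i \<in> {1..l}"
  shows "signed_perm \<pi> s (half_point X) - half_point X = half_point (\<lambda>i. \<sigma> i * X (\<pi> i) - X i)"
  using assms by (intro coord_eqI) (simp add: inner_diff_left diff_divide_distrib)

lemma two_fixed_count_id:
  assumes "0 < q"
  shows "2 * real (fixed_count roots q id) =
    real (card (regular_families q True)) +
    real (card (regular_families q False))"
proof -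
  have "fixed_families q id p = regular_families q p" for p
    using scaled_coweights_0 unfolding fixed_families_def by simp
  then show ?thesis
    using two_fixed_count[OF assms even_signed_perm_id] by (metis of_nat_add of_nat_mult of_nat_numeral)
qed

lemma fixed_count_id_odd:
  assumes q: "0 < q" "odd q"
  shows "real (fixed_count roots q id) = (\<Prod>i=1..l-1. real q - (2 * real i - 1)) * (real q - (real l - 1))"
  using two_fixed_count_id[OF q(1)] card_separated_odd[of "int q" l] q l4 by simp

lemma fixed_count_id_even:
  assumes q: "0 < q" "even q"
  shows "real (fixed_count roots q id) = (\<Prod>i=1..l-2. real q - 2 * real i) *
    ((real q)\<^sup>2 - 2 * (real l - 1) * real q + real l * (real l - 1) / 2)"
proof -
  obtain k where k: "l = Suc (Suc k)" using l4 that[of "l - 2"] by simp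
  have "2 * real (fixed_count roots q id) = (\<Prod>i=1..l-2. real q - 2 * real i) *
      (real q * (real q - 2 * real l + 2) + real l * (real l - 1)) +
      real q * (\<Prod>i=1..l-1. real q - 2 * real i)"
    using two_fixed_count_id[OF q(1)] card_separated_even_even_residues[of "int q" l]
      card_separated_even_odd_residues[of "int q" l] q l4 by simp
  also have "(\<Prod>i=1..l-1. real q - 2 * real i) = (\<Prod>i=1..l-2. real q - 2 * real i) * (real q - 2 * (real l - 1))"
    unfolding k by (simp add: atLeastAtMostSuc_conv)
  finally have total: "2 * real (fixed_count roots q id) = (\<Prod>i=1..l-2. real q - 2 * real i) *
      (real q * (real q - 2 * real l + 2) + real l * (real l - 1)) +
      real q * ((\<Prod>i=1..l-2. real q - 2 * real i) * (real q - 2 * (real l - 1)))" .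
  have "2 * c = P * (Q * (Q - 2 * L + 2) + L * (L - 1)) + Q * (P * (Q - 2 * (L - 1))) \<Longrightarrow>
      c = P * (Q\<^sup>2 - 2 * (L - 1) * Q + L * (L - 1) / 2)" for c P Q L :: real
    by (simp add: field_simps power2_eq_square)
  from this[OF total] show ?thesis .
qed

end

context type_D_even
begin

text \<open>
  The middle coordinates do not move, so the doubled differences cannot all be \<open>q\<close> modulo \<open>2 * q\<close>.
\<close>

lemma fixed_families_omega_1:
  assumes q: "0 < q"
  shows "fixed_families q (omega simple l 1) p =
    {X \<in> regular_families q p. X 1 \<in> {0, int q} \<and> X l \<in> {0, int q}}"
proof -
  have "omega simple l 1 (half_point X) - half_point X \<in> scaled_coweights q \<longleftrightarrow> X 1 \<in> {0, int q} \<and> X l \<in> {0, int q}"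
    if X: "X \<in> regular_families q p" for X
  proof -
    define D where "D i = (if i = 1 \<or> i = l then -1 else 1) * X i - X i" for i
    have "omega simple l 1 (half_point X) - half_point X = half_point (\<lambda>i. (if i = 1 \<or> i = l then -1 else 1) * X (id i) - X i)"
      unfolding omega_1 by (rule signed_perm_half_point_diff) auto
    then have eq: "omega simple l 1 (half_point X) - half_point X = half_point D" by (simp add: D_def[abs_def])
    have range: "0 \<le> X i" "X i < 2 * int q" if "i \<in> {1..l}" for i
      using separated_in[OF X that] by (auto simp: parity_residues_def)
    have "\<not> 2 * int q dvd D 2 - int q"
      using small_multiple[of "2 * int q" "D 2 - int q"] q l4 by (auto simp: D_def)
    then have "\<not> (\<forall>i\<in>{1..l}. 2 * int q dvd D i - int q)" using l4 by (auto intro!: bexI[of _ 2])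
    then have "half_point D \<in> scaled_coweights q \<longleftrightarrow> (\<forall>i\<in>{1..l}. 2 * int q dvd D i)"
      unfolding half_point_in_scaled[OF q] by blast
    also have "\<dots> \<longleftrightarrow> 2 * int q dvd D 1 \<and> 2 * int q dvd D l"
      using l4 by (auto simp: D_def)
    also have "\<dots> \<longleftrightarrow> int q dvd X 1 \<and> int q dvd X l"
    proof -
      have "D 1 = 2 * (- X 1)" "D l = 2 * (- X l)" by (simp_all add: D_def)
      then show ?thesis by (simp only: dvd_mult_cancel_left dvd_minus_iff) simp
    qed
    also have "\<dots> \<longleftrightarrow> X 1 \<in> {0, int q} \<and> X l \<in> {0, int q}"
      using multiples_below_twice[of "int q" "X 1"] multiples_below_twice[of "int q" "X l"]
        range[of 1] range[of l] q l4 by auto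
    finally show ?thesis unfolding eq .
  qed
  then show ?thesis unfolding fixed_families_def by blast
qed

text \<open>The end entries \<open>0\<close> and \<open>q\<close> are distinct and have the same parity, so \<open>q\<close> and all entries are even.\<close>

lemma fixed_families_omega_1_empty:
  assumes q: "0 < q" and "odd q \<or> \<not> p"
  shows "fixed_families q (omega simple l 1) p = {}"
proof -
  have False if X: "X \<in> fixed_families q (omega simple l 1) p" for X
  proof -
    have S: "X \<in> regular_families q p"
      and ends: "X 1 \<in> {0, int q}" "X l \<in> {0, int q}"
      using X unfolding fixed_families_omega_1[OF q] by auto
    have "even (X 1) = p" "even (X l) = p"
      using separated_in[OF S, of 1] separated_in[OF S, of l] l4 by (auto simp: parity_residues_def)
    moreover have "\<not> sign_cong (2 * int q) (X 1) (X l)" using separated_neq[OF S, of 1 l] l4 by auto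
    then have "X 1 \<noteq> X l" by (auto simp: sign_cong_def)
    ultimately show False using ends assms(2) by auto
  qed
  then show ?thesis by blast
qed

text \<open>The ends use up both residues divisible by \<open>q\<close>, so the remaining entries are generic.\<close>

lemma card_separated_fixed_ends:
  assumes q: "0 < q" "even q" and ab: "(a = 0 \<and> b = int q) \<or> (a = int q \<and> b = 0)"
  shows "card {X \<in> regular_families q True. X 1 = a \<and> X l = b} =
    card (separated (sign_cong (2 * int q)) (generic_residues (int q) (int q) True) {2..<l})"
proof -
  let ?R = "sign_cong (2 * int q)" and ?P = "parity_residues (int q) True"
  let ?G = "generic_residues (int q) (int q) True"
  let ?U = "{X \<in> separated ?R ?P {1..l}. X 1 = a \<and> X l = b}"
  have ends: "1 \<noteq> l" "1 \<in> {1..l}" "l \<in> {1..l}" using l4 by auto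
  have mult: "int q dvd a" "int q dvd b" "a \<in> ?P" "b \<in> ?P" using ab q by (auto simp: parity_residues_def)
  have nab: "\<not> ?R a b" "\<not> ?R b a"
    using ab q small_multiple[of "2 * int q" "int q"] small_multiple[of "2 * int q" "- int q"]
    by (auto simp: sign_cong_def)
  have "bij_betw (\<lambda>Y. Y(1 := a, l := b)) (separated ?R ?G {2..<l}) ?U"
  proof (rule bij_betw_byWitness[of _ "\<lambda>X. restrict X {2..<l}"])
    show "\<forall>Y\<in>separated ?R ?G {2..<l}. restrict (Y(1 := a, l := b)) {2..<l} = Y"
    proof
      fix Y assume Y: "Y \<in> separated ?R ?G {2..<l}"
      show "restrict (Y(1 := a, l := b)) {2..<l} = Y"
      proof
        fix i
        show "restrict (Y(1 := a, l := b)) {2..<l} i = Y i"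
          using separated_undefined[OF Y, of i] by (cases "i \<in> {2..<l}") auto
      qed
    qed
    show "\<forall>X\<in>?U. (restrict X {2..<l})(1 := a, l := b) = X"
    proof
      fix X assume X: "X \<in> ?U"
      then have S: "X \<in> separated ?R ?P {1..l}" by blast
      show "(restrict X {2..<l})(1 := a, l := b) = X"
      proof
        fix i
        consider "i = 1" | "i = l" | "i \<in> {2..<l}" | "i \<notin> {1..l}" by force
        then show "((restrict X {2..<l})(1 := a, l := b)) i = X i"
          using separated_undefined[OF S, of i] X ends by cases auto
      qed
    qed
    show "(\<lambda>Y. Y(1 := a, l := b)) ` separated ?R ?G {2..<l} \<subseteq> ?U"
    proof
      fix X assume "X \<in> (\<lambda>Y. Y(1 := a, l := b)) ` separated ?R ?G {2..<l}"
      then obtain Y where Y: "Y \<in> separated ?R ?G {2..<l}" and X: "X = Y(1 := a, l := b)" by blast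
      have mid: "Y i \<in> ?P" "\<not> int q dvd Y i" if "i \<in> {2..<l}" for i
        using separated_in[OF Y that] by (auto simp: generic_residues_def)
      have vals: "X 1 = a" "X l = b" "\<And>i. i \<in> {2..<l} \<Longrightarrow> X i = Y i" using X ends by auto
      have split: "i = 1 \<or> i = l \<or> i \<in> {2..<l}" if "i \<in> {1..l}" for i using that by auto
      have cross: "\<not> ?R (Y i) c" "\<not> ?R c (Y i)" if "i \<in> {2..<l}" "int q dvd c" for i c
      proof -
        show "\<not> ?R (Y i) c" by (rule not_sign_cong_multiple[of "int q"]) (use mid[OF that(1)] that in auto)
        then show "\<not> ?R c (Y i)" using sign_cong_equiv(2) by (metis sympD)
      qed
      have "X \<in> separated ?R ?P {1..l}"
      proof (rule separatedI)
        show "X i \<in> ?P" if "i \<in> {1..l}" for i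
          using split[OF that] mult mid(1) vals by metis
        show "X i = undefined" if "i \<notin> {1..l}" for i
          using separated_undefined[OF Y, of i] that ends unfolding X by auto
        show "\<not> ?R (X i) (X k)" if "i \<in> {1..l}" "k \<in> {1..l}" "i \<noteq> k" for i k
          using split[OF that(1)] split[OF that(2)] that(3) nab cross mult(1,2) vals separated_neq[OF Y, of i k]
          by metis
      qed
      then show "X \<in> ?U" using vals by blast
    qed
    show "(\<lambda>X. restrict X {2..<l}) ` ?U \<subseteq> separated ?R ?G {2..<l}"
    proof
      fix Y assume "Y \<in> (\<lambda>X. restrict X {2..<l}) ` ?U"
      then obtain X where S: "X \<in> separated ?R ?P {1..l}" and X: "X 1 = a" "X l = b"
        and Y: "Y = restrict X {2..<l}" by blast
      show "Y \<in> separated ?R ?G {2..<l}"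
      proof (rule separatedI)
        fix i assume i: "i \<in> {2..<l}"
        then have P: "X i \<in> ?P" using separated_in[OF S, of i] by auto
        have "\<not> ?R (X i) a" "\<not> ?R (X i) b"
          using separated_neq[OF S, of i 1] separated_neq[OF S, of i l] i X ends by auto
        then have "X i \<noteq> 0 \<and> X i \<noteq> int q" using ab by (auto simp: sign_cong_def)
        then show "Y i \<in> ?G"
          using P multiples_below_twice[of "int q" "X i"] q i unfolding Y
          by (auto simp: generic_residues_def parity_residues_def)
      next
        show "Y i = undefined" if "i \<notin> {2..<l}" for i using that unfolding Y by auto
        show "\<not> ?R (Y i) (Y k)" if "i \<in> {2..<l}" "k \<in> {2..<l}" "i \<noteq> k" for i k
          using separated_neq[OF S, of i k] that unfolding Y by auto
      qed
    qed
  qed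
  then show ?thesis by (simp add: bij_betw_same_card)
qed

lemma fixed_count_omega_1_odd:
  assumes "0 < q" "odd q"
  shows "fixed_count roots q (omega simple l 1) = 0"
  using two_fixed_count[OF assms(1) refl_group_even_signed_perm[OF omega_in_refl_group(1)]]
    fixed_families_omega_1_empty[OF assms(1)] assms(2) by simp

lemma fixed_count_omega_1_even:
  assumes q: "0 < q" "even q"
  shows "real (fixed_count roots q (omega simple l 1)) = (\<Prod>i=1..l-2. real q - 2 * real i)"
proof -
  let ?R = "sign_cong (2 * int q)" and ?P = "parity_residues (int q) True"
  let ?G = "generic_residues (int q) (int q) True"
  let ?U = "\<lambda>a b. {X \<in> separated ?R ?P {1..l}. X 1 = a \<and> X l = b}"
  have split: "fixed_families q (omega simple l 1) True = ?U 0 (int q) \<union> ?U (int q) 0"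
  proof -
    have neq: "X 1 \<noteq> X l" if "X \<in> separated ?R ?P {1..l}" for X
    proof -
      have "\<not> ?R (X 1) (X l)" using separated_neq[OF that, of 1 l] l4 by simp
      then show ?thesis unfolding sign_cong_def by fastforce
    qed
    show ?thesis
      unfolding fixed_families_omega_1[OF q(1)]
    proof (rule Set.set_eqI)
      fix X
      show "X \<in> {X \<in> separated ?R ?P {1..l}. X 1 \<in> {0, int q} \<and> X l \<in> {0, int q}} \<longleftrightarrow>
          X \<in> ?U 0 (int q) \<union> ?U (int q) 0"
        using neq[of X] by auto
    qed
  qed
  have disj: "card (?U 0 (int q) \<union> ?U (int q) 0) = card (?U 0 (int q)) + card (?U (int q) 0)"
  proof (rule card_Un_disjoint)
    have "finite (separated ?R ?P {1..l})" by (rule finite_separated) auto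
    then show "finite (?U 0 (int q))" "finite (?U (int q) 0)" by (rule rev_finite_subset, blast)+
    have "int q \<noteq> 0" using q by simp
    then show "?U 0 (int q) \<inter> ?U (int q) 0 = {}" by (simp add: disjoint_iff)
  qed
  have first: "card (?U 0 (int q)) = card (separated ?R ?G {2..<l})"
    by (rule card_separated_fixed_ends[OF q]) simp
  have second: "card (?U (int q) 0) = card (separated ?R ?G {2..<l})"
    by (rule card_separated_fixed_ends[OF q]) simp
  have "card (fixed_families q (omega simple l 1) True) = 2 * card (separated ?R ?G {2..<l})"
    unfolding split disj first second by (rule mult_2[symmetric])
  then have "fixed_count roots q (omega simple l 1) = card (separated ?R ?G {2..<l})"
    using two_fixed_count[OF q(1) refl_group_even_signed_perm[OF omega_in_refl_group(1)]]
      fixed_families_omega_1_empty[OF q(1), of False] by simp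
  then show ?thesis
    using card_separated_generic_2[of "int q" "{2..<l}" True] real_card_generic_residues_2[of "int q" True] q
    by (simp add: prod.atLeast1_atMost_eq algebra_simps)
qed

text \<open>
  For a fixed family the sums of an entry and its mirror image are all \<open>0\<close> or all \<open>q\<close> modulo
  \<open>2 * q\<close>, and \<open>0\<close> would contradict inequivalence.
\<close>

lemma fixed_families_omega_l:
  assumes q: "0 < q"
  shows "fixed_families q (omega simple l l) p =
    {X \<in> regular_families q p.
      \<forall>i\<in>{1..l}. 2 * int q dvd X i + X (flip i) - int q}"
proof -
  have "omega simple l l (half_point X) - half_point X \<in> scaled_coweights q \<longleftrightarrow>
      (\<forall>i\<in>{1..l}. 2 * int q dvd X i + X (flip i) - int q)"
    if X: "X \<in> regular_families q p" for X
  proof -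
    define D where "D i = - X (flip i) - X i" for i
    have "omega simple l l (half_point X) - half_point X = half_point (\<lambda>i. (- 1) * X (flip i) - X i)"
      unfolding omega_l by (rule signed_perm_half_point_diff[OF _ flip_in]) auto
    then have eq: "omega simple l l (half_point X) - half_point X = half_point D" by (simp add: D_def[abs_def])
    have "\<not> sign_cong (2 * int q) (X 1) (X (flip 1))"
      using separated_neq[OF X, of 1 "flip 1"] l4 by (auto simp: flip_def)
    then have "\<not> 2 * int q dvd X 1 + X (flip 1)" by (simp add: sign_cong_def)
    moreover have "D 1 = - (X 1 + X (flip 1))" by (simp add: D_def)
    ultimately have "\<not> 2 * int q dvd D 1" by (simp only: dvd_minus_iff not_False_eq_True)
    then have "\<not> (\<forall>i\<in>{1..l}. 2 * int q dvd D i)" using l4 by (auto intro!: bexI[of _ 1])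
    then have "half_point D \<in> scaled_coweights q \<longleftrightarrow> (\<forall>i\<in>{1..l}. 2 * int q dvd D i - int q)"
      unfolding half_point_in_scaled[OF q] by blast
    also have "\<dots> \<longleftrightarrow> (\<forall>i\<in>{1..l}. 2 * int q dvd X i + X (flip i) - int q)"
    proof (rule ball_cong[OF HOL.refl])
      fix i
      have "X i + X (flip i) - int q = - (D i - int q) - 2 * int q" by (simp add: D_def)
      then show "2 * int q dvd D i - int q \<longleftrightarrow> 2 * int q dvd X i + X (flip i) - int q"
        by (metis dvd_diff_left_iff dvd_minus_iff dvd_refl)
    qed
    finally show ?thesis unfolding eq .
  qed
  then show ?thesis unfolding fixed_families_def by blast
qed

lemma fixed_families_omega_l_odd:
  assumes q: "0 < q" "odd q"
  shows "fixed_families q (omega simple l l) p = {}"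
proof -
  have False if X: "X \<in> fixed_families q (omega simple l l) p" for X
  proof -
    have S: "X \<in> regular_families q p"
      and d: "2 * int q dvd X 1 + X (flip 1) - int q"
      using X l4 unfolding fixed_families_omega_l[OF q(1)] by auto
    have "even (X 1) = p" "even (X (flip 1)) = p"
      using separated_in[OF S, of 1] separated_in[OF S, of "flip 1"] flip_in[of 1] l4
      by (auto simp: parity_residues_def)
    then have "even (X 1 + X (flip 1))" by simp
    moreover have "even (X 1 + X (flip 1) - int q)" using d dvd_mult_left by blast
    ultimately show False using q(2) by simp
  qed
  then show ?thesis by blast
qed

text \<open>
  A fixed family is determined by its first half.  An entry is equivalent modulo \<open>2 * q = 4 * h\<close> to
  another entry or to the mirror image of that entry exactly when the two entries are equivalent
  modulo \<open>q = 2 * h\<close>, and it is inequivalent to its own mirror image exactly when it is unbalanced.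
\<close>

lemma card_fixed_families_omega_l:
  assumes h: "0 < h"
  shows "card (fixed_families (2 * h) (omega simple l l) p) =
    card (separated (sign_cong (2 * int h)) (unbalanced_residues (int h) p) {1..l div 2})"
proof -
  let ?q = "2 * int h" and ?m = "l div 2"
  let ?R = "sign_cong (2 * ?q)" and ?P = "parity_residues ?q p"
  let ?R' = "sign_cong ?q" and ?A = "unbalanced_residues (int h) p"
  let ?F = "{X \<in> separated ?R ?P {1..l}. \<forall>i\<in>{1..l}. 2 * ?q dvd X i + X (flip i) - ?q}"
  have m: "l = 2 * ?m" using even_l by simp
  have first: "i \<in> {1..l}" "flip i \<in> {1..l}" "flip i \<notin> {1..?m}" if "i \<in> {1..?m}" for i
    using that m by (auto simp: flip_def)
  have second: "flip i \<in> {1..?m}" if "i \<in> {1..l}" "i \<notin> {1..?m}" for i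
    using that m by (auto simp: flip_def)
  have P: "0 \<le> a \<and> a < 2 * ?q \<and> even a = p \<longleftrightarrow> a \<in> ?P" for a by (auto simp: parity_residues_def)
  have dvd2: "?q dvd c" if "2 * ?q dvd c" for c using that by (rule dvd_mult_right)
  define ext where "ext Y i = (if i \<in> {1..?m} then Y i else
      if i \<in> {1..l} then (?q - Y (flip i)) mod (2 * ?q) else undefined)" for Y :: "nat \<Rightarrow> int" and i
  have "bij_betw ext (separated ?R' ?A {1..?m}) ?F"
  proof (rule bij_betw_byWitness[of _ "\<lambda>X. restrict X {1..?m}"])
    show "\<forall>Y\<in>separated ?R' ?A {1..?m}. restrict (ext Y) {1..?m} = Y"
    proof
      fix Y assume Y: "Y \<in> separated ?R' ?A {1..?m}"
      show "restrict (ext Y) {1..?m} = Y"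
      proof
        fix i
        show "restrict (ext Y) {1..?m} i = Y i"
          using separated_undefined[OF Y, of i] by (cases "i \<in> {1..?m}") (auto simp: ext_def)
      qed
    qed
    show "\<forall>X\<in>?F. ext (restrict X {1..?m}) = X"
    proof
      fix X assume X: "X \<in> ?F"
      then have S: "X \<in> separated ?R ?P {1..l}" by blast
      show "ext (restrict X {1..?m}) = X"
      proof
        fix i
        consider "i \<in> {1..?m}" | "i \<in> {1..l}" "i \<notin> {1..?m}" | "i \<notin> {1..l}" by blast
        then show "ext (restrict X {1..?m}) i = X i"
        proof cases
          case 1
          then show ?thesis by (simp add: ext_def)
        next
          case 2
          have "2 * ?q dvd X i + X (flip i) - ?q" using X 2(1) by blast
          then have "2 * ?q dvd (?q - X (flip i)) - X i" by (metis diff_diff_eq dvd_diff_commute add.commute diff_diff_eq2)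
          then have "(?q - X (flip i)) mod (2 * ?q) = X i mod (2 * ?q)" by (simp add: mod_eq_dvd_iff)
          moreover have "0 \<le> X i" "X i < 2 * ?q" using separated_in[OF S 2(1)] P by blast+
          ultimately show ?thesis using 2 second[OF 2] by (simp add: ext_def)
        next
          case 3
          then show ?thesis using separated_undefined[OF S 3] first(1) by (auto simp: ext_def)
        qed
      qed
    qed
    show "ext ` separated ?R' ?A {1..?m} \<subseteq> ?F"
    proof
      fix X assume "X \<in> ext ` separated ?R' ?A {1..?m}"
      then obtain Y where Y: "Y \<in> separated ?R' ?A {1..?m}" and X: "X = ext Y" by blast
      have YP: "Y i \<in> ?P" "\<not> 2 * ?q dvd 2 * Y i - ?q" if "i \<in> {1..?m}" for i
        using separated_in[OF Y that] by (auto simp: unbalanced_residues_def)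
      have X1: "X i = Y i" if "i \<in> {1..?m}" for i using that by (simp add: X ext_def)
      have X2: "2 * ?q dvd X i + Y (flip i) - ?q" if "i \<in> {1..l}" "i \<notin> {1..?m}" for i
      proof -
        have "2 * ?q dvd X i - (?q - Y (flip i))"
          using that by (simp add: X ext_def mod_eq_dvd_iff[symmetric])
        then show ?thesis by (simp add: algebra_simps)
      qed
      have mirror: "2 * ?q dvd X i + X (flip i) - ?q" if i: "i \<in> {1..l}" for i
      proof (cases "i \<in> {1..?m}")
        case True
        then show ?thesis using X2[of "flip i"] first[OF True] X1[OF True] by (simp add: add.commute)
      next
        case False
        then show ?thesis using X2[OF i False] X1[OF second[OF i False]] by simp
      qed
      \<comment> \<open>The index in the first half that determines the entry at \<open>i\<close>.\<close>
      define r where "r i = (if i \<in> {1..?m} then i else flip i)" for i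
      have r: "r i \<in> {1..?m}" if "i \<in> {1..l}" for i using second[OF that] by (simp add: r_def)
      have Xr: "?R' (X i) (Y (r i))" if i: "i \<in> {1..l}" for i
      proof (cases "i \<in> {1..?m}")
        case True
        then show ?thesis using X1[OF True] by (simp add: r_def sign_cong_def)
      next
        case False
        have "?q dvd (X i + Y (flip i) - ?q) + ?q" using dvd2[OF X2[OF i False]] by (intro dvd_add) auto
        then have "?q dvd X i + Y (flip i)" by simp
        moreover have "r i = flip i" unfolding r_def by (rule if_not_P[OF False])
        ultimately show ?thesis unfolding sign_cong_def by simp
      qed
      have unbal: "\<not> 2 * ?q dvd 2 * X i - ?q" if i: "i \<in> {1..?m}" for i
        using YP(2)[OF i] X1[OF i] by simp
      have self: "\<not> ?R (X i) (X (flip i))" if i: "i \<in> {1..?m}" for i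
      proof
        have mi: "2 * ?q dvd X i + X (flip i) - ?q" using mirror first(1)[OF i] by blast
        assume "?R (X i) (X (flip i))"
        then show False unfolding sign_cong_def
        proof
          assume "2 * ?q dvd X i - X (flip i)"
          then have "2 * ?q dvd (X i + X (flip i) - ?q) + (X i - X (flip i))" by (rule dvd_add[OF mi])
          then show False using unbal[OF i] by (simp add: algebra_simps)
        next
          assume "2 * ?q dvd X i + X (flip i)"
          then have "2 * ?q dvd (X i + X (flip i)) - (X i + X (flip i) - ?q)" using mi by (rule dvd_diff)
          then show False using small_multiple[of "2 * ?q" ?q] h by auto
        qed
      qed
      have "X \<in> separated ?R ?P {1..l}"
      proof (rule separatedI)
        fix i assume i: "i \<in> {1..l}"
        show "X i \<in> ?P"
        proof (cases "i \<in> {1..?m}")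
          case True
          then show ?thesis using YP(1) X1 by simp
        next
          case False
          have "even (Y (flip i)) = p" using YP(1)[OF second[OF i False]] P by blast
          moreover have "even (X i + Y (flip i) - ?q)" using X2[OF i False] dvd_mult_left by blast
          then have "even (X i) = even (Y (flip i))" by simp
          moreover have "0 \<le> X i" "X i < 2 * ?q" using False i h by (simp_all add: X ext_def)
          ultimately show ?thesis using P by blast
        qed
      next
        fix i assume "i \<notin> {1..l}"
        then show "X i = undefined" using first(1)[of i] by (auto simp: X ext_def)
      next
        fix i k assume ik: "i \<in> {1..l}" "k \<in> {1..l}" "i \<noteq> k"
        show "\<not> ?R (X i) (X k)"
        proof
          assume R: "?R (X i) (X k)"
          then have "?R' (X i) (X k)" using dvd2 unfolding sign_cong_def by blast
          then have "?R' (Y (r i)) (Y (r k))"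
            using Xr[OF ik(1)] Xr[OF ik(2)] sign_cong_equiv(2,3)[of ?q] by (meson sympD transpD)
          then have eq: "r i = r k" using separated_neq[OF Y r[OF ik(1)] r[OF ik(2)]] by blast
          have "(i \<in> {1..?m} \<and> k = flip i) \<or> (k \<in> {1..?m} \<and> i = flip k)"
            using eq ik(3) second[OF ik(1)] second[OF ik(2)] flip_flip unfolding r_def by metis
          then show False using self R sign_cong_equiv(2)[of "2 * ?q"] by (metis sympD)
        qed
      qed
      then show "X \<in> ?F" using mirror by blast
    qed
    show "(\<lambda>X. restrict X {1..?m}) ` ?F \<subseteq> separated ?R' ?A {1..?m}"
    proof
      fix Y assume "Y \<in> (\<lambda>X. restrict X {1..?m}) ` ?F"
      then obtain X where S: "X \<in> separated ?R ?P {1..l}" and Y: "Y = restrict X {1..?m}"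
        and mirror: "\<And>i. i \<in> {1..l} \<Longrightarrow> 2 * ?q dvd X i + X (flip i) - ?q" by blast
      have neq: "\<not> 2 * ?q dvd X i - X k" "\<not> 2 * ?q dvd X i + X k" if "i \<in> {1..l}" "k \<in> {1..l}" "i \<noteq> k" for i k
        using separated_neq[OF S that] by (auto simp: sign_cong_def)
      have cases2: "2 * ?q dvd c \<or> 2 * ?q dvd c - ?q" if "?q dvd c" for c
      proof -
        obtain n where n: "c = ?q * n" using \<open>?q dvd c\<close> by blast
        show ?thesis
        proof (cases "even n")
          case True
          then show ?thesis unfolding n by (elim evenE) simp
        next
          case False
          then show ?thesis unfolding n by (elim oddE) (simp add: algebra_simps)
        qed
      qed
      show "Y \<in> separated ?R' ?A {1..?m}"
      proof (rule separatedI)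
        fix i assume i: "i \<in> {1..?m}"
        have "\<not> 2 * ?q dvd 2 * X i - ?q"
        proof
          assume "2 * ?q dvd 2 * X i - ?q"
          then have "2 * ?q dvd (2 * X i - ?q) - (X i + X (flip i) - ?q)"
            using mirror[OF first(1)[OF i]] by (rule dvd_diff)
          then have "2 * ?q dvd X i - X (flip i)" by (simp add: algebra_simps)
          moreover have "i \<noteq> flip i" using first(3)[OF i] i by metis
          ultimately show False using neq(1)[OF first(1,2)[OF i]] by blast
        qed
        then show "Y i \<in> ?A" using separated_in[OF S first(1)[OF i]] i by (simp add: Y unbalanced_residues_def)
      next
        fix i assume "i \<notin> {1..?m}"
        then show "Y i = undefined" by (auto simp: Y)
      next
        fix i k assume ik: "i \<in> {1..?m}" "k \<in> {1..?m}" "i \<noteq> k"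
        have mem: "i \<in> {1..l}" "k \<in> {1..l}" "flip k \<in> {1..l}" "i \<noteq> flip k"
          using first[OF ik(1)] first[OF ik(2)] ik(1) by metis+
        have "\<not> ?R' (X i) (X k)"
        proof
          assume "?R' (X i) (X k)"
          then show False unfolding sign_cong_def
          proof
            assume "?q dvd X i - X k"
            then have "2 * ?q dvd (X i - X k) - ?q" using cases2 neq(1)[OF mem(1,2) ik(3)] by blast
            then have "2 * ?q dvd (X i - X k - ?q) + (X k + X (flip k) - ?q)"
              using mirror[OF mem(2)] by (rule dvd_add)
            then have "2 * ?q dvd (X i - X k - ?q) + (X k + X (flip k) - ?q) + 2 * ?q"
              by (rule dvd_add) simp
            then show False using neq(2)[OF mem(1,3,4)] by (simp add: algebra_simps)
          next
            assume "?q dvd X i + X k"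
            then have "2 * ?q dvd (X i + X k) - ?q" using cases2 neq(2)[OF mem(1,2) ik(3)] by blast
            then have "2 * ?q dvd (X i + X k - ?q) - (X k + X (flip k) - ?q)"
              using mirror[OF mem(2)] by (rule dvd_diff)
            then show False using neq(1)[OF mem(1,3,4)] by (simp add: algebra_simps)
          qed
        qed
        then show "\<not> ?R' (Y i) (Y k)" using ik by (simp add: Y)
      qed
    qed
  qed
  then have "card (separated ?R' ?A {1..?m}) = card ?F" by (rule bij_betw_same_card)
  moreover have "fixed_families (2 * h) (omega simple l l) p = ?F"
    using fixed_families_omega_l[of "2 * h" p] h by simp
  ultimately show ?thesis by simp
qed

lemma fixed_count_omega_l_odd:
  assumes "0 < q" "odd q"
  shows "fixed_count roots q (omega simple l l) = 0"
  using two_fixed_count[OF assms(1) refl_group_even_signed_perm[OF omega_in_refl_group(3)]]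
    fixed_families_omega_l_odd[OF assms] by simp

lemma fixed_count_omega_l_even:
  assumes h: "0 < h"
  shows "real (fixed_count roots (2 * h) (omega simple l l)) =
    (if odd h then (real (2 * h) - (3 * real l / 2 - 2)) * (\<Prod>i=1..l div 2 - 1. real (2 * h) - (4 * real i - 2))
     else (real (2 * h) - real l / 2) * (\<Prod>i=1..l div 2 - 1. real (2 * h) - 4 * real i))"
proof -
  define m where "m = l div 2"
  have m: "0 < m" "real l = 2 * real m" using l4 even_l by (auto simp: m_def)
  have "2 * fixed_count roots (2 * h) (omega simple l l) =
      card (separated (sign_cong (2 * int h)) (unbalanced_residues (int h) True) {1..m}) +
      card (separated (sign_cong (2 * int h)) (unbalanced_residues (int h) False) {1..m})"
    using two_fixed_count[OF _ refl_group_even_signed_perm[OF omega_in_refl_group(3)], of "2 * h"]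
      card_fixed_families_omega_l[OF h] h by (simp add: m_def)
  then have "2 * real (fixed_count roots (2 * h) (omega simple l l)) =
      real (card (separated (sign_cong (2 * int h)) (unbalanced_residues (int h) True) {1..m})) +
      real (card (separated (sign_cong (2 * int h)) (unbalanced_residues (int h) False) {1..m}))"
    by (metis of_nat_add of_nat_mult of_nat_numeral)
  then show ?thesis
    using card_separated_unbalanced_even[of "int h" m] card_separated_unbalanced_odd[of "int h" m] h m
    unfolding m_def[symmetric] by (cases "odd h") (simp_all add: algebra_simps)
qed

end

context type_D
begin

text \<open>
  Changing the sign of the last coordinate is the diagram automorphism exchanging the last two simple
  roots.  It preserves the roots, hence the coweight lattice and the toric complement.
\<close>

definition last_sign_change :: "'a \<Rightarrow> 'a" where
  "last_sign_change = signed_perm id (\<lambda>i. if i = l then -1 else 1)"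

lemma last_sign_change_involution: "last_sign_change (last_sign_change x) = x"
  unfolding last_sign_change_def by (rule signed_perm_involution) auto

lemma linear_last_sign_change: "linear last_sign_change"
  unfolding last_sign_change_def
  by (intro linearI coord_eqI) (simp_all add: inner_add_left algebra_simps)

lemma last_sign_change_inner: "x \<bullet> last_sign_change y = last_sign_change x \<bullet> y"
proof -
  have "(\<Sum>i\<in>{1..l}. (x \<bullet> e i) * (last_sign_change y \<bullet> e i)) =
      (\<Sum>i\<in>{1..l}. (last_sign_change x \<bullet> e i) * (y \<bullet> e i))"
    by (rule sum.cong) (simp_all add: last_sign_change_def)
  then show ?thesis using inner_coords[of x "last_sign_change y"] inner_coords[of "last_sign_change x" y] by metis
qed

lemma last_sign_change_roots:
  assumes "\<beta> \<in> roots"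
  shows "last_sign_change \<beta> \<in> roots"
proof -
  obtain a b i k where \<beta>: "\<beta> = a *\<^sub>R e i + b *\<^sub>R e k" and ab: "a \<in> {1, -1}" "b \<in> {1, -1}"
    and ik: "i \<in> {1..l}" "k \<in> {1..l}" "i \<noteq> k"
    using assms unfolding roots_signs by blast
  define s :: "nat \<Rightarrow> real" where "s j = (if j = l then -1 else 1)" for j
  have e: "last_sign_change (e j) = s j *\<^sub>R e j" if "j \<in> {1..l}" for j
    using signed_perm_e[OF that, of id] by (simp add: last_sign_change_def s_def)
  have "last_sign_change \<beta> = (a * s i) *\<^sub>R e i + (b * s k) *\<^sub>R e k"
    using e ik by (simp add: \<beta> linear_add[OF linear_last_sign_change] linear_scale[OF linear_last_sign_change])
  moreover have "a * s i \<in> {1, -1}" "b * s k \<in> {1, -1}" using ab by (auto simp: s_def)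
  ultimately show ?thesis unfolding roots_signs using ik by blast
qed

lemma last_sign_change_coweights: "x \<in> coweights \<Longrightarrow> last_sign_change x \<in> coweights"
  unfolding coweight_lattice_def by (simp add: last_sign_change_inner last_sign_change_roots)

lemma last_sign_change_toric_complement:
  assumes "t \<in> toric_complement roots q"
  shows "last_sign_change ` t \<in> toric_complement roots q"
proof -
  let ?\<tau> = last_sign_change
  obtain x where x: "t = x +o scaled_coweights q" "x \<in> coweights" "regular q x"
    using assms unfolding toric_complement_def regular_def by blast
  have sub: "?\<tau> ` scaled_coweights q \<subseteq> scaled_coweights q"
  proof (rule image_subsetI)
    fix y assume "y \<in> scaled_coweights q"
    then obtain z where "z \<in> coweights" "y = real q *\<^sub>R z" by blast
    then show "?\<tau> y \<in> scaled_coweights q"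
      using last_sign_change_coweights linear_scale[OF linear_last_sign_change] by blast
  qed
  have "y \<in> ?\<tau> ` scaled_coweights q" if "y \<in> scaled_coweights q" for y
    using sub that last_sign_change_involution[of y] by (intro image_eqI[of y ?\<tau> "?\<tau> y"]) auto
  then have "?\<tau> ` scaled_coweights q = scaled_coweights q" using sub by blast
  then have "?\<tau> ` t = ?\<tau> x +o scaled_coweights q"
    using linear_image_coset[OF linear_last_sign_change] x(1) by blast
  moreover have "regular q (?\<tau> x)"
    using x(3) last_sign_change_roots unfolding regular_def by (simp add: last_sign_change_inner)
  ultimately show ?thesis
    using last_sign_change_coweights[OF x(2)] unfolding toric_complement_def regular_def by blast
qed

lemma fixed_count_last_sign_change:
  "fixed_count roots q (last_sign_change \<circ> w \<circ> last_sign_change) = fixed_count roots q w"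
proof -
  let ?\<tau> = last_sign_change
  have inv: "?\<tau> ` ?\<tau> ` t = t" for t by (simp add: image_image last_sign_change_involution)
  have "bij_betw ((`) ?\<tau>) {t \<in> toric_complement roots q. w ` t = t}
      {t \<in> toric_complement roots q. (?\<tau> \<circ> w \<circ> ?\<tau>) ` t = t}"
  proof (rule bij_betw_byWitness[of _ "(`) ?\<tau>"])
    show "(`) ?\<tau> ` {t \<in> toric_complement roots q. w ` t = t}
        \<subseteq> {t \<in> toric_complement roots q. (?\<tau> \<circ> w \<circ> ?\<tau>) ` t = t}"
    proof (rule image_subsetI)
      fix t assume "t \<in> {t \<in> toric_complement roots q. w ` t = t}"
      then have t: "t \<in> toric_complement roots q" "w ` t = t" by auto
      have "(?\<tau> \<circ> w \<circ> ?\<tau>) ` ?\<tau> ` t = ?\<tau> ` w ` ?\<tau> ` ?\<tau> ` t"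
        by (simp only: image_comp comp_assoc)
      then show "?\<tau> ` t \<in> {t \<in> toric_complement roots q. (?\<tau> \<circ> w \<circ> ?\<tau>) ` t = t}"
        using last_sign_change_toric_complement[OF t(1)] by (simp only: inv t(2) mem_Collect_eq)
    qed
    show "(`) ?\<tau> ` {t \<in> toric_complement roots q. (?\<tau> \<circ> w \<circ> ?\<tau>) ` t = t}
        \<subseteq> {t \<in> toric_complement roots q. w ` t = t}"
    proof (rule image_subsetI)
      fix t assume "t \<in> {t \<in> toric_complement roots q. (?\<tau> \<circ> w \<circ> ?\<tau>) ` t = t}"
      then have t: "t \<in> toric_complement roots q" "?\<tau> ` w ` ?\<tau> ` t = t"
        by (simp_all only: image_comp comp_assoc mem_Collect_eq)
      then have "w ` ?\<tau> ` t = ?\<tau> ` t" using inv by metis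
      then show "?\<tau> ` t \<in> {t \<in> toric_complement roots q. w ` t = t}"
        using last_sign_change_toric_complement[OF t(1)] by simp
    qed
  qed (use inv in auto)
  then show ?thesis unfolding fixed_count_def by (simp add: bij_betw_same_card)
qed

end

context type_D_even
begin

lemma fixed_count_omega_l1: "fixed_count roots q (omega simple l (l - 1)) = fixed_count roots q (omega simple l l)"
proof -
  have "omega simple l (l - 1) = last_sign_change \<circ> omega simple l l \<circ> last_sign_change"
  proof (rule ext, rule coord_eqI)
    fix x i assume i: "i \<in> {1..l}"
    then show "omega simple l (l - 1) x \<bullet> e i = (last_sign_change \<circ> omega simple l l \<circ> last_sign_change) x \<bullet> e i"
      using l4 flip_in[OF i] unfolding omega_l1 omega_l last_sign_change_def by (auto simp: flip_def)
  qed
  then show ?thesis using fixed_count_last_sign_change by simp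
qed

end

section \<open>The counts of fixed points\<close>

theorem theorem5p6:
  fixes e :: "nat \<Rightarrow> 'a::euclidean_space" and l q :: nat and \<omega> :: "'a \<Rightarrow> 'a"
  defines "\<Phi> \<equiv> D_roots e l" and "\<alpha> \<equiv> D_simple e l"
  assumes "4 \<le> l" and "even l" and "bij_betw e {1..l} Basis"
    and "0 < q"
    and "\<omega> \<in> alcove_stabilizer \<Phi> \<alpha> l"
  shows "alcove_stabilizer \<Phi> \<alpha> l = {id, omega \<alpha> l 1, omega \<alpha> l (l - 1), omega \<alpha> l l} \<and>
    (\<omega> = id \<and> odd q \<longrightarrow>
       real (fixed_count \<Phi> q \<omega>) =
         (\<Prod>i=1..l-1. real q - (2 * real i - 1)) * (real q - (real l - 1))) \<and>
    (\<omega> = id \<and> even q \<longrightarrow>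
       real (fixed_count \<Phi> q \<omega>) =
         (\<Prod>i=1..l-2. real q - 2 * real i) *
         ((real q)\<^sup>2 - 2 * (real l - 1) * real q + real l * (real l - 1) / 2)) \<and>
    (\<omega> = omega \<alpha> l 1 \<and> odd q \<longrightarrow> fixed_count \<Phi> q \<omega> = 0) \<and>
    (\<omega> = omega \<alpha> l 1 \<and> even q \<longrightarrow>
       real (fixed_count \<Phi> q \<omega>) = (\<Prod>i=1..l-2. real q - 2 * real i)) \<and>
    (\<omega> \<in> {omega \<alpha> l (l - 1), omega \<alpha> l l} \<and> gcd 4 q = 1 \<longrightarrow> fixed_count \<Phi> q \<omega> = 0) \<and>
    (\<omega> \<in> {omega \<alpha> l (l - 1), omega \<alpha> l l} \<and> gcd 4 q = 2 \<longrightarrow>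
       real (fixed_count \<Phi> q \<omega>) =
         (real q - (3 * real l / 2 - 2)) * (\<Prod>i=1..l div 2 - 1. real q - (4 * real i - 2))) \<and>
    (\<omega> \<in> {omega \<alpha> l (l - 1), omega \<alpha> l l} \<and> gcd 4 q = 4 \<longrightarrow>
       real (fixed_count \<Phi> q \<omega>) =
         (real q - real l / 2) * (\<Prod>i=1..l div 2 - 1. real q - 4 * real i))"
proof -
  interpret type_D_even e l by unfold_locales fact+
  have last: "fixed_count roots q \<omega> = fixed_count roots q (omega simple l l)"
    if "\<omega> \<in> {omega simple l (l - 1), omega simple l l}"
    using that fixed_count_omega_l1 by auto
  have gcd1: "odd q" if "gcd 4 q = 1"
  proof
    assume "even q"
    then have "2 dvd gcd 4 q" by simp
    then show False using that by simp
  qed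
  have gcd2: "\<exists>h. q = 2 * h \<and> odd h" if g: "gcd 4 q = 2"
  proof -
    have "2 dvd q" using g by (metis gcd_dvd2)
    then obtain h where h: "q = 2 * h" by blast
    moreover have "odd h"
    proof
      assume "even h"
      then have "4 dvd q" using h by auto
      then show False using g by simp
    qed
    ultimately show ?thesis by blast
  qed
  have gcd4: "\<exists>h. q = 2 * h \<and> even h" if g: "gcd 4 q = 4"
  proof -
    have "4 dvd q" using g by (metis gcd_dvd2)
    then obtain k where "q = 4 * k" by blast
    then show ?thesis by (intro exI[of _ "2 * k"]) auto
  qed
  note q = \<open>0 < q\<close>
  show ?thesis
    unfolding \<Phi>_def \<alpha>_def
  proof (intro conjI impI)
    show "alcove_stabilizer roots simple l = {id, omega simple l 1, omega simple l (l - 1), omega simple l l}"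
      by (rule alcove_stabilizer_eq)
  next
    assume "\<omega> = id \<and> odd q"
    then show "real (fixed_count roots q \<omega>) = (\<Prod>i=1..l-1. real q - (2 * real i - 1)) * (real q - (real l - 1))"
      using fixed_count_id_odd[OF q] by (elim conjE) simp
  next
    assume "\<omega> = id \<and> even q"
    then show "real (fixed_count roots q \<omega>) = (\<Prod>i=1..l-2. real q - 2 * real i) *
         ((real q)\<^sup>2 - 2 * (real l - 1) * real q + real l * (real l - 1) / 2)"
      using fixed_count_id_even[OF q] by (elim conjE) simp
  next
    assume "\<omega> = omega simple l 1 \<and> odd q"
    then show "fixed_count roots q \<omega> = 0" using fixed_count_omega_1_odd[OF q] by (elim conjE) simp
  next
    assume "\<omega> = omega simple l 1 \<and> even q"
    then show "real (fixed_count roots q \<omega>) = (\<Prod>i=1..l-2. real q - 2 * real i)"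
      using fixed_count_omega_1_even[OF q] by (elim conjE) simp
  next
    assume "\<omega> \<in> {omega simple l (l - 1), omega simple l l} \<and> gcd 4 q = 1"
    then show "fixed_count roots q \<omega> = 0" using last fixed_count_omega_l_odd[OF q gcd1] by auto
  next
    assume a: "\<omega> \<in> {omega simple l (l - 1), omega simple l l} \<and> gcd 4 q = 2"
    then obtain h where "q = 2 * h" "odd h" using gcd2 by blast
    then show "real (fixed_count roots q \<omega>) =
         (real q - (3 * real l / 2 - 2)) * (\<Prod>i=1..l div 2 - 1. real q - (4 * real i - 2))"
      using last a fixed_count_omega_l_even[of h] q by simp
  next
    assume a: "\<omega> \<in> {omega simple l (l - 1), omega simple l l} \<and> gcd 4 q = 4"
    then obtain h where "q = 2 * h" "even h" using gcd4 by blast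
    then show "real (fixed_count roots q \<omega>) =
         (real q - real l / 2) * (\<Prod>i=1..l div 2 - 1. real q - 4 * real i)"
      using last a fixed_count_omega_l_even[of h] q by simp
  qed
qed

end
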